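(* Let $f\in\mathcal W_{[1]}$ be a $C^3$ circle map with a flat piece $U$, Fibonacci rotation number and critical exponents $(\ell_1,\ell_2)\in(1,2)^2$. Then the scaling ratios $\alpha_n$ go to zero double exponentially fast, i.e. there exist $\kappa\in(0,1)$ and $\lambda>1$ such that $\alpha_n\le\kappa^{\lambda^n}$ for all $n$ large enough.
   Context: **The class of maps.** Fix $\ell_1,\ell_2>1$. $\mathscr L$ is the set of tuples $f=(x_1,x_2,x_3,x_4,s,\varphi,\varphi^l,\varphi^r)$ with $x_1<0<x_3<x_4<1$, $0<x_2<1$, $0<s<1$ and $\varphi,\varphi^l,\varphi^r$ orientation-preserving $C^3$ diffeomorphisms of $[0,1]$. Such a tuple is identified with the circle map $f:[x_1,1]\to[x_1,1]$ (the points $x_1$ and $1$ being identified, so $[x_1,1]$ is a circle; lengths are measured in this coordinate) given by $f(x)=(1-x_2)\,q_s\big(\varphi(\tfrac{x_1-x}{x_1})\big)+x_2$ for $x\in[x_1,0)$; $f(x)=x_1\big(\varphi^l(\tfrac{x_3-x}{x_3})\big)^{\ell_1}$ for $x\in(0,x_3]$; $f(x)=0$ for $x\in[x_3,x_4]$; $f(x)=x_2\big(\varphi^r(\tfrac{x-x_4}{1-x_4})\big)^{\ell_2}$ for $x\in[x_4,1]$; here $q_s(x)=\frac{[(1-s)x+s]^{\ell_2}-s^{\ell_2}}{1-s^{\ell_2}}$, and $f(0)$ is the point $x_1\sim 1$. The pair $(\ell_1,\ell_2)$ is the pair of critical exponents, and $U=U_f=(x_3,x_4)$ is the flat piece. The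 rotation number is $\rho(f)=\lim_n (F^n(x)-x)/n \pmod 1$ for a lift $F$. $\mathcal W_{[1]}$ is the set of $f\in\mathscr L$ with Fibonacci (golden mean) rotation number, i.e. $\rho(f)=\frac{1}{1+\frac{1}{1+\cdots}}$, and negative Schwarzian derivative: $\frac{D^3f(x)}{Df(x)}-\frac32\big(\frac{D^2f(x)}{Df(x)}\big)^2<0$ whenever $Df(x)\ne0$. **Scaling ratios.** $q_0=q_1=1$, $q_{n+1}=q_n+q_{n-1}$. For $i\in\mathbb Z$, $\underline i=f^i(U)$ (a preimage interval if $i<0$, a point if $i>0$); $|(\underline i,\underline j)|$ is the distance between the closest endpoints of $\underline i$ and $\underline j$, and $|[\underline i,\underline j)|=|\underline i|+|(\underline i,\underline j)|$. Then $\alpha_n=\dfrac{|(\underline{-q_n},\underline0)|}{|[\underline{-q_n},\underline0)|}$. *)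

theory Defs
  imports "HOL-Analysis.Analysis" "HOL-Number_Theory.Fib"
begin

definition C3_on :: "real set \<Rightarrow> (real \<Rightarrow> real) \<Rightarrow> bool" where
  "C3_on S g \<longleftrightarrow>
     (\<exists>D :: nat \<Rightarrow> real \<Rightarrow> real.
        (\<forall>x\<in>S. D 0 x = g x) \<and>
        (\<forall>i<3. \<forall>x\<in>S. (D i has_real_derivative D (Suc i) x) (at x within S)) \<and>
        continuous_on S (D 3))"

text \<open>Values of \<open>g\<close> outside \<open>[0,1]\<close> are irrelevant; derivatives at \<open>0\<close> and \<open>1\<close> are one-sided.\<close>

definition C3_diffeo :: "(real \<Rightarrow> real) \<Rightarrow> bool" where
  "C3_diffeo g \<longleftrightarrow>
     bij_betw g {0..1} {0..1} \<and> strict_mono_on {0..1} g \<and>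
     C3_on {0..1} g \<and> C3_on {0..1} (inv_into {0..1} g)"

record flat_tuple =
  x\<^sub>1 :: real
  x\<^sub>2 :: real
  x\<^sub>3 :: real
  x\<^sub>4 :: real
  s_par :: real
  phi :: "real \<Rightarrow> real"
  phi_l :: "real \<Rightarrow> real"
  phi_r :: "real \<Rightarrow> real"

definition class_L :: "flat_tuple set" where
  "class_L = {f.
     x\<^sub>1 f < 0 \<and> 0 < x\<^sub>3 f \<and> x\<^sub>3 f < x\<^sub>4 f \<and> x\<^sub>4 f < 1 \<and>
     0 < x\<^sub>2 f \<and> x\<^sub>2 f < 1 \<and> 0 < s_par f \<and> s_par f < 1 \<and>
     C3_diffeo (phi f) \<and> C3_diffeo (phi_l f) \<and> C3_diffeo (phi_r f)}"

definition q_branch :: "real \<Rightarrow> real \<Rightarrow> real \<Rightarrow> real" where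
  "q_branch l2 s x = (((1 - s) * x + s) powr l2 - s powr l2) / (1 - s powr l2)"

text \<open>The circle is \<open>[x\<^sub>1, 1]\<close> with its two endpoints identified. The point \<open>f(0)\<close> is
  represented by \<open>x\<^sub>1\<close>. Only arguments in \<open>[x\<^sub>1, 1]\<close> are meaningful; this interval is mapped
  into itself, and the two representatives \<open>x\<^sub>1\<close> and \<open>1\<close> have the same image \<open>x\<^sub>2\<close>.\<close>

definition circ_map :: "real \<Rightarrow> real \<Rightarrow> flat_tuple \<Rightarrow> real \<Rightarrow> real" where
  "circ_map l1 l2 f x =
    (if x < 0 then
       (1 - x\<^sub>2 f) * q_branch l2 (s_par f) (phi f ((x\<^sub>1 f - x) / x\<^sub>1 f)) + x\<^sub>2 f
     else if x = 0 then x\<^sub>1 f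
     else if x \<le> x\<^sub>3 f then x\<^sub>1 f * phi_l f ((x\<^sub>3 f - x) / x\<^sub>3 f) powr l1
     else if x \<le> x\<^sub>4 f then 0
     else x\<^sub>2 f * phi_r f ((x - x\<^sub>4 f) / (1 - x\<^sub>4 f)) powr l2)"

definition flat_piece :: "flat_tuple \<Rightarrow> real set" where
  "flat_piece f = {x\<^sub>3 f<..<x\<^sub>4 f}"

definition circ_length :: "flat_tuple \<Rightarrow> real" where
  "circ_length f = 1 - x\<^sub>1 f"

definition circ_dist :: "flat_tuple \<Rightarrow> real \<Rightarrow> real \<Rightarrow> real" where
  "circ_dist f x y = min \<bar>x - y\<bar> (circ_length f - \<bar>x - y\<bar>)"

text \<open>Lifts are taken with respect to the coordinate of \<open>[x\<^sub>1, 1]\<close>, so their period is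
  \<open>1 - x\<^sub>1\<close> and not \<open>1\<close>; accordingly the rotation number is normalised by this length.\<close>

definition is_lift :: "real \<Rightarrow> real \<Rightarrow> flat_tuple \<Rightarrow> (real \<Rightarrow> real) \<Rightarrow> bool" where
  "is_lift l1 l2 f F \<longleftrightarrow>
     continuous_on UNIV F \<and>
     (\<forall>y. F (y + circ_length f) = F y + circ_length f) \<and>
     (\<forall>y\<in>{x\<^sub>1 f..1}. \<exists>k::int. F y = circ_map l1 l2 f y + of_int k * circ_length f)"

definition has_rotation_number :: "real \<Rightarrow> real \<Rightarrow> flat_tuple \<Rightarrow> real \<Rightarrow> bool" where
  "has_rotation_number l1 l2 f \<rho> \<longleftrightarrow>
     (\<exists>F r. is_lift l1 l2 f F \<and>
        (\<forall>y. (\<lambda>n. ((F ^^ n) y - y) / (real n * circ_length f)) \<longlonglongrightarrow> r) \<and>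
        \<rho> = frac r)"

text \<open>The value of the continued fraction \<open>1/(1 + 1/(1 + \<dots>))\<close>, as the limit of its convergents.\<close>

definition golden_mean :: real where
  "golden_mean = lim (\<lambda>n. ((\<lambda>t. 1 / (1 + t)) ^^ n) 0)"

lemma golden_mean_eq: "golden_mean = (sqrt 5 - 1) / 2"
proof -
  define g :: real where "g = (sqrt 5 - 1) / 2"
  define a :: "nat \<Rightarrow> real" where "a = (\<lambda>n. ((\<lambda>t. 1 / (1 + t)) ^^ n) 0)"
  have s: "sqrt 5 > (2::real)" "sqrt 5 < (3::real)"
    by (auto intro: real_less_rsqrt real_less_lsqrt)
  have g: "0 < g" "g < 1" using s by (auto simp: g_def)
  have gg: "g * (1 + g) = 1" by (simp add: g_def field_simps)
  have aS: "a (Suc n) = 1 / (1 + a n)" for n by (simp add: a_def)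
  have a0: "a n \<ge> 0" for n
  proof (induction n)
    case 0 show ?case by (simp add: a_def)
  next
    case (Suc n) then show ?case by (simp add: aS)
  qed
  have b: "\<bar>a n - g\<bar> \<le> g ^ n" for n
  proof (induction n)
    case 0 show ?case using g by (simp add: a_def)
  next
    case (Suc n)
    have "a (Suc n) - g = g * (g - a n) / (1 + a n)"
      using a0[of n] gg by (simp add: aS field_simps)
    then have "\<bar>a (Suc n) - g\<bar> = g * \<bar>a n - g\<bar> / (1 + a n)"
      using a0[of n] g by (simp add: abs_mult abs_minus_commute)
    also have "\<dots> \<le> g * \<bar>a n - g\<bar> / 1"
      using a0[of n] g by (intro divide_left_mono) auto
    also have "\<dots> \<le> g ^ Suc n" using Suc g by simp
    finally show ?case .
  qed
  have "(\<lambda>n. g ^ n) \<longlonglongrightarrow> 0" using g by (intro LIMSEQ_realpow_zero) auto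
  then have "(\<lambda>n. a n - g) \<longlonglongrightarrow> 0"
    by (rule Lim_null_comparison[rotated]) (simp add: b)
  then have "a \<longlonglongrightarrow> g" by (simp add: LIM_zero_iff)
  then show ?thesis unfolding golden_mean_def a_def g_def by (rule limI)
qed

text \<open>At the junctions \<open>0\<close> and \<open>x\<^sub>1 \<sim> 1\<close> a map of the class need not be differentiable, and
  at \<open>x\<^sub>3\<close>, \<open>x\<^sub>4\<close> it need not be three times differentiable; the Schwarzian derivative is only
  considered where the three derivatives exist.\<close>

definition thrice_differentiable_at :: "(real \<Rightarrow> real) \<Rightarrow> real \<Rightarrow> bool" where
  "thrice_differentiable_at F y \<longleftrightarrow>
     (\<forall>\<^sub>F z in nhds y. F field_differentiable (at z) \<and> deriv F field_differentiable (at z)) \<and>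
     (deriv ^^ 2) F field_differentiable (at y)"

definition schwarzian :: "(real \<Rightarrow> real) \<Rightarrow> real \<Rightarrow> real" where
  "schwarzian F y =
     (deriv ^^ 3) F y / deriv F y - 3 / 2 * ((deriv ^^ 2) F y / deriv F y)\<^sup>2"

text \<open>A lift differs from the map by locally constant terms, so it has the same derivatives, also
  at the junctions \<open>0\<close> and \<open>x\<^sub>1 \<sim> 1\<close> of the circle.\<close>

definition negative_schwarzian :: "real \<Rightarrow> real \<Rightarrow> flat_tuple \<Rightarrow> bool" where
  "negative_schwarzian l1 l2 f \<longleftrightarrow>
     (\<exists>F. is_lift l1 l2 f F \<and>
        (\<forall>y. thrice_differentiable_at F y \<and> deriv F y \<noteq> 0 \<longrightarrow> schwarzian F y < 0))"

definition W_fib :: "real \<Rightarrow> real \<Rightarrow> flat_tuple set" where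
  "W_fib l1 l2 =
     {f \<in> class_L. has_rotation_number l1 l2 f golden_mean \<and> negative_schwarzian l1 l2 f}"

text \<open>\<open>f\<^sup>i(U)\<close> for an integer \<open>i\<close>: a preimage if \<open>i < 0\<close>, a one-point image if \<open>i > 0\<close>.\<close>

definition U_iter :: "real \<Rightarrow> real \<Rightarrow> flat_tuple \<Rightarrow> int \<Rightarrow> real set" where
  "U_iter l1 l2 f i =
     (if i < 0 then {x \<in> {x\<^sub>1 f..1}. (circ_map l1 l2 f ^^ nat (- i)) x \<in> flat_piece f}
      else (circ_map l1 l2 f ^^ nat i) ` flat_piece f)"

text \<open>For irrational rotation number the arcs \<open>f\<^sup>-\<^sup>n(U)\<close> never contain the identified point
  \<open>x\<^sub>1 \<sim> 1\<close>, since that point is \<open>f\<^sup>2(U)\<close> and hence its orbit avoids \<open>U\<close>. They are thus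
  subintervals of \<open>(x\<^sub>1, 1)\<close>, with endpoints their infimum and supremum.\<close>

definition endpoints :: "real set \<Rightarrow> real set" where
  "endpoints I = {Inf I, Sup I}"

definition gap :: "real \<Rightarrow> real \<Rightarrow> flat_tuple \<Rightarrow> int \<Rightarrow> int \<Rightarrow> real" where
  "gap l1 l2 f i j =
     Min {circ_dist f a b | a b. a \<in> endpoints (U_iter l1 l2 f i) \<and> b \<in> endpoints (U_iter l1 l2 f j)}"

definition gap_closed_left :: "real \<Rightarrow> real \<Rightarrow> flat_tuple \<Rightarrow> int \<Rightarrow> int \<Rightarrow> real" where
  "gap_closed_left l1 l2 f i j = measure lborel (U_iter l1 l2 f i) + gap l1 l2 f i j"

text \<open>The library sequence starts with \<open>fib 0 = 0\<close>, \<open>fib 1 = 1\<close>; here \<open>q\<^sub>0 = q\<^sub>1 = 1\<close>.\<close>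

definition qn :: "nat \<Rightarrow> nat" where
  "qn n = fib (Suc n)"

definition scaling_ratio :: "real \<Rightarrow> real \<Rightarrow> flat_tuple \<Rightarrow> nat \<Rightarrow> real" where
  "scaling_ratio l1 l2 f n =
     gap l1 l2 f (- int (qn n)) 0 / gap_closed_left l1 l2 f (- int (qn n)) 0"

end

theory Submission
  imports Defs
begin

text \<open>
  Lift \<open>f\<close> to \<open>F\<close> and put \<open>T\<^sub>n = F\<^bsup>q\<^sub>n\<^esup> - p\<^sub>n c\<close> with \<open>p\<^sub>n / q\<^sub>n\<close> the convergents of the golden mean. Around the flat piece
  the preimages \<open>T\<^sub>n\<^sup>-\<^sup>1(U)\<close> and the points \<open>T\<^sub>n(U)\<close> interlace, on the left for one parity of \<open>n\<close> and on the
  right for the other. Let \<open>w\<^sub>n\<close> be the length of the \<open>n\<close>-th preimage divided by its distance to \<open>U\<close>, so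
  that \<open>\<alpha>\<^sub>n = 1 / (1 + w\<^sub>n)\<close>, and let \<open>x\<^sub>n\<close> be the relative gap between the \<open>n\<close>-th preimage and
  \<open>T\<^sub>n\<^sub>+\<^sub>1(U)\<close>. Negative Schwarzian derivative makes \<open>F\<close> decrease the cross ratio
  \<open>(b - a)(d - c) / ((d - a)(c - b))\<close>; as the image of one of the two outer gaps contains the whole of \<open>U\<close>,
  which is long compared with everything else, this gives, up to factors tending to \<open>1\<close>,
  \<open>(1 + w\<^sub>n\<^sub>+\<^sub>2)\<^sup>\<ell> \<ge> 1 + w\<^sub>n / x\<^sub>n\<close> and \<open>(1 + w\<^sub>n\<^sub>+\<^sub>1)(1 - (1 - x\<^sub>n)\<^sup>\<ell>) \<le> 1 - x\<^sub>n\<^sub>+\<^sub>1\<close>, where \<open>\<ell>\<close> is the critical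
  exponent of the side on which the \<open>n\<close>-th preimage lies. For \<open>1 < \<ell> < 2\<close> these two relations make
  \<open>x\<^sub>n w\<^sub>n\<^sub>+\<^sub>1\<^sup>2 w\<^sub>n\<^sub>+\<^sub>2\<^sup>2\<close> grow geometrically, which forces \<open>w\<^sub>n \<rightarrow> \<infinity>\<close>; then
  \<open>(1 + w\<^sub>n\<^sub>+\<^sub>2)\<^sup>\<ell> \<ge> const \<cdot> w\<^sub>n w\<^sub>n\<^sub>+\<^sub>1\<close> with \<open>\<ell> < 2\<close> yields doubly exponential growth.
\<close>


section \<open>A two-step recursion\<close>

text \<open>Neither relation gives growth by itself, because no a priori bound on the
  \<open>w n\<close> and \<open>x n\<close> is available. Combining the second relation at
  \<open>n\<close> with the first at \<open>n+1\<close> compares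
  \<open>x n * (w (n+1))\<^sup>2\<close> with \<open>x (n+1) * (w (n+3))\<^sup>2\<close>; the factor
  \<open>(w (n+2))\<^sup>2\<close> turns this into a comparison of consecutive terms of one
  sequence. The exponents enter asymmetrically: as an upper bound 2 is enough here, while the strict
  gain comes from their exceeding 1. Being strictly below 2 matters in the last step, where
  logarithms satisfy a recursion with factor less than 2. The factors tending to 1 presuppose that
  the preimages accumulate at \<open>U\<close>. That nothing is left between their limit and
  \<open>U\<close> is derived beforehand from the same cross ratio inequality and Lipschitz
  continuity. \<open>F\<close> is smooth only between its junctions, and the critical value and its
  image are such junctions. Hence the cross ratio inequality is used after three iterates, and these
  three are modelled on each side of \<open>U\<close> by a pure power in a smooth
  coordinate.\<close>

lemma powr_le_quadratic:
  fixes w l :: real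
  assumes "0 \<le> w" "l \<le> 2"
  shows "(1 + w) powr l - 1 \<le> w * (2 + w)"
proof -
  have "(1 + w) powr l \<le> (1 + w) powr 2"
    using assms by (intro powr_mono) auto
  also have "\<dots> = (1 + w)\<^sup>2"
    using assms by simp
  finally show ?thesis by (simp add: power2_eq_square algebra_simps)
qed

text \<open>The gain factor \<open>1 + p * (1 - x)\<close> reflects that the exponent exceeds 1. It
  degenerates at \<open>x = 1\<close>, which forces a separate argument there. The bound on
  \<open>(1 - x) powr p\<close> is the weighted mean inequality with second entry 1.\<close>

lemma one_minus_powr_ge:
  fixes x l p :: real
  assumes "0 \<le> x" "x < 1" "1 + p \<le> l" "0 < p" "p < 1"
  shows "x * (1 + p * (1 - x)) \<le> 1 - (1 - x) powr l"
proof -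
  have "(1 - x) powr l \<le> (1 - x) powr (1 + p)"
    using assms by (intro powr_mono') auto
  also have "\<dots> = (1 - x) * (1 - x) powr p"
    using assms by (simp add: powr_add)
  also have "(1 - x) powr p \<le> 1 - p * x"
  proof -
    have "(1 - x) powr p * 1 powr (1 - p) \<le> p * (1 - x) + (1 - p) * 1"
      using assms by (intro Youngs_inequality_0) auto
    then show ?thesis by (simp add: algebra_simps)
  qed
  then have "(1 - x) * (1 - x) powr p \<le> (1 - x) * (1 - p * x)"
    using assms by (intro mult_left_mono) auto
  finally show ?thesis by (simp add: algebra_simps)
qed

text \<open>Here \<open>x\<close> and \<open>w\<close> carry the index \<open>n+1\<close>,
  \<open>w'\<close> carries \<open>n+3\<close>, and \<open>h\<close> stands for
  \<open>(1 - (1 - x n) powr l n) / k\<close>. In terms of the quotient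
  \<open>z = w / (k * x * w')\<close> both conclusions reduce to a perfect square:
  \<open>(1 - z * h)\<^sup>2\<close> for the first, \<open>(z - 2)\<^sup>2\<close> for the
  second.\<close>

lemma potential_step_aux:
  fixes x w w' k h :: real
  assumes "0 < x" "0 < w" "0 < w'" "1 \<le> k" "0 < h" "h < 1"
    and h1: "w \<le> k * x * (w' * (2 + w'))"
    and h2: "(1 + w) * h \<le> 1 - x"
  shows "h * w\<^sup>2 \<le> k\<^sup>2 * x * w'\<^sup>2"
    and "1 / 2 \<le> h \<Longrightarrow> w\<^sup>2 \<le> 4 * k\<^sup>2 * (1 - h) * x * w'\<^sup>2"
proof -
  define z where "z = w / (k * x * w')"
  have pos: "0 < k * x * w'" using assms by simp
  have w: "w = z * (k * x * w')" using pos unfolding z_def by (metis less_irrefl nonzero_eq_divide_eq)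
  have z: "0 < z" using pos assms by (simp add: z_def)
  have "z * (k * x * w') \<le> (2 + w') * (k * x * w')"
    using h1 unfolding w by (simp add: mult_ac)
  then have z2: "z \<le> 2 + w'" using pos by (simp only: mult_le_cancel_right_pos)
  have zw: "z * (z - 2) \<le> z * w'"
    using z z2 by (intro mult_left_mono) auto
  have "x + z * x * w' * h \<le> x + w * h"
  proof -
    have "1 * (z * x * w' * h) \<le> k * (z * x * w' * h)"
      using assms z by (intro mult_right_mono) auto
    then show ?thesis unfolding w by (simp add: mult_ac)
  qed
  also have "\<dots> \<le> 1 - h" using h2 by (simp add: algebra_simps)
  finally have xb: "x * (1 + z * w' * h) \<le> 1 - h" by (simp add: algebra_simps)
  have D: "0 < 1 + z * w' * h" using z assms by (simp add: add_pos_pos)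
  have "h * z\<^sup>2 * x * (1 + z * w' * h) \<le> h * z\<^sup>2 * (1 - h)"
    using mult_left_mono[OF xb, of "h * z\<^sup>2"] assms by (simp add: mult_ac)
  also have "\<dots> \<le> 1 + z * (z - 2) * h"
  proof -
    have "0 \<le> (1 - z * h)\<^sup>2" by simp
    then show ?thesis by (simp add: power2_eq_square algebra_simps)
  qed
  also have "\<dots> \<le> 1 + z * w' * h"
    using zw assms by (simp add: mult_right_mono)
  finally have *: "h * z\<^sup>2 * x \<le> 1" using D by simp
  have "h * w\<^sup>2 = (h * z\<^sup>2 * x) * (k\<^sup>2 * x * w'\<^sup>2)"
    unfolding w by (simp add: power2_eq_square mult_ac)
  also have "\<dots> \<le> 1 * (k\<^sup>2 * x * w'\<^sup>2)"
    using * assms by (intro mult_right_mono) auto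
  finally show "h * w\<^sup>2 \<le> k\<^sup>2 * x * w'\<^sup>2" by simp
  assume h: "1 / 2 \<le> h"
  have "z\<^sup>2 * x * (1 + z * w' * h) \<le> z\<^sup>2 * (1 - h)"
    using mult_left_mono[OF xb, of "z\<^sup>2"] assms by (simp add: mult_ac)
  also have "\<dots> \<le> (4 * (1 + z * w' * h)) * (1 - h)"
  proof (intro mult_right_mono)
    have "z * (z - 2) / 2 \<le> z * w' * h"
    proof -
      have "z * w' / 2 \<le> z * w' * h"
        using mult_left_mono[OF h, of "z * w'"] z \<open>0 < w'\<close> by simp
      then show ?thesis using zw by linarith
    qed
    moreover have "z\<^sup>2 \<le> 4 * (1 + z * (z - 2) / 2)"
    proof -
      have "4 * (1 + z * (z - 2) / 2) - z\<^sup>2 = (z - 2)\<^sup>2"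
        by (simp add: power2_eq_square field_simps)
      then show ?thesis using zero_le_power2[of "z - 2"] by linarith
    qed
    ultimately show "z\<^sup>2 \<le> 4 * (1 + z * w' * h)" by (smt (verit))
  qed (use assms in auto)
  finally have "z\<^sup>2 * x * (1 + z * w' * h) \<le> (4 * (1 - h)) * (1 + z * w' * h)"
    by (simp only: mult_ac)
  then have *: "z\<^sup>2 * x \<le> 4 * (1 - h)" using D by (simp only: mult_le_cancel_right_pos)
  have "w\<^sup>2 = (z\<^sup>2 * x) * (k\<^sup>2 * x * w'\<^sup>2)"
    unfolding w by (simp add: power2_eq_square mult_ac)
  also have "\<dots> \<le> (4 * (1 - h)) * (k\<^sup>2 * x * w'\<^sup>2)"
    using * assms by (intro mult_right_mono) auto
  finally show "w\<^sup>2 \<le> 4 * k\<^sup>2 * (1 - h) * x * w'\<^sup>2" by (simp only: mult_ac)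
qed

text \<open>Away from \<open>x = 1\<close> the exponent above 1 gives a definite gain; near
  \<open>x = 1\<close> the factor \<open>1 - h\<close> is small and the second estimate of
  \<open>potential_step_aux\<close> takes over. The tolerance \<open>k > 1\<close> is there because
  the relations hold only up to factors tending to 1.\<close>

lemma potential_step:
  fixes p :: real
  assumes p: "0 < p" "p < 1"
  obtains k K :: real where "1 < k" "k \<le> 17/16" "0 < K" "K < 1"
    "\<And>x x' w w' l l'. \<lbrakk>0 < x; x < 1; 0 < x'; 0 < w; 0 < w'; 1 + p \<le> l; l' \<le> 2;
       w \<le> k * x' * ((1 + w') powr l' - 1);
       (1 + w) * (1 - (1 - x) powr l) \<le> k * (1 - x')\<rbrakk>
      \<Longrightarrow> x * w\<^sup>2 \<le> K * x' * w'\<^sup>2"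
proof
  \<comment> \<open>For \<open>x \<le> 7/8\<close> the gain is \<open>1 + p/8\<close>, and
    \<open>k ^ 3 \<le> 1 + p/16\<close> uses up only half of it. The value \<open>4/5\<close> covers
    \<open>4 * (17/16)\<^sup>2 * (3/17)\<close>, the constant of the case
    \<open>x > 7/8\<close>.\<close>
  define k where "k = 1 + p / 64"
  define K where "K = max (4/5) ((1 + p/16) / (1 + p/8))"
  show k1: "1 < k" "k \<le> 17/16" using p by (auto simp: k_def)
  show K: "0 < K" "K < 1" using p by (auto simp: K_def field_simps less_max_iff_disj)
  fix x x' w w' l l' :: real
  assume x: "0 < x" "x < 1" "0 < x'" "0 < w" "0 < w'" "1 + p \<le> l" "l' \<le> 2"
    and h1: "w \<le> k * x' * ((1 + w') powr l' - 1)"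
    and h2: "(1 + w) * (1 - (1 - x) powr l) \<le> k * (1 - x')"
  define h where "h = (1 - (1 - x) powr l) / k"
  have hx: "x * (1 + p * (1 - x)) \<le> k * h"
    using one_minus_powr_ge[of x p l] p x k1 by (simp add: h_def)
  have "0 < x * (1 + p * (1 - x))" using p x by (simp add: add_pos_pos)
  then have h0: "0 < h" using hx k1 by (metis less_le_trans mult.commute zero_less_mult_pos2 less_trans zero_less_one)
  have "0 < (1 - x) powr l" using x by simp
  then have "1 - (1 - x) powr l < k" using k1 by linarith
  then have "h < 1" using k1 by (simp add: h_def)
  have a1: "w \<le> k * x' * (w' * (2 + w'))"
  proof -
    have "k * x' * ((1 + w') powr l' - 1) \<le> k * x' * (w' * (2 + w'))"
      using powr_le_quadratic[of w' l'] x k1 by (intro mult_left_mono) auto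
    with h1 show ?thesis by linarith
  qed
  have a2: "(1 + w) * h \<le> 1 - x'"
    using h2 k1 by (simp add: h_def field_simps)
  note aux = potential_step_aux[OF x(3,4,5) _ h0 \<open>h < 1\<close> a1 a2]
  show "x * w\<^sup>2 \<le> K * x' * w'\<^sup>2"
  proof (cases "x \<le> 7/8")
    case True
    have "x * (1 + p / 8) \<le> x * (1 + p * (1 - x))"
      using True p x by (intro mult_left_mono) auto
    with hx have "x * (1 + p / 8) \<le> k * h" by linarith
    then have "x * (1 + p / 8) * w\<^sup>2 \<le> k * (h * w\<^sup>2)"
      by (metis mult.assoc mult_right_mono zero_le_power2)
    also have "\<dots> \<le> k * (k\<^sup>2 * x' * w'\<^sup>2)"
      using aux(1) k1 by (intro mult_left_mono) auto
    also have "\<dots> = k^3 * (x' * w'\<^sup>2)" by (simp add: power2_eq_square power3_eq_cube)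
    also have "\<dots> \<le> (1 + p/16) * (x' * w'\<^sup>2)"
    proof (intro mult_right_mono)
      have "k^3 = 1 + p * (3/64 + 3 * p / 4096 + p^2/262144)"
        by (simp add: k_def power3_eq_cube power2_eq_square field_simps)
      also have "\<dots> \<le> 1 + p * (1/16)"
      proof -
        have "p^2 \<le> 1" using p by (simp add: power_le_one)
        then show ?thesis using p by (intro add_left_mono mult_left_mono) auto
      qed
      finally show "k^3 \<le> 1 + p/16" by simp
    qed (use x in auto)
    finally have "x * w\<^sup>2 * (1 + p/8) \<le> (1 + p/16) * (x' * w'\<^sup>2)" by (simp add: mult_ac)
    then have "x * w\<^sup>2 \<le> (1 + p/16) / (1 + p/8) * (x' * w'\<^sup>2)"
      using p by (simp add: field_simps)
    also have "\<dots> \<le> K * (x' * w'\<^sup>2)"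
      using x by (intro mult_right_mono) (auto simp: K_def)
    finally show ?thesis by (simp add: mult_ac)
  next
    case False
    have "x * 1 \<le> x * (1 + p * (1 - x))" using x p by (intro mult_left_mono) auto
    then have "7/8 \<le> k * h" using hx False by linarith
    also have "\<dots> \<le> 17/16 * h" using k1 h0 by (intro mult_right_mono) auto
    finally have h: "14/17 \<le> h" by simp
    have "x * w\<^sup>2 \<le> 1 * w\<^sup>2" using x by (intro mult_right_mono) auto
    also have "1 * w\<^sup>2 \<le> (4 * k\<^sup>2 * (1 - h)) * (x' * w'\<^sup>2)"
      using aux(2) h k1 by (simp add: mult_ac)
    also have "\<dots> \<le> K * (x' * w'\<^sup>2)"
    proof (intro mult_right_mono)
      have "k\<^sup>2 \<le> (17/16)\<^sup>2" using k1 by (intro power_mono) auto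
      then have "4 * k\<^sup>2 * (1 - h) \<le> 4 * (17/16)\<^sup>2 * (3/17)"
        using h \<open>h < 1\<close> by (intro mult_mono) auto
      also have "\<dots> \<le> K" by (simp add: K_def power2_eq_square)
      finally show "4 * k\<^sup>2 * (1 - h) \<le> K" .
    qed (use x in auto)
    finally show ?thesis by (simp add: mult_ac)
  qed
qed

text \<open>A lower bound \<open>s\<close> for two consecutive terms improves to
  \<open>t * s\<close> for the next one, where \<open>1 < t < 2 / L\<close>, as soon as
  \<open>s\<close> is large enough to absorb \<open>C\<close>. Two steps gain the factor
  \<open>t\<close>, so the rate per step is \<open>sqrt t\<close>.\<close>

lemma doubly_exponential_growth_from_recursion:
  fixes u :: "nat \<Rightarrow> real"
  assumes L: "0 < L" "L < 2"
    and lim: "filterlim u at_top sequentially"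
    and rec: "\<forall>\<^sub>F n in sequentially. u n + u (n+1) \<le> C + L * u (n+2)"
  shows "\<exists>A>0. \<exists>m>1. \<forall>\<^sub>F n in sequentially. A * m ^ n \<le> u n"
proof -
  define t where "t = (2 / L + 1) / 2"
  have t: "1 < t" "t < 2 / L" using L by (auto simp: t_def field_simps)
  \<comment> \<open>Chosen so that \<open>2 * s - C \<ge> L * t * s\<close> for every
    \<open>s \<ge> T\<close>.\<close>
  define T where "T = max 1 (C / (2 - L * t))"
  have d: "0 < 2 - L * t" using t L by (simp add: field_simps)
  have T: "C \<le> (2 - L * t) * T" "T \<ge> 1"
    using d by (auto simp: T_def max_def field_simps)
  have "\<forall>\<^sub>F n in sequentially. T \<le> u n"
    using lim by (simp add: filterlim_at_top)
  with rec have "\<forall>\<^sub>F n in sequentially. T \<le> u n \<and> u n + u (n+1) \<le> C + L * u (n+2)"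
    by eventually_elim auto
  then obtain N where N: "\<And>n. n \<ge> N \<Longrightarrow> T \<le> u n"
      "\<And>n. n \<ge> N \<Longrightarrow> u n + u (n+1) \<le> C + L * u (n+2)"
    by (auto simp: eventually_sequentially)
  have step: "t * s \<le> u (n+2)" if "n \<ge> N" "T \<le> s" "s \<le> u n" "s \<le> u (n+1)" for n s
  proof -
    have "C \<le> (2 - L * t) * s"
      using T(1) mult_left_mono[OF that(2), of "2 - L * t"] d by linarith
    then have "L * (t * s) \<le> 2 * s - C" by (simp add: algebra_simps)
    also have "\<dots> \<le> L * u (n+2)" using N(2)[OF that(1)] that by linarith
    finally show ?thesis using L by simp
  qed
  have tge: "T * t ^ k \<ge> T" for k using t T by simp
  have ind: "T * t ^ k \<le> u (N + 2 * k) \<and> T * t ^ k \<le> u (N + 2 * k + 1)" for k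
  proof (induction k)
    case 0
    then show ?case using N(1)[of N] N(1)[of "N+1"] by simp
  next
    case (Suc k)
    have a: "t * (T * t ^ k) \<le> u (N + 2 * k + 2)"
      using step[of "N + 2 * k" "T * t ^ k"] tge Suc by simp
    have "T * t ^ k \<le> t * (T * t ^ k)"
      using tge[of k] T t by (simp add: mult_le_cancel_right2)
    then have "t * (T * t ^ k) \<le> u (N + 2 * k + 1 + 2)"
      using step[of "N + 2 * k + 1" "T * t ^ k"] tge Suc a by (simp add: add_ac)
    with a show ?case by (simp add: mult_ac add_ac)
  qed
  define m where "m = sqrt t"
  have m: "1 < m" "m^2 = t" using t by (auto simp: m_def)
  have "T / m ^ (N + 1) * m ^ n \<le> u n" if "n \<ge> N" for n
  proof -
    define k where "k = (n - N) div 2"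
    have nk: "n = N + 2 * k \<or> n = N + 2 * k + 1" using that unfolding k_def by presburger
    then have "m ^ n \<le> m ^ (N + 2 * k + 1)" using m by (intro power_increasing) auto
    also have "\<dots> = m ^ (N + 1) * t ^ k" by (simp add: power_add power_mult m)
    finally have "T / m ^ (N + 1) * m ^ n \<le> T * t ^ k"
      using m T by (simp add: field_simps mult_left_mono)
    also have "\<dots> \<le> u n" using ind[of k] nk by auto
    finally show ?thesis .
  qed
  then show ?thesis using m T
    by (intro exI[of _ "T / m ^ (N + 1)"] exI[of _ m] conjI)
       (auto simp: eventually_sequentially)
qed

text \<open>Growth of the potential \<open>Q\<close> only makes the products
  \<open>(w (n+2))\<^sup>2 * w (n+1)\<close> tend to infinity; single terms could still stay small.
  The recursion \<open>rec2\<close> first yields a positive lower bound for all terms and then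
  passes the size of one large factor on to the next term.\<close>

lemma scaling_sequence_doubly_exponential:
  fixes w x l :: "nat \<Rightarrow> real" and p L :: real
  assumes p: "0 < p" "p < 1" and l: "\<And>n. 1 + p \<le> l n" "\<And>n. l n \<le> L" and L: "L < 2"
    and pos: "\<forall>\<^sub>F n in sequentially. 0 < w n \<and> 0 < x n \<and> x n < 1"
    and h1: "\<And>k. 1 < k \<Longrightarrow> \<forall>\<^sub>F n in sequentially. w n \<le> k * x n * ((1 + w (n+2)) powr l n - 1)"
    and h2: "\<And>k. 1 < k \<Longrightarrow> \<forall>\<^sub>F n in sequentially.
       (1 + w (n+1)) * (1 - (1 - x n) powr l n) \<le> k * (1 - x (n+1))"
  shows "\<exists>A>0. \<exists>m>1. \<forall>\<^sub>F n in sequentially. exp (A * m ^ n) \<le> w n"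
proof -
  obtain k K where k: "1 < k" "k \<le> 17/16" and K: "0 < K" "K < 1"
    and step: "\<And>x x' w w' l l'. \<lbrakk>0 < x; x < 1; 0 < x'; 0 < w; 0 < w'; 1 + p \<le> l; l' \<le> 2;
       w \<le> k * x' * ((1 + w') powr l' - 1);
       (1 + w) * (1 - (1 - x) powr l) \<le> k * (1 - x')\<rbrakk>
      \<Longrightarrow> x * w\<^sup>2 \<le> K * x' * w'\<^sup>2"
    using potential_step[OF p] by metis
  obtain N where pN: "\<And>n. n \<ge> N \<Longrightarrow> 0 < w n \<and> 0 < x n \<and> x n < 1"
    and h1N: "\<And>n. n \<ge> N \<Longrightarrow> w n \<le> k * x n * ((1 + w (n+2)) powr l n - 1)"
    and h2N: "\<And>n. n \<ge> N \<Longrightarrow> (1 + w (n+1)) * (1 - (1 - x n) powr l n) \<le> k * (1 - x (n+1))"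
    using eventually_conj[OF pos eventually_conj[OF h1[OF k(1)] h2[OF k(1)]]]
    by (auto simp: eventually_sequentially)
  have l2: "l n \<le> 2" for n using l(2)[of n] L by linarith
  have P: "x n * (w (n+1))\<^sup>2 \<le> K * x (n+1) * (w (n+3))\<^sup>2" if "n \<ge> N" for n
    using pN[of n] pN[of "n+1"] pN[of "n+3"] that h1N[of "n+1"] h2N[of n] l(1)[of n] l2[of "n+1"]
    by (intro step) (auto simp: add_ac eval_nat_numeral)
  define Q where "Q n = x n * (w (n+2))\<^sup>2 * (w (n+1))\<^sup>2" for n
  have QS: "Q n \<le> K * Q (n+1)" if "n \<ge> N" for n
    using mult_right_mono[OF P[OF that], of "(w (n+2))\<^sup>2"]
    by (simp add: Q_def mult_ac add_ac eval_nat_numeral)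
  have Qpos: "0 < Q n" if "n \<ge> N" for n
    using pN[of n] pN[of "n+1"] pN[of "n+2"] that by (auto simp: Q_def)
  have Qge: "Q N * (1 / K) ^ j \<le> Q (N + j)" for j
  proof (induction j)
    case (Suc j)
    have "Q N * (1 / K) ^ Suc j = (Q N * (1 / K) ^ j) / K" by simp
    also have "\<dots> \<le> Q (N + j) / K" using Suc K by (intro divide_right_mono) auto
    also have "\<dots> \<le> Q (N + Suc j)" using QS[of "N + j"] K by (simp add: field_simps)
    finally show ?case .
  qed auto
  \<comment> \<open>Removes \<open>x n\<close> from \<open>Q n\<close> at the price of one factor
    \<open>w (n+1)\<close>.\<close>
  have xw: "x n * (1 + w (n+1)) \<le> k" if "n \<ge> N" for n
  proof -
    have "x n * 1 \<le> x n * (1 + p * (1 - x n))" using pN[OF that] p by (intro mult_left_mono) auto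
    also have "\<dots> \<le> 1 - (1 - x n) powr l n"
      using pN[OF that] p l(1)[of n] by (intro one_minus_powr_ge) auto
    finally have "x n * (1 + w (n+1)) \<le> (1 - (1 - x n) powr l n) * (1 + w (n+1))"
      using pN[of "n+1"] that by (intro mult_right_mono) auto
    also have "\<dots> \<le> k * (1 - x (n+1))" using h2N[OF that] by (simp add: mult_ac)
    also have "\<dots> \<le> k * 1" using pN[of "n+1"] that k by (intro mult_left_mono) auto
    finally show ?thesis by simp
  qed
  have big: "\<forall>\<^sub>F n in sequentially. R \<le> (w (n+2))\<^sup>2 * w (n+1)" for R
  proof -
    have "filterlim (\<lambda>j. Q N * (1 / K) ^ j) at_top sequentially"
      using Qpos[of N] K
      by (intro filterlim_tendsto_pos_mult_at_top[OF tendsto_const]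
          filterlim_at_infinity_imp_filterlim_at_top filterlim_realpow_sequentially_gt1) auto
    then have "\<forall>\<^sub>F j in sequentially. k * R \<le> Q N * (1 / K) ^ j"
      by (simp add: filterlim_at_top)
    then have "\<forall>\<^sub>F j in sequentially. R \<le> (w (N + j+2))\<^sup>2 * w (N + j+1)"
    proof eventually_elim
      case (elim j)
      have w: "0 < w (N+j+1)" "0 < x (N+j)" using pN[of "N+j+1"] pN[of "N+j"] by auto
      have "k * R \<le> Q (N + j)" using elim Qge[of j] by linarith
      also have "\<dots> = (x (N+j) * w (N+j+1)) * ((w (N+j+2))\<^sup>2 * w (N+j+1))"
        by (simp add: Q_def power2_eq_square)
      also have "\<dots> \<le> k * ((w (N+j+2))\<^sup>2 * w (N+j+1))"
        using xw[of "N+j"] w by (intro mult_right_mono) (auto simp: algebra_simps)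
      finally show ?case using k by simp
    qed
    then have "\<forall>\<^sub>F j in sequentially. R \<le> (w (j + N+2))\<^sup>2 * w (j + N+1)"
      by (simp add: add.commute)
    then show ?thesis
      using eventually_sequentially_seg[of "\<lambda>n. R \<le> (w (n+2))\<^sup>2 * w (n+1)" N] by simp
  qed
  have k2: "k\<^sup>2 \<le> 2" using power_mono[OF k(2), of 2] k by (simp add: power2_eq_square)
  have rec: "w n * (1 + w (n+1)) \<le> 2 * ((1 + w (n+2)) powr l n - 1)" if "n \<ge> N" for n
  proof -
    have V: "0 \<le> (1 + w (n+2)) powr l n - 1"
      using pN[of "n+2"] that l(1)[of n] p by (simp add: ge_one_powr_ge_zero)
    have "w n * (1 + w (n+1)) \<le> (k * x n * ((1 + w (n+2)) powr l n - 1)) * (1 + w (n+1))"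
      using h1N[OF that] pN[of "n+1"] that by (intro mult_right_mono) auto
    also have "\<dots> = k * ((1 + w (n+2)) powr l n - 1) * (x n * (1 + w (n+1)))" by simp
    also have "\<dots> \<le> k * ((1 + w (n+2)) powr l n - 1) * k"
      using xw[OF that] V k by (intro mult_left_mono) auto
    also have "\<dots> = k\<^sup>2 * ((1 + w (n+2)) powr l n - 1)" by (simp add: power2_eq_square)
    also have "\<dots> \<le> 2 * ((1 + w (n+2)) powr l n - 1)" using k2 V by (intro mult_right_mono)
    finally show ?thesis .
  qed
  have rec2: "w n * (1 + w (n+1)) \<le> 2 * (w (n+2) * (2 + w (n+2)))" if "n \<ge> N" for n
    using rec[OF that] powr_le_quadratic[of "w (n+2)" "l n"] l2[of n] pN[of "n+2"] that by auto
  obtain M where M: "M \<ge> N" "\<And>n. n \<ge> M \<Longrightarrow> 5 \<le> (w (n+2))\<^sup>2 * w (n+1)"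
    using eventually_conj[OF big[of 5] eventually_ge_at_top[of N]]
    by (auto simp: eventually_sequentially)
  \<comment> \<open>If \<open>w (n+1)\<close> is large, the recursion forbids a drop below
    \<open>min (w n) 1\<close>; if it is small, the large product forces \<open>w (n+2)\<close> up
    to at least 1.\<close>
  have mn: "min (w n) 1 \<le> w (n+2)" if "n \<ge> M" for n
  proof (cases "w (n+1) \<ge> 5")
    case True
    show ?thesis
    proof (rule ccontr)
      assume "\<not> ?thesis"
      then have lt: "w (n+2) < w n" "w (n+2) < 1" by auto
      have p0: "0 < w n" "0 < w (n+2)" using pN[of n] pN[of "n+2"] that M by auto
      have "w n * 6 \<le> w n * (1 + w (n+1))" using True p0 by (intro mult_left_mono) auto
      also have "\<dots> \<le> 2 * (w (n+2) * (2 + w (n+2)))" using rec2[of n] that M by auto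
      also have "\<dots> \<le> 2 * (w (n+2) * 3)" using lt p0 by (intro mult_left_mono) auto
      finally show False using lt by simp
    qed
  next
    case False
    have p0: "0 < w (n+2)" using pN[of "n+2"] that M by auto
    have "5 \<le> (w (n+2))\<^sup>2 * w (n+1)" using M that by blast
    also have "\<dots> \<le> (w (n+2))\<^sup>2 * 5" using False by (intro mult_left_mono) auto
    finally have "1 \<le> (w (n+2))\<^sup>2" by simp
    then show ?thesis using p0
      by (smt (verit, best) one_power2 power_less_imp_less_base power2_le_imp_le)
  qed
  define d where "d = min 1 (min (w M) (w (M+1)))"
  have d: "0 < d" "d \<le> 1" using pN[of M] pN[of "M+1"] M by (auto simp: d_def)
  have dw: "d \<le> w (M + j) \<and> d \<le> w (M + j + 1)" for j
  proof (induction j)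
    case 0
    then show ?case by (auto simp: d_def)
  next
    case (Suc j)
    then show ?case using mn[of "M + j"] d by (auto simp: min_def split: if_splits)
  qed
  have dw': "d \<le> w n" if "n \<ge> M" for n using dw[of "n - M"] that by simp
  have lim: "filterlim w at_top sequentially"
    unfolding filterlim_at_top_gt[where c=1]
  proof (intro allI impI)
    fix Z :: real assume Z: "1 < Z"
    \<comment> \<open>One of \<open>w (n+1)\<close>, \<open>w (n+2)\<close> exceeds
      \<open>S\<close>. Then \<open>w (n+1) * (1 + w (n+2)) \<ge> d * S\<close>, and this value is
      what \<open>rec2\<close> needs to give \<open>w (n+3) \<ge> Z\<close>.\<close>
    define S where "S = 2 * Z * (2 + Z) / d"
    have S: "0 < S" "d * S = 2 * (Z * (2 + Z))"
      unfolding S_def using d Z by (auto intro!: divide_pos_pos mult_pos_pos)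
    have "\<forall>\<^sub>F n in sequentially. Z \<le> w (n + 3)"
      using big[of "S^3"] eventually_ge_at_top[of M]
    proof eventually_elim
      case (elim n)
      have dd: "d \<le> w (n+1)" "d \<le> w (n+2)" "d \<le> w (n+3)" using dw' elim by auto
      have "S \<le> w (n+1) \<or> S \<le> w (n+2)"
      proof (rule ccontr)
        assume "\<not> ?thesis"
        then have "(w (n+2))\<^sup>2 * w (n+1) < S\<^sup>2 * S"
          using dd d by (intro mult_strict_mono power_strict_mono) auto
        then show False using elim by (simp add: power2_eq_square power3_eq_cube)
      qed
      then have "d * S \<le> w (n+1) * (1 + w (n+2))"
      proof
        assume a: "S \<le> w (n+1)"
        have "d * S \<le> 1 * w (n+1)" using a d S by (intro mult_mono) auto
        also have "\<dots> \<le> w (n+1) * (1 + w (n+2))" using dd d by simp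
        finally show ?thesis .
      next
        assume a: "S \<le> w (n+2)"
        show ?thesis using a dd d S by (intro mult_mono) auto
      qed
      also have "\<dots> \<le> 2 * (w (n+3) * (2 + w (n+3)))"
        using rec2[of "n+1"] elim M by (simp add: add_ac eval_nat_numeral)
      finally have le: "Z * (2 + Z) \<le> w (n+3) * (2 + w (n+3))" using S by simp
      show ?case
      proof (rule ccontr)
        assume "\<not> ?thesis"
        then have "w (n+3) * (2 + w (n+3)) < Z * (2 + Z)"
          using dd d Z by (intro mult_strict_mono) auto
        then show False using le by simp
      qed
    qed
    then show "\<forall>\<^sub>F n in sequentially. Z \<le> w n"
      using eventually_sequentially_seg[of "\<lambda>n. Z \<le> w n" 3] by simp
  qed
  define u where "u n = ln (1 + w n)" for n
  have ulim: "filterlim u at_top sequentially"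
    unfolding u_def
    by (rule filterlim_compose[OF ln_at_top filterlim_tendsto_add_at_top[OF tendsto_const lim]])
  have w1: "\<forall>\<^sub>F n in sequentially. 1 \<le> w n" using lim by (simp add: filterlim_at_top)
  have w2: "\<forall>\<^sub>F n in sequentially. 2 \<le> w n" using lim by (simp add: filterlim_at_top)
  from w1 obtain N1 where N1: "\<And>n. n \<ge> N1 \<Longrightarrow> 1 \<le> w n" by (auto simp: eventually_sequentially)
  have L0: "0 < L" using l(1)[of 0] l(2)[of 0] p by linarith
  have "\<forall>\<^sub>F n in sequentially. u n + u (n+1) \<le> ln 4 + L * u (n+2)"
    using eventually_ge_at_top[of N] eventually_ge_at_top[of N1]
  proof eventually_elim
    case (elim n)
    have g: "1 \<le> w n" "1 \<le> w (n+1)" "1 \<le> w (n+2)" using N1 elim by auto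
    have "(1 + w n) * (1 + w (n+1)) \<le> 2 * (w n * (1 + w (n+1)))"
      using mult_right_mono[of "1 + w n" "2 * w n" "1 + w (n+1)"] g by (simp add: mult_ac)
    also have "\<dots> \<le> 4 * (1 + w (n+2)) powr l n" using rec[of n] elim by simp
    also have "\<dots> \<le> 4 * (1 + w (n+2)) powr L"
      using l(2)[of n] g by (intro mult_left_mono powr_mono) auto
    finally have "ln ((1 + w n) * (1 + w (n+1))) \<le> ln (4 * (1 + w (n+2)) powr L)"
      using g by (subst ln_le_cancel_iff) auto
    then show ?case using g by (simp add: u_def ln_mult ln_powr)
  qed
  from doubly_exponential_growth_from_recursion[OF L0 L ulim this]
  obtain A m where A: "A > 0" "m > 1" and ev: "\<forall>\<^sub>F n in sequentially. A * m ^ n \<le> u n" by auto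
  \<comment> \<open>Passing from \<open>1 + w n\<close> to \<open>w n\<close> costs half of the
    constant \<open>A\<close>, because \<open>1 + w n \<le> (w n)\<^sup>2\<close> once
    \<open>w n \<ge> 2\<close>.\<close>
  have "\<forall>\<^sub>F n in sequentially. exp ((A/2) * m ^ n) \<le> w n"
    using ev w2
  proof eventually_elim
    case (elim n)
    have "exp ((A/2) * m ^ n) * exp ((A/2) * m ^ n) = exp (A * m ^ n)"
      by (simp flip: exp_add)
    also have "\<dots> \<le> exp (u n)" using elim by simp
    also have "\<dots> = 1 + w n" using elim by (simp add: u_def)
    finally have "(exp ((A/2) * m ^ n))\<^sup>2 \<le> 1 + w n" by (simp add: power2_eq_square)
    also have "\<dots> \<le> (w n)\<^sup>2"
    proof -
      have "2 * w n \<le> w n * w n" using elim by (intro mult_right_mono) auto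
      then show ?thesis unfolding power2_eq_square using elim by linarith
    qed
    finally show ?case using elim power2_le_imp_le[of "exp ((A/2) * m ^ n)" "w n"] by linarith
  qed
  then show ?thesis using A by (intro exI[of _ "A/2"]) auto
qed

section \<open>Cross ratios and negative Schwarzian derivative\<close>

definition cross_ratio :: "real \<Rightarrow> real \<Rightarrow> real \<Rightarrow> real \<Rightarrow> real" where
  "cross_ratio a b c d = (b - a) * (d - c) / ((d - a) * (c - b))"

text \<open>The form shifted by 1 is a plain product of quotients. It suits logarithms and allows a
  factor that is at most 1 to be dropped.\<close>

lemma cross_ratio_alt:
  assumes "a < b" "b < c" "c < d"
  shows "cross_ratio a b c d = (c - a) * (d - b) / ((d - a) * (c - b)) - 1"
proof -
  have "(d - a) * (c - b) \<noteq> 0" using assms by auto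
  moreover have "(b - a) * (d - c) = (c - a) * (d - b) - (d - a) * (c - b)" by algebra
  ultimately show ?thesis by (simp add: cross_ratio_def diff_divide_distrib)
qed

lemma cross_ratio_reflect: "cross_ratio (-d) (-c) (-b) (-a) = cross_ratio a b c d"
  by (simp add: cross_ratio_def algebra_simps)

definition decreases_cross_ratio :: "real \<Rightarrow> real \<Rightarrow> (real \<Rightarrow> real) \<Rightarrow> bool" where
  "decreases_cross_ratio lo hi f \<longleftrightarrow> (\<forall>a b c d. lo \<le> a \<longrightarrow> a < b \<longrightarrow> b < c \<longrightarrow> c < d \<longrightarrow> d \<le> hi \<longrightarrow>
     cross_ratio (f a) (f b) (f c) (f d) \<le> cross_ratio a b c d)"

text \<open>Derivatives are demanded in the open interval only, since the branches end at critical
  points or junctions. Continuity carries the inequality over to the closed interval.\<close>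

locale neg_schwarzian_interval =
  fixes f f1 f2 f3 :: "real \<Rightarrow> real" and lo hi :: real
  assumes D1: "\<And>x. x \<in> {lo<..<hi} \<Longrightarrow> (f has_real_derivative f1 x) (at x)"
    and D2: "\<And>x. x \<in> {lo<..<hi} \<Longrightarrow> (f1 has_real_derivative f2 x) (at x)"
    and D3: "\<And>x. x \<in> {lo<..<hi} \<Longrightarrow> (f2 has_real_derivative f3 x) (at x)"
    and pos: "\<And>x. x \<in> {lo<..<hi} \<Longrightarrow> 0 < f1 x"
    and neg: "\<And>x. x \<in> {lo<..<hi} \<Longrightarrow> f3 x / f1 x - 3 / 2 * (f2 x / f1 x)\<^sup>2 < 0"
    and cont: "continuous_on {lo..hi} f"
begin

text \<open>The second derivative is \<open>-1/2 * f1 x powr (-1/2)\<close> times the Schwarzian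
  derivative of \<open>f\<close>, hence nonnegative.\<close>

lemma convex_inverse_sqrt_deriv: "convex_on {lo<..<hi} (\<lambda>x. f1 x powr (-1/2))"
proof (rule f''_ge0_imp_convex)
  fix x assume x: "x \<in> {lo<..<hi}"
  note p = pos[OF x]
  show "((\<lambda>x. f1 x powr (-1/2)) has_real_derivative (-1/2) * f1 x powr (-3/2) * f2 x) (at x)"
    using p by (auto intro!: derivative_eq_intros D2 x simp: powr_diff)
  show "((\<lambda>x. (-1/2) * f1 x powr (-3/2) * f2 x) has_real_derivative
      (3/4) * f1 x powr (-5/2) * (f2 x)\<^sup>2 - 1/2 * f1 x powr (-3/2) * f3 x) (at x)"
    using p by (auto intro!: derivative_eq_intros D2 D3 x)
      (simp add: power2_eq_square powr_diff field_simps powr_minus flip: powr_add)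
  have e1: "f1 x powr (-3/2) = f1 x powr (-1/2) / f1 x"
    using p powr_diff[of "f1 x" "-1/2" 1] by simp
  have e2: "f1 x powr (-5/2) = f1 x powr (-1/2) / (f1 x)\<^sup>2"
    using p powr_diff[of "f1 x" "-1/2" 2] by simp
  have "(3/4) * f1 x powr (-5/2) * (f2 x)\<^sup>2 - 1/2 * f1 x powr (-3/2) * f3 x
      = - (1/2) * f1 x powr (-1/2) * (f3 x / f1 x - 3 / 2 * (f2 x / f1 x)\<^sup>2)"
    unfolding e1 e2 by (simp add: field_simps)
  also have "\<dots> \<ge> 0" using neg[OF x] by (simp add: mult_nonneg_nonpos)
  finally show "(3/4) * f1 x powr (-5/2) * (f2 x)\<^sup>2 - 1/2 * f1 x powr (-3/2) * f3 x \<ge> 0" .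
qed auto

text \<open>The chord of the convex function \<open>f1 powr (-1/2)\<close> is the derivative to the power \<open>-1/2\<close> of a
  Moebius map, and \<open>f\<close> grows at least as fast as that map.\<close>

lemma deriv_product_le:
  assumes a: "a \<in> {lo<..<hi}" and b: "b \<in> {lo<..<hi}" and ab: "a < b"
  shows "f1 a * f1 b * (b - a)\<^sup>2 \<le> (f b - f a)\<^sup>2"
proof -
  define h where "h x = f1 x powr (-1/2)" for x
  have hpos: "0 < h x" if "x \<in> {lo<..<hi}" for x using pos[OF that] by (simp add: h_def)
  have h2: "f1 x = 1 / (h x)\<^sup>2" if "x \<in> {lo<..<hi}" for x
  proof -
    have "h x * h x = f1 x powr (-1)" unfolding h_def using pos[OF that] by (simp flip: powr_add)
    also have "\<dots> = 1 / f1 x" using pos[OF that] by (simp add: powr_minus field_simps)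
    finally show ?thesis by (simp add: power2_eq_square)
  qed
  define L where "L x = h a + (h b - h a) / (b - a) * (x - a)" for x
  have L: "h x \<le> L x" "0 < L x" if "x \<in> {a..b}" for x
  proof -
    have xin: "x \<in> {lo<..<hi}" using that a b by auto
    have "h x \<le> (h b - h a) / (b - a) * (x - a) + h a"
      unfolding h_def
    proof (rule convex_onD_Icc')
      show "convex_on {a..b} (\<lambda>x. f1 x powr (-1/2))"
        by (rule convex_on_subset[OF convex_inverse_sqrt_deriv]) (use a b in auto)
      show "x \<in> {a..b}" by fact
    qed
    then show "h x \<le> L x" by (simp add: L_def)
    with hpos[OF xin] show "0 < L x" by simp
  qed
  \<comment> \<open>The Moebius map with \<open>M a = 0\<close> and derivative
    \<open>1 / (L x)\<^sup>2\<close>. Since \<open>h \<le> L\<close>, the difference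
    \<open>f - M\<close> is nondecreasing.\<close>
  define M where "M x = (x - a) / (h a * L x)" for x
  have "f a - M a \<le> f b - M b"
  proof (rule DERIV_nonneg_imp_nondecreasing[of a b "\<lambda>x. f x - M x"])
    fix x assume x: "a \<le> x" "x \<le> b"
    have xin: "x \<in> {lo<..<hi}" using x a b by auto
    have l: "0 < L x" "h x \<le> L x" using L x by auto
    have h0: "0 < h a" using hpos a by auto
    have "(L has_real_derivative (h b - h a) / (b - a)) (at x)"
      unfolding L_def using ab by (auto intro!: derivative_eq_intros)
    then have "(M has_real_derivative (h a * L x - (x - a) * (h a * ((h b - h a) / (b - a)))) / (h a * L x)\<^sup>2) (at x)"
      unfolding M_def using l h0 by (auto intro!: derivative_eq_intros simp: power2_eq_square)
    also have "h a * L x - (x - a) * (h a * ((h b - h a) / (b - a))) = h a * h a"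
      by (simp add: L_def algebra_simps)
    also have "h a * h a / (h a * L x)\<^sup>2 = 1 / (L x)\<^sup>2" using h0 by (simp add: power2_eq_square)
    finally have M': "(M has_real_derivative 1 / (L x)\<^sup>2) (at x)" .
    have "1 / (L x)\<^sup>2 \<le> f1 x"
      unfolding h2[OF xin] using l hpos[OF xin] by (intro divide_left_mono power_mono) auto
    then show "\<exists>y. ((\<lambda>x. f x - M x) has_real_derivative y) (at x) \<and> 0 \<le> y"
      by (intro exI[of _ "f1 x - 1 / (L x)\<^sup>2"] conjI DERIV_diff D1 xin M') auto
  qed (use ab in auto)
  moreover have "M a = 0" by (simp add: M_def)
  moreover have "M b = (b - a) / (h a * h b)" using ab by (auto simp: M_def L_def)
  ultimately have "(b - a) / (h a * h b) \<le> f b - f a" by simp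
  then have "((b - a) / (h a * h b))\<^sup>2 \<le> (f b - f a)\<^sup>2"
    using ab hpos[OF a] hpos[OF b] by (intro power_mono) auto
  then show ?thesis unfolding h2[OF a] h2[OF b] by (simp add: power_divide power_mult_distrib)
qed

lemma strict_mono_interior:
  assumes "x \<in> {lo<..<hi}" "y \<in> {lo<..<hi}" "x < y"
  shows "f x < f y"
  using assms by (intro DERIV_pos_imp_increasing[of x y f]) (auto intro!: exI D1 pos)

text \<open>By \<open>deriv_product_le\<close> the mixed second derivative of
  \<open>ln ((f y - f x) / (y - x))\<close> is nonpositive. Integrating over \<open>x\<close> in
  \<open>[a, b]\<close> and \<open>y\<close> in \<open>[c, d]\<close> gives the logarithm of the
  claim for the shifted cross ratio. \<open>G\<close> is the difference between \<open>y = d\<close>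
  and \<open>y = c\<close>, and \<open>H\<close> is the derivative in \<open>x\<close>.\<close>

lemma cross_ratio_decreasing_interior:
  assumes p: "a \<in> {lo<..<hi}" "d \<in> {lo<..<hi}" "a < b" "b < c" "c < d"
  shows "cross_ratio (f a) (f b) (f c) (f d) \<le> cross_ratio a b c d"
proof -
  have I: "x \<in> {lo<..<hi}" if "a \<le> x" "x \<le> d" for x using that p by auto
  have sm: "f x < f y" if "a \<le> x" "x < y" "y \<le> d" for x y
    using strict_mono_interior[of x y] I that by auto
  define G where "G x = ln (f d - f x) - ln (d - x) - ln (f c - f x) + ln (c - x)" for x
  have "G b \<le> G a"
  proof (rule DERIV_nonpos_imp_nonincreasing[of a b G])
    fix x assume x: "a \<le> x" "x \<le> b"
    have xI: "x \<in> {lo<..<hi}" using I x p by auto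
    define H where "H y = 1 / (y - x) - f1 x / (f y - f x)" for y
    have "H d \<le> H c"
    proof (rule DERIV_nonpos_imp_nonincreasing[of c d H])
      fix y assume y: "c \<le> y" "y \<le> d"
      have yI: "y \<in> {lo<..<hi}" using I y p by auto
      have xy: "x < y" "f x < f y" using x y p sm by auto
      have "(H has_real_derivative (f1 x * f1 y / (f y - f x)\<^sup>2 - 1 / (y - x)\<^sup>2)) (at y)"
        unfolding H_def using xy
        by (auto intro!: derivative_eq_intros D1 yI simp: power2_eq_square)
      moreover have "f1 x * f1 y / (f y - f x)\<^sup>2 \<le> 1 / (y - x)\<^sup>2"
        using deriv_product_le[OF xI yI xy(1)] xy by (simp add: field_simps)
      ultimately show "\<exists>z. (H has_real_derivative z) (at y) \<and> z \<le> 0" by force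
    qed (use p in auto)
    moreover have "(G has_real_derivative (H d - H c)) (at x)"
      unfolding G_def H_def using x p sm[of x c] sm[of x d]
      by (auto intro!: derivative_eq_intros D1 xI)
    ultimately show "\<exists>y. (G has_real_derivative y) (at x) \<and> y \<le> 0" by force
  qed (use p in auto)
  have *: "D * A / (B * C) \<le> s * q / (r * t)"
    if "A / q / C * t \<le> B / r / D * s" "0 < A" "0 < B" "0 < C" "0 < D" "0 < q" "0 < r" "0 < t"
    for A B C D q r s t :: real
    using that by (simp add: field_simps)
  from \<open>G b \<le> G a\<close> have "exp (G b) \<le> exp (G a)" by simp
  moreover have "exp (G x) = (f d - f x) / (d - x) / (f c - f x) * (c - x)" if "a \<le> x" "x \<le> b" for x
    using that p sm[of x c] sm[of x d] by (simp add: G_def exp_add exp_diff)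
  ultimately have "(f d - f b) / (d - b) / (f c - f b) * (c - b) \<le> (f d - f a) / (d - a) / (f c - f a) * (c - a)"
    using p by simp
  then have "(f c - f a) * (f d - f b) / ((f d - f a) * (f c - f b)) \<le> (c - a) * (d - b) / ((d - a) * (c - b))"
    using p sm[of b c] sm[of a c] sm[of a d] sm[of b d] by (intro *) auto
  then show ?thesis using p sm[of b c] sm[of a b] sm[of c d] by (simp add: cross_ratio_alt)
qed

lemma strict_mono_closed:
  assumes "lo \<le> x" "x < y" "y \<le> hi"
  shows "f x < f y"
proof -
  have ne: "lo < hi" using assms by simp
  have m: "f u \<le> f v" if "lo \<le> u" "u \<le> v" "v \<le> hi" for u v
    by (rule DERIV_nonneg_imp_increasing_open[of u v f])
       (use that in \<open>auto intro!: exI D1 less_imp_le[OF pos] continuous_on_subset[OF cont]\<close>)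
  define u where "u = x + (y - x) / 3"
  define v where "v = x + 2 * (y - x) / 3"
  have "f u < f v" using assms by (intro strict_mono_interior) (auto simp: u_def v_def field_simps)
  moreover have "f x \<le> f u" "f v \<le> f y" using assms by (auto intro!: m simp: u_def v_def field_simps)
  ultimately show ?thesis by simp
qed

lemma cross_ratio_decreasing: "decreases_cross_ratio lo hi f"
  unfolding decreases_cross_ratio_def
proof (intro allI impI, rule tendsto_le[of "at_right (0::real)"])
  fix a b c d assume p: "lo \<le> a" "a < b" "b < c" "c < d" "d \<le> hi"
  have ta: "((\<lambda>t. a + t) \<longlongrightarrow> a) (at_right 0)" by (auto intro!: tendsto_eq_intros)
  have td: "((\<lambda>t. d - t) \<longlongrightarrow> d) (at_right 0)" by (auto intro!: tendsto_eq_intros)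
  have ev: "\<forall>\<^sub>F t in at_right 0. 0 < t \<and> t < b - a \<and> t < d - c"
    using p by (intro eventually_conj eventually_at_right_less eventually_at_rightI[of 0 "b - a"]
      eventually_at_rightI[of 0 "d - c"]) auto
  show "((\<lambda>t. cross_ratio (a + t) b c (d - t)) \<longlongrightarrow> cross_ratio a b c d) (at_right 0)"
    unfolding cross_ratio_def using p by (intro tendsto_intros ta td) auto
  have fa: "((\<lambda>t. f (a + t)) \<longlongrightarrow> f a) (at_right 0)"
    by (rule continuous_on_tendsto_compose[OF cont ta])
       (use p ev in \<open>auto elim!: eventually_mono\<close>)
  have fd: "((\<lambda>t. f (d - t)) \<longlongrightarrow> f d) (at_right 0)"
    by (rule continuous_on_tendsto_compose[OF cont td])
       (use p ev in \<open>auto elim!: eventually_mono\<close>)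
  show "((\<lambda>t. cross_ratio (f (a + t)) (f b) (f c) (f (d - t))) \<longlongrightarrow> cross_ratio (f a) (f b) (f c) (f d)) (at_right 0)"
    unfolding cross_ratio_def
    using p strict_mono_closed[of a d] strict_mono_closed[of b c]
    by (intro tendsto_intros fa fd) auto
  show "\<forall>\<^sub>F t in at_right 0. cross_ratio (f (a + t)) (f b) (f c) (f (d - t)) \<le> cross_ratio (a + t) b c (d - t)"
    using ev by eventually_elim (use p in \<open>auto intro!: cross_ratio_decreasing_interior\<close>)
qed simp

end

section \<open>Combinatorics of a lift with a flat piece\<close>

lemma add_int_period:
  fixes F :: "real \<Rightarrow> real"
  assumes F: "\<And>y. F (y + c) = F y + c"
  shows "F (y + of_int k * c) = F y + of_int k * c"
proof -
  have nat: "F (y + of_nat n * c) = F y + of_nat n * c" for y n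
  proof (induction n)
    case (Suc n)
    have "F (y + of_nat (Suc n) * c) = F ((y + of_nat n * c) + c)" by (simp add: algebra_simps)
    then show ?case by (simp only: F Suc) (simp add: algebra_simps)
  qed simp
  show ?thesis
  proof (cases "k \<ge> 0")
    case True
    then show ?thesis using nat[of y "nat k"] by simp
  next
    case False
    then show ?thesis using nat[of "y + of_int k * c" "nat (-k)"] by simp
  qed
qed

lemma iter_add_int_period:
  fixes F :: "real \<Rightarrow> real"
  assumes F: "\<And>y. F (y + c) = F y + c"
  shows "(F ^^ j) (y + of_int k * c) = (F ^^ j) y + of_int k * c"
  by (induction j) (auto simp: add_int_period[of F c, OF F])

lemma continuous_on_iter:
  fixes F :: "real \<Rightarrow> real"
  assumes F: "continuous_on UNIV F"
  shows "continuous_on S (F ^^ j)"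
proof (induction j)
  case (Suc j)
  then show ?case using continuous_on_compose2[OF F Suc] by (simp add: comp_def)
qed (auto simp: id_def)

text \<open>The flat piece is \<open>[a, b]\<close>, and \<open>[l n, r n]\<close> is its preimage under \<open>T n\<close>. The assumptions are invariant
  under the reflection \<open>y \<mapsto> - y\<close> combined with the index shift \<open>n \<mapsto> n + 1\<close>; hence it suffices to
  treat even \<open>n\<close>, for which the preimage lies to the left of \<open>a\<close> and the point \<open>e n\<close> to the right of \<open>b\<close>.\<close>

locale fib_flat_lift =
  fixes F :: "real \<Rightarrow> real" and c a b g :: real and q :: "nat \<Rightarrow> nat" and p :: "nat \<Rightarrow> int"
    and l r :: "nat \<Rightarrow> real"
  assumes ab: "a < b" and bc: "b < a + c"
    and cont: "continuous_on UNIV F"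
    and shift: "F (y + c) = F y + c"
    and mono: "y \<le> z \<Longrightarrow> F y \<le> F z"
    and flat: "F b = F a"
    and inj: "F y = F z \<Longrightarrow> y < z \<Longrightarrow> \<exists>k::int. a + of_int k * c \<le> y \<and> z \<le> b + of_int k * c"
    and rot_gt: "0 < j \<Longrightarrow> of_int k < of_nat j * g \<Longrightarrow> y + of_int k * c < (F ^^ j) y"
    and rot_lt: "0 < j \<Longrightarrow> of_nat j * g < of_int k \<Longrightarrow> (F ^^ j) y < y + of_int k * c"
    and irr: "0 < j \<Longrightarrow> of_nat j * g \<noteq> of_int k"
    and q_pos: "0 < q n" and q_rec: "q (n + 2) = q (n + 1) + q n"
    and p_rec: "p (n + 2) = p (n + 1) + p n"
    and sgn_even: "even n \<Longrightarrow> of_int (p n) < of_nat (q n) * g"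
    and sgn_odd: "odd n \<Longrightarrow> of_nat (q n) * g < of_int (p n)"
    and best: "0 < i \<Longrightarrow> i < q n \<Longrightarrow>
      \<bar>of_nat (q n) * g - of_int (p n)\<bar> \<le> \<bar>of_nat i * g - of_int k\<bar>"
    and cross_ratio_F: "x1 < x2 \<Longrightarrow> x2 < x3 \<Longrightarrow> x3 < x4 \<Longrightarrow>
      (\<And>y k::int. x1 < y \<Longrightarrow> y < x4 \<Longrightarrow> \<not> (a + of_int k * c \<le> y \<and> y \<le> b + of_int k * c) \<and>
         y \<noteq> F a + of_int k * c \<and> y \<noteq> F (F a) + of_int k * c) \<Longrightarrow>
      cross_ratio (F x1) (F x2) (F x3) (F x4) \<le> cross_ratio x1 x2 x3 x4"
    and l_eq: "(F ^^ q n) (l n) = a + of_int (p n) * c"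
    and r_eq: "(F ^^ q n) (r n) = b + of_int (p n) * c"
begin

abbreviation in_flat :: "real \<Rightarrow> int \<Rightarrow> bool" where
  "in_flat y k \<equiv> a + of_int k * c \<le> y \<and> y \<le> b + of_int k * c"

definition T :: "nat \<Rightarrow> real \<Rightarrow> real" where "T n y = (F ^^ q n) y - of_int (p n) * c"

definition e :: "nat \<Rightarrow> real" where "e n = T n a"

lemma shift_int: "F (y + of_int k * c) = F y + of_int k * c"
  using add_int_period shift .

lemma iter_shift: "(F ^^ j) (y + of_int k * c) = (F ^^ j) y + of_int k * c"
  using iter_add_int_period shift .

lemma iter_add: "(F ^^ m) ((F ^^ n) y) = (F ^^ (m + n)) y"
  by (simp add: funpow_add)

lemma iter_mono: "y \<le> z \<Longrightarrow> (F ^^ j) y \<le> (F ^^ j) z"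
  by (induction j) (auto intro: mono)

lemma F_flat: "z \<in> {a..b} \<Longrightarrow> F z = F a"
  using mono[of a z] mono[of z b] flat by auto

lemma iter_flat: "z \<in> {a..b} \<Longrightarrow> 0 < j \<Longrightarrow> (F ^^ j) z = (F ^^ j) a"
proof -
  assume z: "z \<in> {a..b}" and "0 < j"
  then obtain i where "j = Suc i" by (cases j) auto
  then show ?thesis by (simp only: funpow_Suc_right comp_apply F_flat[OF z])
qed

text \<open>The whole flat piece has one image, so a return yields a point \<open>z'\<close> with
  \<open>(F ^^ j) z' = z' + of_int k * c\<close>. This contradicts irrationality of
  \<open>g\<close>.\<close>

lemma no_return: "0 < j \<Longrightarrow> z \<in> {a..b} \<Longrightarrow> \<not> in_flat ((F ^^ j) z) k"
proof
  assume j: "0 < j" and z: "z \<in> {a..b}" and fl: "in_flat ((F ^^ j) z) k"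
  define z' where "z' = (F ^^ j) z - of_int k * c"
  have z': "z' \<in> {a..b}" using fl by (auto simp: z'_def)
  have "(F ^^ j) z' = z' + of_int k * c"
    using iter_flat[OF z j] iter_flat[OF z' j] by (simp add: z'_def)
  then show False using irr[OF j, of k] rot_gt[OF j, of k z'] rot_lt[OF j, of k z'] by linarith
qed

lemma iter_inj:
  assumes "(F ^^ j) y = (F ^^ j) z" "y < z"
  shows "\<exists>i<j. \<exists>k. in_flat ((F ^^ i) y) k \<and> in_flat ((F ^^ i) z) k"
  using assms
proof (induction j)
  case (Suc j)
  show ?case
  proof (cases "(F ^^ j) y = (F ^^ j) z")
    case True
    then show ?thesis using Suc by (metis less_Suc_eq)
  next
    case False
    then have lt: "(F ^^ j) y < (F ^^ j) z" using iter_mono[of y z j] Suc by auto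
    then obtain k where "a + of_int k * c \<le> (F ^^ j) y" "(F ^^ j) z \<le> b + of_int k * c"
      using inj[OF _ lt] Suc.prems by auto
    then show ?thesis using lt by (intro exI[of _ j]) (auto intro!: exI[of _ k])
  qed
qed simp

lemma in_flat_final:
  assumes "in_flat ((F ^^ i) y) k" "i < j"
  shows "\<not> in_flat ((F ^^ j) y) k'"
proof -
  define z where "z = (F ^^ i) y - of_int k * c"
  have z: "z \<in> {a..b}" using assms by (auto simp: z_def)
  have "(F ^^ j) y = (F ^^ (j - i)) ((F ^^ i) y)"
    using assms by (simp add: iter_add)
  also have "(F ^^ i) y = z + of_int k * c" by (simp add: z_def)
  finally have "(F ^^ j) y = (F ^^ (j - i)) z + of_int k * c" by (simp only: iter_shift)
  moreover have "\<not> in_flat ((F ^^ (j - i)) z) (k' - k)" using assms z by (intro no_return) auto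
  ultimately show ?thesis by (auto simp: algebra_simps)
qed

text \<open>Two orbits can merge only inside a flat piece, and an orbit that is in a flat piece at
  time \<open>j\<close> was in none before.\<close>

lemma iter_less:
  assumes "in_flat ((F ^^ j) y) k \<or> in_flat ((F ^^ j) z) k" "y < z"
  shows "(F ^^ j) y < (F ^^ j) z"
proof -
  have "(F ^^ j) y \<noteq> (F ^^ j) z"
    using iter_inj[of j y z] in_flat_final assms by metis
  then show ?thesis using iter_mono[of y z j] assms by auto
qed

section \<open>The return maps \<open>T n\<close> and the order of preimages and images near the
  flat piece\<close>

lemma T_mono: "y \<le> z \<Longrightarrow> T n y \<le> T n z"
  by (simp add: T_def iter_mono)

lemma T_less_cancel: "T n y < T n z \<Longrightarrow> y < z"
  using T_mono[of z y n] by (meson not_le)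

lemma T_less:
  assumes "T n y \<in> {a..b} \<or> T n z \<in> {a..b}" "y < z"
  shows "T n y < T n z"
  using iter_less[where j="q n" and y=y and z=z and k="p n"] assms by (auto simp: T_def algebra_simps)

lemma T_T: "T m (T n y) = (F ^^ (q m + q n)) y - of_int (p m + p n) * c"
proof -
  have "T n y = (F ^^ q n) y + of_int (- p n) * c" by (simp add: T_def)
  then show ?thesis unfolding T_def[of m] by (simp only: iter_shift) (simp add: funpow_add algebra_simps)
qed

lemma T_Suc_Suc: "T (n + 1) (T n y) = T (n + 2) y" "T n (T (n + 1) y) = T (n + 2) y"
  by (simp_all only: T_T) (simp_all only: T_def q_rec p_rec add.commute)

lemma T_l: "T n (l n) = a" and T_r: "T n (r n) = b"
  using l_eq[of n] r_eq[of n] by (auto simp: T_def)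

lemma T_b: "T n b = e n"
  using iter_flat[of b "q n"] ab q_pos[of n] by (simp add: e_def T_def)

lemma T_eq_l: "T n y = a \<Longrightarrow> y = l n"
  using T_less[of n y "l n"] T_less[of n "l n" y] T_l[of n] ab
  by (cases y "l n" rule: linorder_cases) auto

lemma T_eq_r: "T n y = b \<Longrightarrow> y = r n"
  using T_less[of n y "r n"] T_less[of n "r n" y] T_r[of n] ab
  by (cases y "r n" rule: linorder_cases) auto

lemma l_less_r: "l n < r n"
  using T_less_cancel[of n "l n" "r n"] T_l T_r ab by simp

lemma T_l_Suc_Suc: "T (n + 1) (l (n + 2)) = l n"
  by (rule T_eq_l) (simp only: T_Suc_Suc T_l)

lemma T_r_Suc_Suc: "T (n + 1) (r (n + 2)) = r n"
  by (rule T_eq_r) (simp only: T_Suc_Suc T_r)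

lemma T_e: "T (n + 1) (e n) = e (n + 2)" "T n (e (n + 1)) = e (n + 2)"
  by (simp_all only: e_def T_Suc_Suc)

lemma e_even: "even n \<Longrightarrow> b < e n"
  using rot_gt[OF q_pos sgn_even, of n b] unfolding T_b[symmetric] by (simp add: T_def)

lemma e_odd: "odd n \<Longrightarrow> e n < a"
  using rot_lt[OF q_pos sgn_odd, of n a] by (simp add: e_def T_def)

text \<open>Every comparison is pulled back through \<open>T n\<close> or \<open>T (n + 2)\<close>.
  The images are endpoints of the flat piece and points \<open>e\<close>, whose side is fixed by the
  sign of \<open>q * g - p\<close> at their index.\<close>

lemma order_left:
  assumes "even n"
  shows "r n < e (n + 1)" "e (n + 1) < l (n + 2)" "e (n + 1) < a"
proof -
  show "r n < e (n + 1)"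
    using e_even[of "n+2"] assms by - (rule T_less_cancel[of n], simp only: T_r T_e, simp)
  have "T (n + 2) (e (n + 1)) = e (n + 3)"
    using T_e(1)[of "n+1"] by (simp add: eval_nat_numeral)
  then show "e (n + 1) < l (n + 2)"
    using e_odd[of "n+3"] assms by - (rule T_less_cancel[of "n+2"], simp only: T_l, simp)
  show "e (n + 1) < a" using e_odd[of "n+1"] assms by simp
qed

lemma order_right:
  assumes "even n"
  shows "e (n + 2) < l (n + 1)" "r (n + 1) < e n" "b < e n" "b < l (n + 1)"
proof -
  have "T (n + 1) (e (n + 2)) = e (n + 3)"
    using T_e(2)[of "n+1"] by (simp add: eval_nat_numeral)
  then show 1: "e (n + 2) < l (n + 1)"
    using e_odd[of "n+3"] assms by - (rule T_less_cancel[of "n+1"], simp only: T_l, simp)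
  show "r (n + 1) < e n"
    using e_even[of "n+2"] assms by - (rule T_less_cancel[of "n+1"], simp only: T_r T_e, simp)
  show "b < e n" using e_even[of n] assms by simp
  show "b < l (n + 1)" using e_even[of "n+2"] assms 1 by simp
qed

text \<open>Suppose the orbit of \<open>y\<close> visits the translate by \<open>k\<close> at time
  \<open>i\<close>. As \<open>y < a\<close>, it has moved forward by more than \<open>k\<close>
  periods, so \<open>k < i * g\<close>. The remaining \<open>q n - i\<close> iterates carry it past
  \<open>a + p n * c\<close>, so also \<open>p n - k < (q n - i) * g\<close>. Thus
  \<open>i * g - k\<close> lies strictly between 0 and \<open>q n * g - p n\<close>, against best
  approximation.\<close>

lemma avoid_left:
  assumes n: "even n" and y: "l n < y" "y < a" and i: "0 < i" "i < q n"
  shows "\<not> in_flat ((F ^^ i) y) k"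
proof
  assume fl: "in_flat ((F ^^ i) y) k"
  define z where "z = (F ^^ i) y - of_int k * c"
  have z: "z \<in> {a..b}" using fl by (auto simp: z_def)
  have Fz: "(F ^^ i) y = z + of_int k * c" by (simp add: z_def)
  have gt: "of_int k < of_nat i * g"
    using irr[OF i(1), of k] rot_lt[OF i(1), of k y] Fz z y by fastforce
  have "T n (l n) < T n y" using T_l[of n] y ab by (intro T_less) auto
  then have "a + of_int (p n) * c < (F ^^ q n) y" by (simp add: T_l) (simp add: T_def)
  also have "(F ^^ q n) y = (F ^^ (q n - i)) (z + of_int k * c)"
    using i Fz by (simp add: iter_add flip: Fz)
  also have "\<dots> = (F ^^ (q n - i)) a + of_int k * c"
    using i iter_flat[OF z, of "q n - i"] by (simp only: iter_shift)
  finally have *: "a + of_int (p n - k) * c < (F ^^ (q n - i)) a" by (simp add: algebra_simps)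
  have "\<not> of_nat (q n - i) * g < of_int (p n - k)"
    using rot_lt[of "q n - i" "p n - k" a] * i by auto
  then have "of_int (p n - k) < of_nat (q n - i) * g"
    using irr[of "q n - i" "p n - k"] i by auto
  then have "of_nat i * g - of_int k < of_nat (q n) * g - of_int (p n)"
    using i by (simp add: of_nat_diff algebra_simps)
  then show False using best[OF i, of k] gt by linarith
qed

lemma reflect:
  "fib_flat_lift (\<lambda>y. - F (- y)) c (- b) (- a) (- g) (\<lambda>n. q (n + 1)) (\<lambda>n. - p (n + 1))
     (\<lambda>n. - r (n + 1)) (\<lambda>n. - l (n + 1))"
proof -
  have it: "((\<lambda>y. - F (- y)) ^^ j) y = - (F ^^ j) (- y)" for j y
    by (induction j) auto
  show ?thesis
  proof
    show "continuous_on UNIV (\<lambda>y. - F (- y))"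
      by (intro continuous_intros continuous_on_compose2[OF cont]) auto
    show "- F (- (y + c)) = - F (- y) + c" for y using shift[of "- y - c"] by simp
    show "- F (- y) \<le> - F (- z)" if "y \<le> z" for y z using mono[of "-z" "-y"] that by simp
    show "\<exists>k::int. - b + of_int k * c \<le> y \<and> z \<le> - a + of_int k * c"
      if "- F (- y) = - F (- z)" "y < z" for y z
    proof -
      have "F (-z) = F (-y)" "-z < -y" using that by auto
      from inj[OF this] obtain k :: int where "a + of_int k * c \<le> -z" "-y \<le> b + of_int k * c"
        by blast
      then show ?thesis by (intro exI[of _ "-k"]) auto
    qed
    show "y + of_int k * c < ((\<lambda>y. - F (- y)) ^^ j) y" if "0 < j" "of_int k < of_nat j * - g" for j k y
      using rot_lt[of j "-k" "-y"] that by (simp add: it)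
    show "((\<lambda>y. - F (- y)) ^^ j) y < y + of_int k * c" if "0 < j" "of_nat j * - g < of_int k" for j k y
      using rot_gt[of j "-k" "-y"] that by (simp add: it)
    show "of_nat j * - g \<noteq> of_int k" if "0 < j" for j k using irr[OF that, of "-k"] by auto
    show "of_int (- p (n + 1)) < of_nat (q (n + 1)) * - g" if "even n" for n
      using sgn_odd[of "n+1"] that by auto
    show "of_nat (q (n + 1)) * - g < of_int (- p (n + 1))" if "odd n" for n
      using sgn_even[of "n+1"] that by auto
    show "\<bar>of_nat (q (n + 1)) * - g - of_int (- p (n + 1))\<bar> \<le> \<bar>of_nat i * - g - of_int k\<bar>"
      if "0 < i" "i < q (n + 1)" for i n k
      using best[OF that, of "-k"] by linarith
    show "((\<lambda>y. - F (- y)) ^^ q (n + 1)) (- r (n + 1)) = - b + of_int (- p (n + 1)) * c" for n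
      using r_eq[of "n+1"] by (simp add: it)
    show "((\<lambda>y. - F (- y)) ^^ q (n + 1)) (- l (n + 1)) = - a + of_int (- p (n + 1)) * c" for n
      using l_eq[of "n+1"] by (simp add: it)
    show "q (n + 2 + 1) = q (n + 1 + 1) + q (n + 1)" for n using q_rec[of "n+1"] by (simp add: add_ac)
    show "- p (n + 2 + 1) = - p (n + 1 + 1) + - p (n + 1)" for n using p_rec[of "n+1"] by (simp add: add_ac)
    show "cross_ratio (- F (- x1)) (- F (- x2)) (- F (- x3)) (- F (- x4)) \<le> cross_ratio x1 x2 x3 x4"
      if x: "x1 < x2" "x2 < x3" "x3 < x4" and
        av: "\<And>y k::int. x1 < y \<Longrightarrow> y < x4 \<Longrightarrow>
          \<not> (- b + of_int k * c \<le> y \<and> y \<le> - a + of_int k * c) \<and>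
          y \<noteq> - F (- (- b)) + of_int k * c \<and> y \<noteq> - F (- (- F (- (- b)))) + of_int k * c"
      for x1 x2 x3 x4
    proof -
      have "cross_ratio (F (-x4)) (F (-x3)) (F (-x2)) (F (-x1)) \<le> cross_ratio (-x4) (-x3) (-x2) (-x1)"
      proof (rule cross_ratio_F)
        fix y and k :: int assume "- x4 < y" "y < - x1"
        then show "\<not> in_flat y k \<and> y \<noteq> F a + of_int k * c \<and> y \<noteq> F (F a) + of_int k * c"
          using av[of "-y" "-k"] flat by auto
      qed (use x in auto)
      then show ?thesis by (simp only: cross_ratio_reflect)
    qed
  qed (use ab bc flat q_pos in auto)
qed

lemma iter_reflect: "((\<lambda>y. - F (- y)) ^^ j) y = - (F ^^ j) (- y)"
  by (induction j) auto

lemma e_reflect: "fib_flat_lift.e (\<lambda>y. - F (- y)) c (- b) (\<lambda>n. q (n + 1)) (\<lambda>n. - p (n + 1)) n = - e (n + 1)"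
  unfolding fib_flat_lift.e_def[OF reflect] fib_flat_lift.T_def[OF reflect] T_b[symmetric] T_def
  by (simp add: iter_reflect)

lemma avoid_right:
  assumes n: "even n" and y: "b < y" "y < r (n + 1)" and i: "0 < i" "i < q (n + 1)"
  shows "\<not> in_flat ((F ^^ i) y) k"
  using fib_flat_lift.avoid_left[OF reflect n _ _ i, of "-y" "-k"] y by (auto simp: iter_reflect)

text \<open>The junctions \<open>F a\<close> and \<open>F (F a)\<close> of the smooth branches are hit only by the first two
  iterates, which is why the comparison starts at \<open>F ^^ 3\<close>.\<close>

lemma cross_ratio_iter:
  assumes x: "x1 \<le> x2" "x2 \<le> x3" "x3 \<le> x4" and J: "3 \<le> J"
    and lt: "(F ^^ J) x1 < (F ^^ J) x2" "(F ^^ J) x2 < (F ^^ J) x3" "(F ^^ J) x3 < (F ^^ J) x4"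
    and av: "\<And>y i k. x1 < y \<Longrightarrow> y < x4 \<Longrightarrow> 0 < i \<Longrightarrow> i < J \<Longrightarrow> \<not> in_flat ((F ^^ i) y) k"
  shows "cross_ratio ((F ^^ J) x1) ((F ^^ J) x2) ((F ^^ J) x3) ((F ^^ J) x4) \<le>
    cross_ratio ((F ^^ 3) x1) ((F ^^ 3) x2) ((F ^^ 3) x3) ((F ^^ 3) x4)"
proof -
  have lt': "(F ^^ i) u < (F ^^ i) v" if "(F ^^ J) u < (F ^^ J) v" "i \<le> J" for u v i
  proof (rule ccontr)
    assume "\<not> ?thesis"
    then have "(F ^^ (J - i)) ((F ^^ i) v) \<le> (F ^^ (J - i)) ((F ^^ i) u)"
      by - (rule iter_mono, simp)
    then show False using that by (simp add: iter_add)
  qed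
  have "cross_ratio ((F ^^ (3 + i)) x1) ((F ^^ (3 + i)) x2) ((F ^^ (3 + i)) x3) ((F ^^ (3 + i)) x4) \<le>
    cross_ratio ((F ^^ 3) x1) ((F ^^ 3) x2) ((F ^^ 3) x3) ((F ^^ 3) x4)" if "3 + i \<le> J" for i
    using that
  proof (induction i)
    case (Suc i)
    let ?f = "F ^^ (3 + i)"
    have "cross_ratio (F (?f x1)) (F (?f x2)) (F (?f x3)) (F (?f x4)) \<le> cross_ratio (?f x1) (?f x2) (?f x3) (?f x4)"
    proof (rule cross_ratio_F)
      fix y and k :: int assume y: "?f x1 < y" "y < ?f x4"
      \<comment> \<open>Every point of the image interval is an iterate of some point of the
        original interval, and to that point the avoidance hypothesis applies.\<close>
      have "\<exists>y0. x1 \<le> y0 \<and> y0 \<le> x4 \<and> ?f y0 = y"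
        using y x continuous_on_iter[OF cont] by (intro IVT') auto
      then obtain y0 where y0: "x1 \<le> y0" "y0 \<le> x4" "?f y0 = y" by auto
      have y0': "x1 < y0" "y0 < x4" using y0 y by (auto simp: order.order_iff_strict)
      note av' = av[OF y0']
      \<comment> \<open>One and two steps back along the orbit: if \<open>y\<close> were a translate
        of \<open>F a\<close> or \<open>F (F a)\<close>, then \<open>z\<close> or \<open>v\<close>
        would lie in a flat piece. Their times \<open>2 + i\<close> and \<open>1 + i\<close> are
        positive, as \<open>av\<close> requires.\<close>
      define z where "z = (F ^^ (2 + i)) y0"
      define v where "v = (F ^^ (1 + i)) y0"
      have zv: "y = F z" "z = F v" using y0 by (auto simp: z_def v_def numeral_3_eq_3)
      have avz: "\<not> in_flat z k" and avv: "\<not> in_flat v k" for k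
        using av' Suc.prems by (auto simp: z_def v_def simp del: funpow.simps)
      have F_eq: "z' = u + of_int k * c \<or> in_flat z' k' \<or> (\<exists>k'. in_flat z' k')"
        if "F z' = F u + of_int k * c" for z' u k k'
      proof -
        have "F z' = F (u + of_int k * c)" using that by (simp add: shift_int)
        then show ?thesis using inj[of z' "u + of_int k * c"] inj[of "u + of_int k * c" z']
          by (cases z' "u + of_int k * c" rule: linorder_cases) (force, simp, force)
      qed
      have notin: "\<not> in_flat (a + of_int k * c) k \<Longrightarrow> False" for k using ab by simp
      have nF: "F z' \<noteq> F a + of_int k * c" if "\<And>k. \<not> in_flat z' k" for z' k
        using F_eq[of z' a k] that notin by metis
      show "\<not> in_flat y k \<and> y \<noteq> F a + of_int k * c \<and> y \<noteq> F (F a) + of_int k * c"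
      proof (intro conjI)
        show "\<not> in_flat y k" using av'[of "3 + i"] Suc.prems y0 by auto
        show "y \<noteq> F a + of_int k * c" unfolding zv(1) by (rule nF) (rule avz)
        show "y \<noteq> F (F a) + of_int k * c"
        proof
          assume "y = F (F a) + of_int k * c"
          then have "z = F a + of_int k * c" using F_eq[of z "F a" k] avz zv by metis
          then show False using nF[of v k] avv zv by metis
        qed
      qed
    qed (use lt lt' Suc.prems in auto)
    moreover have fs: "(F ^^ (3 + Suc i)) u = F (?f u)" for u
      by (simp only: add_Suc_right funpow.simps comp_apply)
    moreover note Suc.IH
    ultimately show ?case unfolding fs using Suc.prems by linarith
  qed simp
  from this[of "J - 3"] J show ?thesis by simp
qed

section \<open>Cross ratio comparisons for the return maps\<close>

lemma cross_ratio_T: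
  assumes x: "x1 \<le> x2" "x2 \<le> x3" "x3 \<le> x4" and J: "3 \<le> q n"
    and lt: "T n x1 < T n x2" "T n x2 < T n x3" "T n x3 < T n x4"
    and av: "\<And>y i k. x1 < y \<Longrightarrow> y < x4 \<Longrightarrow> 0 < i \<Longrightarrow> i < q n \<Longrightarrow> \<not> in_flat ((F ^^ i) y) k"
  shows "cross_ratio (T n x1) (T n x2) (T n x3) (T n x4) \<le>
    cross_ratio ((F ^^ 3) x1) ((F ^^ 3) x2) ((F ^^ 3) x3) ((F ^^ 3) x4)"
    and "(F ^^ 3) x1 < (F ^^ 3) x2" "(F ^^ 3) x2 < (F ^^ 3) x3" "(F ^^ 3) x3 < (F ^^ 3) x4"
proof -
  show "cross_ratio (T n x1) (T n x2) (T n x3) (T n x4) \<le>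
    cross_ratio ((F ^^ 3) x1) ((F ^^ 3) x2) ((F ^^ 3) x3) ((F ^^ 3) x4)"
    using cross_ratio_iter[OF x J _ _ _ av] lt by (simp add: T_def cross_ratio_def)
  have lt': "(F ^^ 3) u < (F ^^ 3) v" if "T n u < T n v" for u v
  proof (rule ccontr)
    assume "\<not> ?thesis"
    then have "(F ^^ (q n - 3)) ((F ^^ 3) v) \<le> (F ^^ (q n - 3)) ((F ^^ 3) u)"
      by - (rule iter_mono, simp)
    then show False using that J unfolding T_def by (simp add: iter_add)
  qed
  show "(F ^^ 3) x1 < (F ^^ 3) x2" "(F ^^ 3) x2 < (F ^^ 3) x3" "(F ^^ 3) x3 < (F ^^ 3) x4"
    using lt lt' by auto
qed

text \<open>Source of the first relation. \<open>T (n + 1)\<close> sends \<open>l (n + 2)\<close>,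
  \<open>r (n + 2)\<close>, \<open>a\<close>, \<open>r (n + 1)\<close> to \<open>l n\<close>,
  \<open>r n\<close>, \<open>e (n + 1)\<close>, \<open>b\<close>, and the last image gap contains
  the flat piece. The source interval contains the flat piece too; this is harmless because the
  piece never returns to its translates, and the source gap beyond \<open>a\<close> enters only
  through a factor at most 1.\<close>

lemma preimage_ratio_le:
  assumes n: "even n" and q: "3 \<le> q (n + 1)"
  shows "(r n - l n) * (b - e (n + 1)) / ((b - l n) * (e (n + 1) - r n))
    \<le> ((F ^^ 3) (r (n + 2)) - (F ^^ 3) (l (n + 2))) / ((F ^^ 3) a - (F ^^ 3) (r (n + 2)))"
    and "(F ^^ 3) (r (n + 2)) < (F ^^ 3) a"
proof -
  note ol = order_left[OF n] order_left[of "n+2"] l_less_r[of n] l_less_r[of "n+2"] l_less_r[of "n+1"] order_right[OF n]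
  have im: "T (n+1) (l (n+2)) = l n" "T (n+1) (r (n+2)) = r n" "T (n+1) a = e (n+1)" "T (n+1) (r (n+1)) = b"
    by (simp_all only: T_l_Suc_Suc T_r_Suc_Suc T_r e_def)
  have pts: "l (n+2) < r (n+2)" "r (n+2) < a" "a < r (n+1)" using ol n ab by auto
  have av: "\<not> in_flat ((F ^^ i) y) k" if "l (n+2) < y" "y < r (n+1)" "0 < i" "i < q (n+1)" for y i k
  proof -
    consider "y < a" | "y \<in> {a..b}" | "b < y" by force
    then show ?thesis
    proof cases
      case 1
      then show ?thesis using avoid_left[of "n+2" y i k] n that q_rec[of n] by auto
    next
      case 2
      then show ?thesis using no_return that by blast
    next
      case 3
      then show ?thesis using avoid_right[OF n, of y i k] that by auto
    qed
  qed
  have img: "l n < r n" "r n < e (n+1)" "e (n+1) < b" using ol ab n by auto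
  note * = cross_ratio_T[OF less_imp_le[OF pts(1)] less_imp_le[OF pts(2)] less_imp_le[OF pts(3)] q, unfolded im, OF img av]
  show "(F ^^ 3) (r (n + 2)) < (F ^^ 3) a" using * by simp
  let ?A = "(F ^^ 3) (l (n+2))" and ?B = "(F ^^ 3) (r (n+2))" and ?C = "(F ^^ 3) a" and ?D = "(F ^^ 3) (r (n+1))"
  have "(r n - l n) * (b - e (n + 1)) / ((b - l n) * (e (n + 1) - r n)) \<le> cross_ratio ?A ?B ?C ?D"
    using *(1) by (simp add: cross_ratio_def)
  also have "\<dots> = (?B - ?A) / (?C - ?B) * ((?D - ?C) / (?D - ?A))" by (simp add: cross_ratio_def)
  also have "\<dots> \<le> (?B - ?A) / (?C - ?B) * 1"
    using *(2-4) by (intro mult_left_mono) auto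
  finally show "(r n - l n) * (b - e (n + 1)) / ((b - l n) * (e (n + 1) - r n)) \<le> (?B - ?A) / (?C - ?B)" by simp
qed

text \<open>Source of the second relation. \<open>T n\<close> sends \<open>l n\<close>,
  \<open>r n\<close>, \<open>e (n + 1)\<close>, \<open>a\<close> to \<open>a\<close>,
  \<open>b\<close>, \<open>e (n + 2)\<close>, \<open>e n\<close>. The first gap becomes the flat
  piece itself, so \<open>(e (n + 2) - a) / (e n - a)\<close> is close to 1 once \<open>e n\<close>
  is close to \<open>b\<close>.\<close>

lemma image_ratio_le:
  assumes n: "even n" and q: "3 \<le> q n"
  shows "(e (n + 2) - a) * (e n - b) / ((e n - a) * (e (n + 2) - b))
    \<le> ((F ^^ 3) a - (F ^^ 3) (r n)) / ((F ^^ 3) (e (n + 1)) - (F ^^ 3) (r n))"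
    and "(F ^^ 3) (r n) < (F ^^ 3) (e (n + 1))" "(F ^^ 3) (e (n + 1)) < (F ^^ 3) a"
proof -
  note ol = order_left[OF n] l_less_r[of n] l_less_r[of "n+1"] order_right[OF n] order_right[of "n+2"]
  have im: "T n (l n) = a" "T n (r n) = b" "T n (e (n+1)) = e (n+2)" "T n a = e n"
    by (simp_all only: T_l T_r T_e e_def[symmetric])
  have pts: "l n < r n" "r n < e (n+1)" "e (n+1) < a" using ol by auto
  have img: "a < b" "b < e (n+2)" "e (n+2) < e n" using ol ab n by auto
  note * = cross_ratio_T[OF less_imp_le[OF pts(1)] less_imp_le[OF pts(2)] less_imp_le[OF pts(3)] q, unfolded im, OF img avoid_left[OF n]]
  show "(F ^^ 3) (r n) < (F ^^ 3) (e (n + 1))" "(F ^^ 3) (e (n + 1)) < (F ^^ 3) a" using * by auto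
  let ?A = "(F ^^ 3) (l n)" and ?B = "(F ^^ 3) (r n)" and ?C = "(F ^^ 3) (e (n+1))" and ?D = "(F ^^ 3) a"
  have "(e (n + 2) - a) * (e n - b) / ((e n - a) * (e (n + 2) - b)) \<le> (?C - ?A) * (?D - ?B) / ((?D - ?A) * (?C - ?B))"
  proof -
    have "cross_ratio ?A ?B ?C ?D = (?C - ?A) * (?D - ?B) / ((?D - ?A) * (?C - ?B)) - 1"
      by (rule cross_ratio_alt) (use * in auto)
    then show ?thesis using *(1) unfolding cross_ratio_alt[OF img] by linarith
  qed
  also have "\<dots> = (?D - ?B) / (?C - ?B) * ((?C - ?A) / (?D - ?A))" by (simp add: mult_ac)
  also have "\<dots> \<le> (?D - ?B) / (?C - ?B) * 1"
    using *(2-4) by (intro mult_left_mono) auto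
  finally show "(e (n + 2) - a) * (e n - b) / ((e n - a) * (e (n + 2) - b)) \<le> (?D - ?B) / (?C - ?B)" by simp
qed

text \<open>The orbits of \<open>z\<close> and \<open>a\<close> could merge only in a common flat
  piece. By \<open>no_return\<close> only time 0 is possible, and no translate of the flat piece
  contains both \<open>a\<close> and a smaller point.\<close>

lemma F3_less: "z < a \<Longrightarrow> (F ^^ 3) z < (F ^^ 3) a"
proof -
  assume z: "z < a"
  have "(F ^^ 3) z \<noteq> (F ^^ 3) a"
  proof
    assume "(F ^^ 3) z = (F ^^ 3) a"
    from iter_inj[OF this z] obtain i k where ik: "i < 3" "in_flat ((F ^^ i) z) k" "in_flat ((F ^^ i) a) k" by auto
    have "i = 0" using no_return[of i a k] ik ab by auto
    with ik have *: "a + of_int k * c \<le> z" "a \<le> b + of_int k * c" by auto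
    have c: "0 < c" using ab bc by simp
    have "of_int k * c < 0" using * z by simp
    then have "k \<le> -1" using c by (simp add: mult_less_0_iff)
    then have "of_int k * c \<le> -1 * c" using c by (intro mult_right_mono) auto
    then show False using * bc by simp
  qed
  then show ?thesis using iter_mono[of z a 3] z by auto
qed

lemma q_ge: "n \<le> q n"
proof (induction n rule: less_induct)
  case (less n)
  show ?case
  proof (cases "n < 2")
    case True
    then show ?thesis using q_pos[of n] by (cases n) auto
  next
    case False
    then obtain m where m: "n = m + 2" by (metis add.commute le_Suc_ex not_less)
    show ?thesis using less.IH[of "m+1"] q_rec[of m] q_pos[of m] m by simp
  qed
qed

text \<open>If the preimages on the left accumulated at a point below \<open>a\<close>, then the cross ratio bound would
  make their lengths eventually increasing, although these lengths tend to \<open>0\<close>.\<close>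

lemma preimages_tendsto_left:
  assumes lip: "L-lipschitz_on UNIV (F ^^ 3)" and d: "0 < d"
  shows "\<forall>\<^sub>F n in sequentially. even n \<longrightarrow> a - d < l n"
proof -
  define lo where "lo k = l (2 * k)" for k
  define hi where "hi k = r (2 * k)" for k
  define ek where "ek k = e (2 * k + 1)" for k
  have ord: "lo k < hi k" "hi k < ek k" "ek k < lo (Suc k)" "ek k < a" for k
    using order_left[of "2 * k"] l_less_r[of "2 * k"] by (auto simp: lo_def hi_def ek_def)
  have hi_a: "hi k < a" for k using ord[of k] by linarith
  have hi_Suc: "hi k < hi (Suc k)" for k using ord[of k] ord[of "Suc k"] by linarith
  have lo_Suc: "lo k < lo (Suc k)" for k using ord[of k] by linarith
  have inc: "incseq hi" using hi_Suc by (intro incseq_SucI less_imp_le)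
  have lo_inc: "incseq lo" using lo_Suc by (intro incseq_SucI less_imp_le)
  obtain z where z: "hi \<longlonglongrightarrow> z" "\<And>k. hi k \<le> z"
    using incseq_convergent[OF inc, of a] hi_a less_imp_le by metis
  have za: "z \<le> a" using z(1) hi_a by (intro LIMSEQ_le_const2) (auto intro: less_imp_le)
  have hi1: "(\<lambda>k. hi (Suc k)) \<longlonglongrightarrow> z" using z(1) by (rule LIMSEQ_Suc)
  have lo1: "(\<lambda>k. lo (Suc k)) \<longlonglongrightarrow> z"
    by (rule tendsto_sandwich[OF _ _ z(1) hi1]) (auto intro!: always_eventually less_imp_le ord less_trans[OF ord(2) ord(3)])
  then have lo0: "lo \<longlonglongrightarrow> z" by (rule LIMSEQ_imp_Suc)
  have ek0: "ek \<longlonglongrightarrow> z"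
    by (rule tendsto_sandwich[OF _ _ z(1) lo1]) (auto intro!: always_eventually less_imp_le ord)
  have "z = a"
  proof (rule ccontr)
    assume "z \<noteq> a"
    then have "z < a" using za by simp
    \<comment> \<open>Positive exactly because the limit \<open>z\<close> is below \<open>a\<close>.
      It bounds all denominators \<open>(F ^^ 3) a - (F ^^ 3) (hi k)\<close> from below.\<close>
    define D where "D = (F ^^ 3) a - (F ^^ 3) z"
    have D: "0 < D" using F3_less[OF \<open>z < a\<close>] by (simp add: D_def)
    have L: "0 \<le> L" using lip by (rule lipschitz_on_nonneg)
    define J where "J k = hi k - lo k" for k
    define M where "M = b - lo 1"
    have M: "0 < M" using hi_a[of 1] ord[of 1] ab by (simp add: M_def)
    have J0: "J \<longlonglongrightarrow> 0" using tendsto_diff[OF z(1) lo0] unfolding J_def by simp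
    have Jpos: "0 < J k" for k using ord(1)[of k] by (simp add: J_def)
    have step: "J k * ((b - a) / (M * (ek k - hi k))) \<le> L * J (Suc k) / D" if k: "1 \<le> k" for k
    proof -
      have lok: "lo 1 \<le> lo k" using lo_inc k by (auto simp: incseq_def)
      have q3: "3 \<le> q (2 * k + 1)" using q_ge[of "2 * k + 1"] k by linarith
      have "J k * ((b - a) / (M * (ek k - hi k))) = J k * (b - a) / (M * (ek k - hi k))" by simp
      also have "\<dots> \<le> J k * (b - ek k) / ((b - lo k) * (ek k - hi k))"
        using ord[of k] Jpos[of k] ab lok by (intro frac_le mult_mono mult_pos_pos) (auto simp: M_def)
      also have "\<dots> \<le> ((F ^^ 3) (hi (Suc k)) - (F ^^ 3) (lo (Suc k))) / ((F ^^ 3) a - (F ^^ 3) (hi (Suc k)))"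
        using preimage_ratio_le(1)[OF _ q3] by (simp add: J_def lo_def hi_def ek_def)
      also have "\<dots> \<le> (L * J (Suc k)) / D"
      proof (rule frac_le)
        from lipschitz_onD[OF lip UNIV_I UNIV_I, of "hi (Suc k)" "lo (Suc k)"]
        show "(F ^^ 3) (hi (Suc k)) - (F ^^ 3) (lo (Suc k)) \<le> L * J (Suc k)"
          using ord(1)[of "Suc k"] by (simp add: dist_real_def J_def)
        show "D \<le> (F ^^ 3) a - (F ^^ 3) (hi (Suc k))"
          using iter_mono[OF z(2)[of "Suc k"], of 3] by (simp add: D_def)
      qed (use D L Jpos[of "Suc k"] in auto)
      finally show ?thesis .
    qed
    have "(\<lambda>k. ek k - hi k) \<longlonglongrightarrow> 0" using tendsto_diff[OF ek0 z(1)] by simp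
    moreover have "0 < (b - a) * D / (M * (L + 1))" using ab D M L by simp
    ultimately have "\<forall>\<^sub>F k in sequentially. ek k - hi k < (b - a) * D / (M * (L + 1))"
      by (rule order_tendstoD)
    then obtain N where N: "\<And>k. k \<ge> N \<Longrightarrow> ek k - hi k < (b - a) * D / (M * (L + 1))"
      by (auto simp: eventually_sequentially)
    \<comment> \<open>In \<open>step\<close> the coefficient of \<open>J k\<close> contains
      \<open>1 / (ek k - hi k)\<close>, which is unbounded, while the coefficient of
      \<open>J (Suc k)\<close> is fixed. Using \<open>L + 1\<close> instead of \<open>L\<close>
      keeps the latter positive.\<close>
    have inc: "J k \<le> J (Suc k)" if k: "k \<ge> N + 1" for k
    proof -
      have h: "0 < ek k - hi k" "ek k - hi k < (b - a) * D / (M * (L + 1))" using ord[of k] N[of k] k by auto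
      have "(L + 1) / D \<le> (b - a) / (M * (ek k - hi k))"
      proof -
        have *: "(L + 1) / D \<le> (b - a) / (M * t)" if "0 < t" "t < (b - a) * D / (M * (L + 1))" for t
        proof -
          have "0 < M * (L + 1)" using M L by simp
          then have "t * (M * (L + 1)) < (b - a) * D" using that by (simp only: pos_less_divide_eq)
          then have "(L + 1) * (M * t) \<le> (b - a) * D" by (simp add: algebra_simps)
          then show ?thesis using that D M by (simp only: pos_divide_le_eq pos_le_divide_eq mult_pos_pos times_divide_eq_left)
        qed
        show ?thesis using *[OF h] .
      qed
      then have "J k * ((L + 1) / D) \<le> J k * ((b - a) / (M * (ek k - hi k)))"
        using Jpos[of k] by (intro mult_left_mono) auto
      also have "\<dots> \<le> L * J (Suc k) / D" using step[of k] k by simp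
      also have "\<dots> \<le> (L + 1) * J (Suc k) / D"
        using D Jpos[of "Suc k"] by (intro divide_right_mono mult_right_mono) auto
      finally have "J k * (L + 1) / D \<le> J (Suc k) * (L + 1) / D" by (simp add: mult_ac)
      then have "J k * (L + 1) \<le> J (Suc k) * (L + 1)" using D by (simp only: divide_le_cancel)
      then show ?thesis using L by simp
    qed
    have "J (N + 1) \<le> J (N + 1 + k)" for k
    proof (induction k)
      case (Suc k)
      then show ?case using inc[of "N + 1 + k"] by simp
    qed simp
    then have "J (N + 1) \<le> J k" if "k \<ge> N + 1" for k using that by (metis le_Suc_ex)
    then have "J (N + 1) \<le> 0" by (intro LIMSEQ_le_const[OF J0]) auto
    then show False using Jpos[of "N + 1"] by simp
  qed
  then have "\<forall>\<^sub>F k in sequentially. a - d < lo k" using lo0 d by (intro order_tendstoD(1)[OF lo0]) auto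
  then obtain K where K: "\<And>k. k \<ge> K \<Longrightarrow> a - d < lo k" by (auto simp: eventually_sequentially)
  show ?thesis
    unfolding eventually_sequentially
  proof (intro exI[of _ "2 * K"] allI impI)
    fix n assume "2 * K \<le> n" "even n"
    then show "a - d < l n" using K[of "n div 2"] by (auto simp: lo_def elim!: evenE)
  qed
qed

end

section \<open>Scaling recursion in power-law coordinates\<close>

text \<open>Proportionality of the increments of \<open>f\<close> and \<open>h\<close> near
  \<open>x\<close>, cross-multiplied. This form needs neither derivatives nor division nor signs,
  and affine changes of \<open>f\<close> or \<open>h\<close> preserve it. The set \<open>S\<close>
  makes the notion one-sided.\<close>

definition asymp_affine :: "real set \<Rightarrow> real \<Rightarrow> (real \<Rightarrow> real) \<Rightarrow> (real \<Rightarrow> real) \<Rightarrow> bool" where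
  "asymp_affine S x f h \<longleftrightarrow> (\<forall>k>1. \<exists>d>0. \<forall>y z u v. {y, z, u, v} \<subseteq> S \<inter> {x - d<..<x + d} \<longrightarrow>
     \<bar>f z - f y\<bar> * \<bar>h v - h u\<bar> \<le> k * (\<bar>h z - h y\<bar> * \<bar>f v - f u\<bar>))"

lemma asymp_affineD:
  assumes "asymp_affine S x f h" "1 < k"
  obtains d where "0 < d" "\<And>y z u v. {y, z, u, v} \<subseteq> S \<inter> {x - d<..<x + d} \<Longrightarrow>
     \<bar>f z - f y\<bar> * \<bar>h v - h u\<bar> \<le> k * (\<bar>h z - h y\<bar> * \<bar>f v - f u\<bar>)"
  using assms unfolding asymp_affine_def by metis

lemma asymp_affine_reflect:
  assumes "asymp_affine S x f h"
  shows "asymp_affine (uminus ` S) (- x) (\<lambda>y. f (- y)) (\<lambda>y. h (- y))"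
  unfolding asymp_affine_def
proof (intro allI impI)
  fix k :: real assume "1 < k"
  then obtain d where d: "0 < d" "\<And>y z u v. {y, z, u, v} \<subseteq> S \<inter> {x - d<..<x + d} \<Longrightarrow>
     \<bar>f z - f y\<bar> * \<bar>h v - h u\<bar> \<le> k * (\<bar>h z - h y\<bar> * \<bar>f v - f u\<bar>)"
    using asymp_affineD[OF assms] by blast
  show "\<exists>d>0. \<forall>y z u v. {y, z, u, v} \<subseteq> uminus ` S \<inter> {- x - d<..<- x + d} \<longrightarrow>
     \<bar>f (- z) - f (- y)\<bar> * \<bar>h (- v) - h (- u)\<bar> \<le> k * (\<bar>h (- z) - h (- y)\<bar> * \<bar>f (- v) - f (- u)\<bar>)"
    by (intro exI[of _ d] conjI d(1) allI impI d(2)) auto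
qed

lemma asymp_affine_minus_right: "asymp_affine S x f (\<lambda>y. - h y) \<longleftrightarrow> asymp_affine S x f h"
  and asymp_affine_minus_left: "asymp_affine S x (\<lambda>y. - f y) h \<longleftrightarrow> asymp_affine S x f h"
proof -
  have *: "\<bar>- s - - t\<bar> = \<bar>s - t\<bar>" for s t :: real by simp
  show "asymp_affine S x f (\<lambda>y. - h y) \<longleftrightarrow> asymp_affine S x f h"
    "asymp_affine S x (\<lambda>y. - f y) h \<longleftrightarrow> asymp_affine S x f h"
    unfolding asymp_affine_def * by simp_all
qed

text \<open>\<open>A\<close> and \<open>B\<close> are smooth coordinates on the two sides of the flat piece in which \<open>F\<close> is an exact power.
  The third iterate is compared with this power on each side separately, because the two one-sided
  derivatives of \<open>F\<close> at \<open>F a\<close> and at \<open>F (F a)\<close> may differ.\<close>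

locale fib_flat_lift_coords = fib_flat_lift +
  fixes A B :: "real \<Rightarrow> real" and lA lB :: real
  assumes lA: "0 < lA" and lB: "0 < lB"
    and A_a: "A a = 0" and B_b: "B b = 0"
    and A_dec: "\<exists>d>0. \<forall>y z. a - d < y \<longrightarrow> y < z \<longrightarrow> z \<le> a \<longrightarrow> A z < A y"
    and B_inc: "\<exists>d>0. \<forall>y z. b \<le> y \<longrightarrow> y < z \<longrightarrow> z < b + d \<longrightarrow> B y < B z"
    and A_aff: "asymp_affine {..a} a A (\<lambda>y. y)" and B_aff: "asymp_affine {b..} b B (\<lambda>y. y)"
    and F3_A: "asymp_affine {..a} a (F ^^ 3) (\<lambda>y. A y powr lA)"
    and F3_B: "asymp_affine {b..} b (F ^^ 3) (\<lambda>y. B y powr lB)"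
    and lip: "\<exists>L. L-lipschitz_on UNIV F"
begin

text \<open>Measured in the coordinates \<open>A\<close> and \<open>B\<close> instead of lengths, so
  that \<open>1 + w n\<close> to the power \<open>lA\<close> or \<open>lB\<close> is exactly a
  quotient of the powers modelling \<open>F ^^ 3\<close>. For odd \<open>n\<close> the endpoints
  change roles, since then \<open>l n\<close> is the one nearer to the flat piece.\<close>

definition w :: "nat \<Rightarrow> real" where
  "w n = (if even n then A (l n) / A (r n) - 1 else B (r n) / B (l n) - 1)"

definition x :: "nat \<Rightarrow> real" where
  "x n = (if even n then 1 - A (e (n + 1)) / A (r n) else 1 - B (e (n + 1)) / B (l n))"

lemma reflect_coords:
  "fib_flat_lift_coords (\<lambda>y. - F (- y)) c (- b) (- a) (- g) (\<lambda>n. q (n + 1)) (\<lambda>n. - p (n + 1))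
     (\<lambda>n. - r (n + 1)) (\<lambda>n. - l (n + 1)) (\<lambda>y. B (- y)) (\<lambda>y. A (- y)) lB lA"
proof -
  interpret R: fib_flat_lift "\<lambda>y. - F (- y)" c "- b" "- a" "- g" "\<lambda>n. q (n + 1)" "\<lambda>n. - p (n + 1)"
     "\<lambda>n. - r (n + 1)" "\<lambda>n. - l (n + 1)" by (rule reflect)
  have im: "uminus ` {..a} = {- a..}" "uminus ` {b..} = {..- b}" by simp_all
  have f3: "(\<lambda>y. - F (- y)) ^^ 3 = (\<lambda>y. - (F ^^ 3) (- y))" by (rule ext) (rule iter_reflect)
  show ?thesis
  proof
    show "\<exists>d>0. \<forall>y z. - b - d < y \<longrightarrow> y < z \<longrightarrow> z \<le> - b \<longrightarrow> B (- z) < B (- y)"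
    proof -
      obtain d where d: "d > 0" "\<And>y z. b \<le> y \<Longrightarrow> y < z \<Longrightarrow> z < b + d \<Longrightarrow> B y < B z" using B_inc by metis
      show ?thesis by (intro exI[of _ d] conjI d(1) allI impI d(2)) auto
    qed
    show "\<exists>d>0. \<forall>y z. - a \<le> y \<longrightarrow> y < z \<longrightarrow> z < - a + d \<longrightarrow> A (- y) < A (- z)"
    proof -
      obtain d where d: "d > 0" "\<And>y z. a - d < y \<Longrightarrow> y < z \<Longrightarrow> z \<le> a \<Longrightarrow> A z < A y" using A_dec by metis
      show ?thesis by (intro exI[of _ d] conjI d(1) allI impI d(2)) auto
    qed
    show "asymp_affine {..- b} (- b) (\<lambda>y. B (- y)) (\<lambda>y. y)"
      using asymp_affine_reflect[OF B_aff] by (simp add: im asymp_affine_minus_right)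
    show "asymp_affine {- a..} (- a) (\<lambda>y. A (- y)) (\<lambda>y. y)"
      using asymp_affine_reflect[OF A_aff] by (simp add: im asymp_affine_minus_right)
    show "asymp_affine {..- b} (- b) ((\<lambda>y. - F (- y)) ^^ 3) (\<lambda>y. B (- y) powr lB)"
      using asymp_affine_reflect[OF F3_B] unfolding f3 by (simp add: im asymp_affine_minus_left)
    show "asymp_affine {- a..} (- a) ((\<lambda>y. - F (- y)) ^^ 3) (\<lambda>y. A (- y) powr lA)"
      using asymp_affine_reflect[OF F3_A] unfolding f3 by (simp add: im asymp_affine_minus_left)
    show "\<exists>L. L-lipschitz_on UNIV (\<lambda>y. - F (- y))"
    proof -
      obtain L where L: "L-lipschitz_on UNIV F" using lip by auto
      have "L-lipschitz_on UNIV (\<lambda>y. - F (- y))"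
        using lipschitz_onD[OF L UNIV_I UNIV_I, of "- y" "- z" for y z] lipschitz_on_nonneg[OF L]
        by (intro lipschitz_onI) (auto simp: dist_real_def abs_minus_commute)
      then show ?thesis ..
    qed
  qed (use lA lB A_a B_b in auto)
qed

lemma w_x_reflect:
  "fib_flat_lift_coords.w (\<lambda>n. - r (n + 1)) (\<lambda>n. - l (n + 1)) (\<lambda>y. B (- y)) (\<lambda>y. A (- y)) n = w (n + 1)"
  "fib_flat_lift_coords.x (\<lambda>y. - F (- y)) c (- b) (\<lambda>n. q (n + 1)) (\<lambda>n. - p (n + 1))
     (\<lambda>n. - r (n + 1)) (\<lambda>n. - l (n + 1)) (\<lambda>y. B (- y)) (\<lambda>y. A (- y)) n = x (n + 1)"
  unfolding fib_flat_lift_coords.w_def[OF reflect_coords] fib_flat_lift_coords.x_def[OF reflect_coords]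
    w_def x_def e_reflect by simp_all

lemma near_left: "0 < d \<Longrightarrow> \<forall>\<^sub>F n in sequentially. even n \<longrightarrow> a - d < l n"
proof -
  assume d: "0 < d"
  obtain L where L: "L-lipschitz_on UNIV F" using lip by auto
  have "(L * (L * L))-lipschitz_on UNIV (\<lambda>x. F (F (F x)))"
    using lipschitz_on_subset[OF L] by (intro lipschitz_on_compose2[where g=F] L) auto
  then show ?thesis using preimages_tendsto_left[OF _ d] by (simp add: numeral_3_eq_3 comp_def)
qed

lemma near_right:
  assumes d: "0 < d"
  shows "\<forall>\<^sub>F n in sequentially. even n \<longrightarrow> r (n + 1) < b + d"
    and "\<forall>\<^sub>F n in sequentially. even n \<longrightarrow> e n < b + d"
proof -
  show *: "\<forall>\<^sub>F n in sequentially. even n \<longrightarrow> r (n + 1) < b + d"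
    using fib_flat_lift_coords.near_left[OF reflect_coords d] by eventually_elim auto
  then have "\<forall>\<^sub>F n in sequentially. even (n + 2) \<longrightarrow> e (n + 2) < b + d"
  proof eventually_elim
    case (elim n)
    then show ?case using order_right[of n] l_less_r[of "n+1"] by force
  qed
  then show "\<forall>\<^sub>F n in sequentially. even n \<longrightarrow> e n < b + d"
    using eventually_sequentially_seg[of "\<lambda>n. even n \<longrightarrow> e n < b + d" 2] by simp
qed

lemma eventually_left:
  assumes "0 < d"
  shows "\<forall>\<^sub>F n in sequentially. even n \<longrightarrow> a - d < l n \<and> a - d < r n \<and> a - d < e (n + 1) \<and>
    a - d < l (n + 2) \<and> a - d < r (n + 2) \<and> l n < r n \<and> r n < e (n + 1) \<and> e (n + 1) < l (n + 2) \<and>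
    l (n + 2) < r (n + 2) \<and> r (n + 2) < a \<and> e (n + 1) < a \<and> r n < a"
  using near_left[OF assms]
proof eventually_elim
  case (elim n)
  then show ?case
    using order_left[of n] order_left[of "n + 2"] l_less_r[of n] l_less_r[of "n + 2"] by auto
qed

lemma eventually_right:
  assumes "0 < d"
  shows "\<forall>\<^sub>F n in sequentially. even n \<longrightarrow> b < e (n + 2) \<and> e (n + 2) < l (n + 1) \<and> l (n + 1) < r (n + 1) \<and>
    r (n + 1) < e n \<and> e n < b + d"
  using near_right(2)[OF assms]
proof eventually_elim
  case (elim n)
  then show ?case
    using order_right[of n] order_right[of "n + 2"] l_less_r[of "n + 1"] by auto
qed

lemma A_order: "\<forall>\<^sub>F n in sequentially. even n \<longrightarrow> 0 < A (e (n + 1)) \<and> A (e (n + 1)) < A (r n) \<and> A (r n) < A (l n)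
    \<and> 0 < A (r (n + 2)) \<and> A (r (n + 2)) < A (l (n + 2))"
proof -
  obtain d where d: "d > 0" "\<And>y z. a - d < y \<Longrightarrow> y < z \<Longrightarrow> z \<le> a \<Longrightarrow> A z < A y" using A_dec by metis
  show ?thesis
    using eventually_left[OF d(1)]
  proof eventually_elim
    case (elim n)
    show ?case
    proof
      assume "even n"
      with elim show "0 < A (e (n + 1)) \<and> A (e (n + 1)) < A (r n) \<and> A (r n) < A (l n)
          \<and> 0 < A (r (n + 2)) \<and> A (r (n + 2)) < A (l (n + 2))"
        unfolding A_a[symmetric] by (intro conjI d(2)) auto
    qed
  qed
qed

lemma B_order: "\<forall>\<^sub>F n in sequentially. even n \<longrightarrow> 0 < B (e (n + 2)) \<and> B (e (n + 2)) < B (l (n + 1)) \<and> B (l (n + 1)) < B (r (n + 1))"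
  using fib_flat_lift_coords.A_order[OF reflect_coords] unfolding e_reflect by eventually_elim simp

lemma w_x_pos_even: "\<forall>\<^sub>F n in sequentially. even n \<longrightarrow> 0 < w n \<and> 0 < x n \<and> x n < 1"
  using A_order by eventually_elim (auto simp: w_def x_def)

lemma w_rec_even:
  assumes k: "1 < k"
  shows "\<forall>\<^sub>F n in sequentially. even n \<longrightarrow> w n \<le> k * x n * ((1 + w (n + 2)) powr lA - 1)"
proof -
  \<comment> \<open>The tolerance is shared by three approximations: linearity of \<open>A\<close>,
    the power law for \<open>F ^^ 3\<close>, and the quotient
    \<open>(b - l n) / (b - e (n + 1))\<close>, which \<open>d \<le> (h - 1) * (b - a)\<close> keeps
    at most \<open>h\<close>.\<close>
  define h where "h = root 3 k"
  have h: "1 < h" "h ^ 3 = k" using k by (auto simp: h_def real_root_pow_pos2)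
  obtain d1 where d1: "0 < d1" "\<And>y z u v. {y, z, u, v} \<subseteq> {..a} \<inter> {a - d1<..<a + d1} \<Longrightarrow>
     \<bar>A z - A y\<bar> * \<bar>v - u\<bar> \<le> h * (\<bar>z - y\<bar> * \<bar>A v - A u\<bar>)"
    using asymp_affineD[OF A_aff h(1)] by blast
  obtain d2 where d2: "0 < d2" "\<And>y z u v. {y, z, u, v} \<subseteq> {..a} \<inter> {a - d2<..<a + d2} \<Longrightarrow>
     \<bar>(F ^^ 3) z - (F ^^ 3) y\<bar> * \<bar>A v powr lA - A u powr lA\<bar> \<le> h * (\<bar>A z powr lA - A y powr lA\<bar> * \<bar>(F ^^ 3) v - (F ^^ 3) u\<bar>)"
    using asymp_affineD[OF F3_A h(1)] by blast
  define d where "d = Min {d1, d2, (h - 1) * (b - a)}"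
  have d: "0 < d" "d \<le> d1" "d \<le> d2" "d \<le> (h - 1) * (b - a)" using d1 d2 h ab by (auto simp: d_def)
  have q3: "\<forall>\<^sub>F n in sequentially. 3 \<le> q (n + 1)"
    using eventually_ge_at_top[of 3] by eventually_elim (use q_ge order_trans in \<open>metis le_add1 order_trans\<close>)
  show ?thesis
    using eventually_left[OF d(1)] A_order q3
  proof eventually_elim
    case (elim n)
    show ?case
    proof
      assume n: "even n"
      note el = elim(1)[rule_format, OF n] and eA = elim(2)[rule_format, OF n]
      define P where "P = (r n - l n) * (b - e (n + 1)) / ((b - l n) * (e (n + 1) - r n))"
      define Q where "Q = ((F ^^ 3) (r (n + 2)) - (F ^^ 3) (l (n + 2))) / ((F ^^ 3) a - (F ^^ 3) (r (n + 2)))"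
      have PQ: "P \<le> Q" and F3: "(F ^^ 3) (r (n + 2)) < (F ^^ 3) a"
        using preimage_ratio_le[OF n elim(3)] by (simp_all add: P_def Q_def)
      have F3': "(F ^^ 3) (l (n + 2)) \<le> (F ^^ 3) (r (n + 2))" using el by (intro iter_mono) auto
      have pw: "A (r (n + 2)) powr lA < A (l (n + 2)) powr lA" using eA lA by (intro powr_less_mono2) auto
      have "((F ^^ 3) (r (n + 2)) - (F ^^ 3) (l (n + 2))) * A (r (n + 2)) powr lA
          \<le> h * ((A (l (n + 2)) powr lA - A (r (n + 2)) powr lA) * ((F ^^ 3) a - (F ^^ 3) (r (n + 2))))"
        using d2(2)[of "l (n + 2)" "r (n + 2)" "r (n + 2)" a] el d F3 F3' pw by (simp add: A_a)
      then have "Q \<le> h * ((A (l (n + 2)) powr lA - A (r (n + 2)) powr lA) / A (r (n + 2)) powr lA)"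
        using F3 eA by (simp add: Q_def field_simps)
      also have "(A (l (n + 2)) powr lA - A (r (n + 2)) powr lA) / A (r (n + 2)) powr lA = (1 + w (n + 2)) powr lA - 1"
        using eA n by (simp add: w_def powr_divide diff_divide_distrib)
      finally have Q: "Q \<le> h * ((1 + w (n + 2)) powr lA - 1)" .
      have "(A (l n) - A (r n)) * (e (n + 1) - r n) \<le> h * ((r n - l n) * (A (r n) - A (e (n + 1))))"
        using d1(2)[of "l n" "r n" "r n" "e (n + 1)"] el d eA by (simp add: abs_minus_commute abs_if)
      then have "(A (l n) - A (r n)) / (A (r n) - A (e (n + 1))) \<le> h * ((r n - l n) / (e (n + 1) - r n))"
        using el eA by (simp add: pos_divide_le_eq pos_le_divide_eq mult_ac)
      also have "(A (l n) - A (r n)) / (A (r n) - A (e (n + 1))) = w n / x n"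
        using eA n by (simp add: w_def x_def field_simps)
      also have "(r n - l n) / (e (n + 1) - r n) = P * ((b - l n) / (b - e (n + 1)))"
        using el ab by (simp add: P_def)
      also have "h * (P * ((b - l n) / (b - e (n + 1)))) \<le> h * (P * h)"
      proof (intro mult_left_mono)
        have "b - l n \<le> h * (b - a)" using el d by (simp add: algebra_simps)
        also have "\<dots> \<le> h * (b - e (n + 1))" using el h by (intro mult_left_mono) auto
        finally show "(b - l n) / (b - e (n + 1)) \<le> h" using el ab by (simp add: pos_divide_le_eq)
      qed (use h el ab in \<open>auto simp: P_def\<close>)
      also have "\<dots> \<le> h * ((h * ((1 + w (n + 2)) powr lA - 1)) * h)"
        using PQ Q h by (intro mult_left_mono mult_right_mono) auto
      also have "\<dots> = k * ((1 + w (n + 2)) powr lA - 1)"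
        unfolding h(2)[symmetric] by (simp add: power3_eq_cube)
      finally have "w n / x n \<le> k * ((1 + w (n + 2)) powr lA - 1)" .
      moreover have "0 < x n" using eA n by (simp add: x_def)
      ultimately show "w n \<le> k * x n * ((1 + w (n + 2)) powr lA - 1)"
        by (simp add: pos_divide_le_eq mult_ac)
    qed
  qed
qed

lemma x_rec_even:
  assumes k: "1 < k"
  shows "\<forall>\<^sub>F n in sequentially. even n \<longrightarrow> (1 + w (n + 1)) * (1 - (1 - x n) powr lA) \<le> k * (1 - x (n + 1))"
proof -
  \<comment> \<open>Again three factors: the power law for \<open>F ^^ 3\<close>, the quotient
    \<open>(e n - a) / (b - a)\<close>, and the linearity of \<open>B\<close>.\<close>
  define h where "h = root 3 k"
  have h: "1 < h" "h ^ 3 = k" using k by (auto simp: h_def real_root_pow_pos2)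
  obtain d1 where d1: "0 < d1" "\<And>y z u v. {y, z, u, v} \<subseteq> {b..} \<inter> {b - d1<..<b + d1} \<Longrightarrow>
     \<bar>B z - B y\<bar> * \<bar>v - u\<bar> \<le> h * (\<bar>z - y\<bar> * \<bar>B v - B u\<bar>)"
    using asymp_affineD[OF B_aff h(1)] by blast
  obtain d2 where d2: "0 < d2" "\<And>y z u v. {y, z, u, v} \<subseteq> {..a} \<inter> {a - d2<..<a + d2} \<Longrightarrow>
     \<bar>(F ^^ 3) z - (F ^^ 3) y\<bar> * \<bar>A v powr lA - A u powr lA\<bar> \<le> h * (\<bar>A z powr lA - A y powr lA\<bar> * \<bar>(F ^^ 3) v - (F ^^ 3) u\<bar>)"
    using asymp_affineD[OF F3_A h(1)] by blast
  define d where "d = Min {d1, d2, (h - 1) * (b - a)}"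
  have d: "0 < d" "d \<le> d1" "d \<le> d2" "d \<le> (h - 1) * (b - a)" using d1 d2 h ab by (auto simp: d_def)
  have q3: "\<forall>\<^sub>F n in sequentially. 3 \<le> q n"
    using eventually_ge_at_top[of 3] by eventually_elim (use q_ge order_trans in blast)
  show ?thesis
    using eventually_left[OF d(1)] eventually_right[OF d(1)] A_order B_order q3
  proof eventually_elim
    case (elim n)
    show ?case
    proof
      assume n: "even n"
      note el = elim(1)[rule_format, OF n] and er = elim(2)[rule_format, OF n]
        and eA = elim(3)[rule_format, OF n] and eB = elim(4)[rule_format, OF n]
      note img = image_ratio_le[OF n elim(5)]
      define S where "S = 1 - (1 - x n) powr lA"
      have S: "S = (A (r n) powr lA - A (e (n + 1)) powr lA) / A (r n) powr lA"
        using eA n by (simp add: S_def x_def powr_divide diff_divide_distrib)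
      have pw: "A (e (n + 1)) powr lA < A (r n) powr lA" using eA lA by (intro powr_less_mono2) auto
      have S0: "0 < S" using pw eA unfolding S by simp
      define Q where "Q = ((F ^^ 3) a - (F ^^ 3) (r n)) / ((F ^^ 3) (e (n + 1)) - (F ^^ 3) (r n))"
      have "((F ^^ 3) a - (F ^^ 3) (r n)) * (A (r n) powr lA - A (e (n + 1)) powr lA)
          \<le> h * (A (r n) powr lA * ((F ^^ 3) (e (n + 1)) - (F ^^ 3) (r n)))"
        using d2(2)[of "r n" a "r n" "e (n + 1)"] el d img pw by (simp add: A_a abs_minus_commute)
      then have Q: "Q * S \<le> h"
        using img eA by (simp add: Q_def S field_simps)
      have "(e (n + 2) - a) * (e n - b) / ((e n - a) * (e (n + 2) - b)) * S \<le> Q * S"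
        using img(1) S0 by (intro mult_right_mono) (auto simp: Q_def)
      with Q have "(e (n + 2) - a) * (e n - b) / ((e n - a) * (e (n + 2) - b)) * S \<le> h" by linarith
      then have "(e (n + 2) - a) * (e n - b) * S \<le> h * ((e n - a) * (e (n + 2) - b))"
        using er ab by (simp add: pos_divide_le_eq)
      also have "\<dots> \<le> h * ((h * (b - a)) * (e (n + 2) - b))"
        using er d h by (intro mult_left_mono mult_right_mono) (auto simp: algebra_simps)
      also have "\<dots> \<le> h * ((h * (e (n + 2) - a)) * (e (n + 2) - b))"
        using er d h by (intro mult_left_mono mult_right_mono) auto
      finally have "(e (n + 2) - a) * ((e n - b) * S) \<le> (e (n + 2) - a) * (h * h * (e (n + 2) - b))"
        by (simp only: mult_ac)
      then have "(e n - b) * S \<le> h * h * (e (n + 2) - b)"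
        using er ab by (simp only: mult_le_cancel_left_pos diff_gt_0_iff_gt less_trans[of a b])
      \<comment> \<open>As \<open>e n\<close> lies beyond \<open>r (n + 1)\<close>, the estimate
        passes to the far endpoint of the preimage. Division by \<open>B (l (n + 1))\<close> then
        produces \<open>1 + w (n + 1)\<close>.\<close>
      moreover have "(r (n + 1) - b) * S \<le> (e n - b) * S" using er S0 by (intro mult_right_mono) auto
      ultimately have 1: "(r (n + 1) - b) * S \<le> h * h * (e (n + 2) - b)" by linarith
      have 2: "B (r (n + 1)) * (e (n + 2) - b) \<le> h * ((r (n + 1) - b) * B (e (n + 2)))"
        using d1(2)[of b "r (n + 1)" b "e (n + 2)"] er d eB by (simp add: B_b)
      have "(r (n + 1) - b) * (B (r (n + 1)) * S) \<le> B (r (n + 1)) * (h * h * (e (n + 2) - b))"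
        using mult_left_mono[OF 1, of "B (r (n + 1))"] eB by (simp add: mult_ac)
      also have "\<dots> \<le> (h * h) * (h * ((r (n + 1) - b) * B (e (n + 2))))"
        using mult_left_mono[OF 2, of "h * h"] h by (simp add: mult_ac)
      also have "\<dots> = (r (n + 1) - b) * (k * B (e (n + 2)))"
        unfolding h(2)[symmetric] by (simp add: power3_eq_cube)
      finally have "B (r (n + 1)) * S \<le> k * B (e (n + 2))" using er by simp
      then have "B (r (n + 1)) * S / B (l (n + 1)) \<le> k * B (e (n + 2)) / B (l (n + 1))"
        using eB by (intro divide_right_mono) auto
      then show "(1 + w (n + 1)) * (1 - (1 - x n) powr lA) \<le> k * (1 - x (n + 1))"
        unfolding S_def[symmetric] using n by (simp add: w_def x_def)
    qed
  qed
qed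

text \<open>Transfers lower bounds for \<open>w\<close> to the quotient of true lengths; near
  \<open>a\<close> the coordinate \<open>A\<close> distorts such quotients by a factor of at most
  2.\<close>

lemma w_le_even: "\<forall>\<^sub>F n in sequentially. even n \<longrightarrow> w n \<le> 2 * ((r n - l n) / (a - r n))"
proof -
  obtain d1 where d1: "0 < d1" "\<And>y z u v. {y, z, u, v} \<subseteq> {..a} \<inter> {a - d1<..<a + d1} \<Longrightarrow>
     \<bar>A z - A y\<bar> * \<bar>v - u\<bar> \<le> 2 * (\<bar>z - y\<bar> * \<bar>A v - A u\<bar>)"
    using asymp_affineD[OF A_aff, of 2] by (metis one_less_numeral_iff semiring_norm(76))
  show ?thesis
    using eventually_left[OF d1(1)] A_order
  proof eventually_elim
    case (elim n)
    show ?case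
    proof
      assume n: "even n"
      note el = elim(1)[rule_format, OF n] and eA = elim(2)[rule_format, OF n]
      have "(A (l n) - A (r n)) * (a - r n) \<le> 2 * ((r n - l n) * A (r n))"
        using d1(2)[of "l n" "r n" "r n" a] el eA by (simp add: A_a)
      then have "(A (l n) - A (r n)) / A (r n) \<le> 2 * ((r n - l n) / (a - r n))"
        using el eA by (simp add: pos_divide_le_eq pos_le_divide_eq mult_ac)
      moreover have "w n = (A (l n) - A (r n)) / A (r n)" using eA n by (simp add: w_def diff_divide_distrib)
      ultimately show "w n \<le> 2 * ((r n - l n) / (a - r n))" by simp
    qed
  qed
qed

lemma eventually_parity:
  assumes "\<forall>\<^sub>F n in sequentially. even n \<longrightarrow> P n" "\<forall>\<^sub>F n in sequentially. even n \<longrightarrow> P (n + 1)"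
  shows "\<forall>\<^sub>F n in sequentially. P n"
proof -
  obtain N where N: "\<And>n. n \<ge> N \<Longrightarrow> even n \<Longrightarrow> P n" "\<And>n. n \<ge> N \<Longrightarrow> even n \<Longrightarrow> P (n + 1)"
    using eventually_conj[OF assms] unfolding eventually_sequentially by blast
  show ?thesis
    unfolding eventually_sequentially
  proof (intro exI[of _ "N + 1"] allI impI)
    fix n assume "N + 1 \<le> n"
    then show "P n" using N(1)[of n] N(2)[of "n - 1"] by (cases "even n") auto
  qed
qed

theorem preimage_scaling_doubly_exponential:
  assumes lA': "1 < lA" "lA < 2" and lB': "1 < lB" "lB < 2"
  shows "\<exists>C>0. \<exists>m>1. \<forall>\<^sub>F n in sequentially.
    exp (C * m ^ n) \<le> 2 * ((r n - l n) / (if even n then a - r n else l n - b))"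
proof -
  define ell where "ell n = (if even n then lA else lB)" for n :: nat
  have "\<exists>C>0. \<exists>m>1. \<forall>\<^sub>F n in sequentially. exp (C * m ^ n) \<le> w n"
  proof (rule scaling_sequence_doubly_exponential[of "min lA lB - 1" ell "max lA lB" w x])
    show "\<forall>\<^sub>F n in sequentially. 0 < w n \<and> 0 < x n \<and> x n < 1"
      by (rule eventually_parity[OF w_x_pos_even fib_flat_lift_coords.w_x_pos_even[OF reflect_coords, unfolded w_x_reflect]])
    show "\<forall>\<^sub>F n in sequentially. w n \<le> k * x n * ((1 + w (n + 2)) powr ell n - 1)" if k: "1 < k" for k
    proof (rule eventually_parity)
      show "\<forall>\<^sub>F n in sequentially. even n \<longrightarrow> w n \<le> k * x n * ((1 + w (n + 2)) powr ell n - 1)"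
        using w_rec_even[OF k] by eventually_elim (auto simp: ell_def)
      show "\<forall>\<^sub>F n in sequentially. even n \<longrightarrow>
          w (n + 1) \<le> k * x (n + 1) * ((1 + w (n + 1 + 2)) powr ell (n + 1) - 1)"
        using fib_flat_lift_coords.w_rec_even[OF reflect_coords k, unfolded w_x_reflect] by eventually_elim (auto simp: ell_def)
    qed
    show "\<forall>\<^sub>F n in sequentially. (1 + w (n + 1)) * (1 - (1 - x n) powr ell n) \<le> k * (1 - x (n + 1))"
      if k: "1 < k" for k
    proof (rule eventually_parity)
      show "\<forall>\<^sub>F n in sequentially. even n \<longrightarrow>
          (1 + w (n + 1)) * (1 - (1 - x n) powr ell n) \<le> k * (1 - x (n + 1))"
        using x_rec_even[OF k] by eventually_elim (auto simp: ell_def)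
      show "\<forall>\<^sub>F n in sequentially. even n \<longrightarrow>
          (1 + w (n + 1 + 1)) * (1 - (1 - x (n + 1)) powr ell (n + 1)) \<le> k * (1 - x (n + 1 + 1))"
        using fib_flat_lift_coords.x_rec_even[OF reflect_coords k, unfolded w_x_reflect] by eventually_elim (auto simp: ell_def)
    qed
  qed (use lA' lB' in \<open>auto simp: ell_def\<close>)
  then obtain C m where Cm: "C > 0" "m > 1" "\<forall>\<^sub>F n in sequentially. exp (C * m ^ n) \<le> w n" by auto
  have "\<forall>\<^sub>F n in sequentially. w n \<le> 2 * ((r n - l n) / (if even n then a - r n else l n - b))"
  proof (rule eventually_parity)
    show "\<forall>\<^sub>F n in sequentially. even n \<longrightarrow> w n \<le> 2 * ((r n - l n) / (if even n then a - r n else l n - b))"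
      using w_le_even by eventually_elim auto
    show "\<forall>\<^sub>F n in sequentially. even n \<longrightarrow> w (n + 1) \<le>
        2 * ((r (n + 1) - l (n + 1)) / (if even (n + 1) then a - r (n + 1) else l (n + 1) - b))"
      using fib_flat_lift_coords.w_le_even[OF reflect_coords, unfolded w_x_reflect] by eventually_elim (auto simp: algebra_simps)
  qed
  with Cm(3) have "\<forall>\<^sub>F n in sequentially.
    exp (C * m ^ n) \<le> 2 * ((r n - l n) / (if even n then a - r n else l n - b))"
    by eventually_elim linarith
  then show ?thesis using Cm by blast
qed

end

section \<open>One-sided smoothness\<close>

definition C1_on :: "real set \<Rightarrow> (real \<Rightarrow> real) \<Rightarrow> (real \<Rightarrow> real) \<Rightarrow> bool" where
  "C1_on T f f1 \<longleftrightarrow> continuous_on T f1 \<and> (\<forall>x\<in>T. (f has_real_derivative f1 x) (at x within T))"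

definition C1_regular :: "real set \<Rightarrow> (real \<Rightarrow> real) \<Rightarrow> bool" where
  "C1_regular T f \<longleftrightarrow> (\<exists>f1. C1_on T f f1 \<and> (\<forall>x\<in>T. f1 x \<noteq> 0))"

lemma C1_on_subset: "C1_on T f f1 \<Longrightarrow> S \<subseteq> T \<Longrightarrow> C1_on S f f1"
  unfolding C1_on_def by (auto intro: continuous_on_subset DERIV_subset)

lemma C1_regular_subset: "C1_regular T f \<Longrightarrow> S \<subseteq> T \<Longrightarrow> C1_regular S f"
  unfolding C1_regular_def using C1_on_subset by blast

lemma C1_on_imp_continuous_on: "C1_on T f f1 \<Longrightarrow> continuous_on T f"
  unfolding C1_on_def by (meson DERIV_continuous_on)

lemma C1_regular_imp_continuous_on: "C1_regular T f \<Longrightarrow> continuous_on T f"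
  unfolding C1_regular_def using C1_on_imp_continuous_on by blast

lemma C1_regular_compose:
  assumes "C1_regular T f" "C1_regular S g" "g ` S \<subseteq> T"
  shows "C1_regular S (\<lambda>x. f (g x))"
proof -
  obtain f1 where f1: "continuous_on T f1" "\<And>x. x \<in> T \<Longrightarrow> (f has_real_derivative f1 x) (at x within T)"
      "\<And>x. x \<in> T \<Longrightarrow> f1 x \<noteq> 0"
    using assms(1) unfolding C1_regular_def C1_on_def by metis
  obtain g1 where g1: "continuous_on S g1" "\<And>x. x \<in> S \<Longrightarrow> (g has_real_derivative g1 x) (at x within S)"
      "\<And>x. x \<in> S \<Longrightarrow> g1 x \<noteq> 0"
    using assms(2) unfolding C1_regular_def C1_on_def by metis
  have "continuous_on S g" using C1_regular_imp_continuous_on assms(2) .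
  then have "continuous_on S (\<lambda>x. f1 (g x) * g1 x)"
    using assms(3) by (intro continuous_intros continuous_on_compose2[OF f1(1)] g1(1)) auto
  moreover have "((\<lambda>x. f (g x)) has_real_derivative f1 (g x) * g1 x) (at x within S)" if "x \<in> S" for x
    using DERIV_image_chain[of f "f1 (g x)" g x S "g1 x"] DERIV_subset[OF f1(2) assms(3)] g1(2) that assms(3)
    by (auto simp: comp_def)
  moreover have "f1 (g x) * g1 x \<noteq> 0" if "x \<in> S" for x using f1(3) g1(3) that assms(3) by auto
  ultimately show ?thesis unfolding C1_regular_def C1_on_def by (intro exI[of _ "\<lambda>x. f1 (g x) * g1 x"]) auto
qed

lemma C1_regular_affine: "m \<noteq> 0 \<Longrightarrow> C1_regular T (\<lambda>x. m * x + t)"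
  unfolding C1_regular_def C1_on_def
  by (intro exI[of _ "\<lambda>_. m"]) (auto intro!: derivative_eq_intros)

lemma C1_regular_powr:
  assumes "\<And>x. x \<in> T \<Longrightarrow> 0 < x" "l \<noteq> 0"
  shows "C1_regular T (\<lambda>x. x powr l)"
  unfolding C1_regular_def C1_on_def
proof (intro exI[of _ "\<lambda>x. l * x powr (l - 1)"] conjI ballI)
  show "continuous_on T (\<lambda>x. l * x powr (l - 1))"
    using assms by (intro continuous_intros) (auto dest: less_imp_neq)
  show "((\<lambda>x. x powr l) has_real_derivative l * x powr (l - 1)) (at x within T)" if "x \<in> T" for x
    using has_real_derivative_powr[OF assms(1)[OF that]] by (rule has_field_derivative_at_within)
qed (use assms in \<open>auto dest: less_imp_neq\<close>)

lemma C1_on_mvt: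
  assumes "C1_on {lo..hi} f f1" "y \<in> {lo..hi}" "z \<in> {lo..hi}"
  shows "\<exists>t. min y z \<le> t \<and> t \<le> max y z \<and> f z - f y = f1 t * (z - y)"
proof -
  have *: "\<exists>t\<in>{y..z}. f z - f y = f1 t * (z - y)" if "y \<le> z" "y \<in> {lo..hi}" "z \<in> {lo..hi}" for y z
  proof (rule mvt_very_simple[OF that(1)])
    fix x assume x: "y \<le> x" "x \<le> z"
    have "(f has_real_derivative f1 x) (at x within {lo..hi})"
      using assms(1) x that by (auto simp: C1_on_def)
    then have "(f has_real_derivative f1 x) (at x within {y..z})"
      by (rule DERIV_subset) (use that in auto)
    then show "(f has_derivative (\<lambda>t. f1 x * t)) (at x within {y..z})"
      by (simp add: has_field_derivative_def mult_commute_abs)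
  qed
  show ?thesis
  proof (cases "y \<le> z")
    case True
    then show ?thesis using *[OF True assms(2,3)] by auto
  next
    case False
    then obtain t where "t \<in> {z..y}" "f y - f z = f1 t * (y - z)" using *[of z y] assms by auto
    then show ?thesis using False by (intro exI[of _ t]) (auto simp: algebra_simps)
  qed
qed

lemma C1_on_lipschitz:
  assumes "C1_on {lo..hi} f f1"
  shows "\<exists>L. L-lipschitz_on {lo..hi} f"
proof -
  have "compact (f1 ` {lo..hi})"
    using assms by (intro compact_continuous_image) (auto simp: C1_on_def)
  then obtain L where L: "\<And>x. x \<in> {lo..hi} \<Longrightarrow> \<bar>f1 x\<bar> \<le> L"
    by (meson bounded_real compact_imp_bounded imageI)
  have "\<bar>f z - f y\<bar> \<le> max 0 L * \<bar>z - y\<bar>" if yz: "y \<in> {lo..hi}" "z \<in> {lo..hi}" for y z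
  proof -
    obtain t where t: "min y z \<le> t" "t \<le> max y z" "f z - f y = f1 t * (z - y)"
      using C1_on_mvt[OF assms yz] by auto
    have "t \<in> {lo..hi}" using t yz by (auto simp: min_def max_def split: if_splits)
    then have "\<bar>f1 t\<bar> \<le> max 0 L" using L[of t] by auto
    then show ?thesis unfolding t(3) abs_mult by (intro mult_right_mono) auto
  qed
  then have "(max 0 L)-lipschitz_on {lo..hi} f"
    by (intro lipschitz_onI) (auto simp: dist_real_def abs_minus_commute)
  then show ?thesis ..
qed

text \<open>The derivative is continuous and nonzero at \<open>x\<close>, so by the mean value
  theorem all difference quotients near \<open>x\<close> agree up to a factor close to 1. Near
  \<open>x\<close> the set \<open>S\<close> has to stay inside the interval of regularity.\<close>

lemma asymp_affine_C1:
  assumes f: "C1_regular {lo..hi} f" and x: "x \<in> {lo..hi}"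
    and S: "0 < s" "\<And>y. y \<in> S \<Longrightarrow> \<bar>y - x\<bar> < s \<Longrightarrow> y \<in> {lo..hi}"
  shows "asymp_affine S x f (\<lambda>y. y)"
  unfolding asymp_affine_def
proof (intro allI impI)
  fix k :: real assume k: "1 < k"
  obtain f1 where f1: "C1_on {lo..hi} f f1" "\<And>x. x \<in> {lo..hi} \<Longrightarrow> f1 x \<noteq> 0"
    using f unfolding C1_regular_def by auto
  define m where "m = \<bar>f1 x\<bar>"
  \<comment> \<open>The solution of \<open>(m + ep) / (m - ep) = k\<close>.\<close>
  define ep where "ep = m * (k - 1) / (k + 1)"
  have m: "0 < m" using f1(2)[OF x] by (simp add: m_def)
  have ep: "0 < ep" "m + ep = k * (m - ep)" "ep < m" using m k by (auto simp: ep_def field_simps)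
  have "continuous_on {lo..hi} f1" using f1 by (simp add: C1_on_def)
  then obtain d where d: "0 < d" "\<And>y. y \<in> {lo..hi} \<Longrightarrow> dist y x < d \<Longrightarrow> dist (f1 y) (f1 x) < ep"
    using x ep unfolding continuous_on_iff by metis
  have bd: "(m - ep) * \<bar>z - y\<bar> \<le> \<bar>f z - f y\<bar> \<and> \<bar>f z - f y\<bar> \<le> (m + ep) * \<bar>z - y\<bar>"
    if "y \<in> S" "z \<in> S" "\<bar>y - x\<bar> < min d s" "\<bar>z - x\<bar> < min d s" for y z
  proof -
    have yz: "y \<in> {lo..hi}" "z \<in> {lo..hi}" using S that by auto
    obtain t where t: "min y z \<le> t" "t \<le> max y z" "f z - f y = f1 t * (z - y)"
      using C1_on_mvt[OF f1(1) yz] by auto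
    have "\<bar>t - x\<bar> < d" using t that by linarith
    moreover have "t \<in> {lo..hi}" using t yz by (auto simp: min_def max_def split: if_splits)
    ultimately have "\<bar>f1 t - f1 x\<bar> < ep" using d(2)[of t] by (auto simp: dist_real_def)
    then have "m - ep \<le> \<bar>f1 t\<bar>" "\<bar>f1 t\<bar> \<le> m + ep" unfolding m_def by linarith+
    then show ?thesis unfolding t(3) abs_mult by (auto intro: mult_right_mono)
  qed
  show "\<exists>d>0. \<forall>y z u v. {y, z, u, v} \<subseteq> S \<inter> {x - d<..<x + d} \<longrightarrow>
     \<bar>f z - f y\<bar> * \<bar>v - u\<bar> \<le> k * (\<bar>z - y\<bar> * \<bar>f v - f u\<bar>)"
  proof (intro exI[of _ "min d s"] conjI allI impI)
    fix y z u v assume *: "{y, z, u, v} \<subseteq> S \<inter> {x - min d s<..<x + min d s}"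
    then have in_S: "y \<in> S" "z \<in> S" "u \<in> S" "v \<in> S" by auto
    have nr: "\<bar>y - x\<bar> < min d s" "\<bar>z - x\<bar> < min d s" "\<bar>u - x\<bar> < min d s" "\<bar>v - x\<bar> < min d s"
      using * by (auto simp: abs_diff_less_iff simp del: min_less_iff_conj)
    have "\<bar>f z - f y\<bar> * \<bar>v - u\<bar> \<le> (k * (m - ep) * \<bar>z - y\<bar>) * \<bar>v - u\<bar>"
      using bd[of y z] in_S nr ep by (intro mult_right_mono) auto
    also have "\<dots> = k * \<bar>z - y\<bar> * ((m - ep) * \<bar>v - u\<bar>)" by simp
    also have "\<dots> \<le> k * \<bar>z - y\<bar> * \<bar>f v - f u\<bar>"
      using bd[of u v] in_S nr k by (intro mult_left_mono) auto
    finally show "\<bar>f z - f y\<bar> * \<bar>v - u\<bar> \<le> k * (\<bar>z - y\<bar> * \<bar>f v - f u\<bar>)" by (simp add: mult_ac)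
  qed (use d S in auto)
qed

text \<open>Intended for \<open>h\<close> a pure power and \<open>K\<close> the regular remainder of
  a composition of branches. Although \<open>h\<close> may be critical at \<open>x\<close>, only
  regularity of \<open>K\<close> at \<open>h x = 0\<close> matters for comparing \<open>f\<close>
  with \<open>h\<close>.\<close>

lemma asymp_affine_compose:
  assumes K: "C1_regular {0..ep} K" "0 < ep"
    and h: "continuous_on R h" "x \<in> R" "h x = 0" "\<And>y. y \<in> R \<Longrightarrow> 0 \<le> h y"
    and S: "0 < s" "\<And>y. y \<in> S \<Longrightarrow> \<bar>y - x\<bar> < s \<Longrightarrow> y \<in> R"
    and f: "\<And>y. y \<in> R \<Longrightarrow> h y \<le> ep \<Longrightarrow> f y = K (h y) + t"
  shows "asymp_affine S x f h"
  unfolding asymp_affine_def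
proof (intro allI impI)
  fix k :: real assume k: "1 < k"
  have "asymp_affine {0..} 0 K (\<lambda>v. v)"
    by (rule asymp_affine_C1[OF K(1), where s=ep]) (use K in auto)
  then obtain d where d: "0 < d" "\<And>y z u v. {y, z, u, v} \<subseteq> {0..} \<inter> {0 - d<..<0 + d} \<Longrightarrow>
     \<bar>K z - K y\<bar> * \<bar>v - u\<bar> \<le> k * (\<bar>z - y\<bar> * \<bar>K v - K u\<bar>)"
    using asymp_affineD k by blast
  have "0 < min d ep" using d K by simp
  then obtain d' where d': "0 < d'" "\<And>y. y \<in> R \<Longrightarrow> dist y x < d' \<Longrightarrow> dist (h y) (h x) < min d ep"
    using h(1,2) unfolding continuous_on_iff by metis
  show "\<exists>d>0. \<forall>y z u v. {y, z, u, v} \<subseteq> S \<inter> {x - d<..<x + d} \<longrightarrow>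
     \<bar>f z - f y\<bar> * \<bar>h v - h u\<bar> \<le> k * (\<bar>h z - h y\<bar> * \<bar>f v - f u\<bar>)"
  proof (intro exI[of _ "min d' s"] conjI allI impI)
    fix y z u v assume *: "{y, z, u, v} \<subseteq> S \<inter> {x - min d' s<..<x + min d' s}"
    have near: "h p \<in> {0..} \<inter> {0 - d<..<0 + d}" "f p = K (h p) + t" if "p \<in> {y, z, u, v}" for p
    proof -
      have p: "p \<in> S" "\<bar>p - x\<bar> < d'" "\<bar>p - x\<bar> < s" using * that by (auto simp: abs_diff_less_iff)
      have "p \<in> R" using S(2) p by blast
      then show "h p \<in> {0..} \<inter> {0 - d<..<0 + d}" "f p = K (h p) + t"
        using d'(2)[of p] p h(3) h(4)[of p] f[of p] by (auto simp: dist_real_def)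
    qed
    then show "\<bar>f z - f y\<bar> * \<bar>h v - h u\<bar> \<le> k * (\<bar>h z - h y\<bar> * \<bar>f v - f u\<bar>)"
      using d(2)[of "h y" "h z" "h u" "h v"] by simp
  qed (use d' S in auto)
qed

section \<open>Three times differentiable maps and \<open>C3\<close> diffeomorphisms\<close>

definition D3_regular :: "real set \<Rightarrow> (real \<Rightarrow> real) \<Rightarrow> bool" where
  "D3_regular I f \<longleftrightarrow> (\<exists>f1 f2 f3. \<forall>x\<in>I. (f has_real_derivative f1 x) (at x) \<and>
     (f1 has_real_derivative f2 x) (at x) \<and> (f2 has_real_derivative f3 x) (at x) \<and> f1 x \<noteq> 0)"

lemma D3_regular_compose:
  assumes "D3_regular J f" "D3_regular I g" "g ` I \<subseteq> J"
  shows "D3_regular I (\<lambda>x. f (g x))"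
proof -
  obtain f1 f2 f3 where f: "\<And>x. x \<in> J \<Longrightarrow> (f has_real_derivative f1 x) (at x) \<and>
     (f1 has_real_derivative f2 x) (at x) \<and> (f2 has_real_derivative f3 x) (at x) \<and> f1 x \<noteq> 0"
    using assms(1) unfolding D3_regular_def Ball_def by blast
  obtain g1 g2 g3 where g: "\<And>x. x \<in> I \<Longrightarrow> (g has_real_derivative g1 x) (at x) \<and>
     (g1 has_real_derivative g2 x) (at x) \<and> (g2 has_real_derivative g3 x) (at x) \<and> g1 x \<noteq> 0"
    using assms(2) unfolding D3_regular_def Ball_def by blast
  show ?thesis
    unfolding D3_regular_def
  proof (intro exI ballI conjI)
    fix x assume x: "x \<in> I"
    note gx = g[OF x]
    have "g x \<in> J" using x assms(3) by auto
    note fx = f[OF this]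
    have c: "((\<lambda>x. h (g x)) has_real_derivative h' * g1 x) (at x)"
      if "(h has_real_derivative h') (at (g x))" for h h'
      using DERIV_chain2[where f=h and g=g and x=x, OF that] gx by blast
    show "((\<lambda>x. f (g x)) has_real_derivative f1 (g x) * g1 x) (at x)" using c fx by blast
    show "((\<lambda>x. f1 (g x) * g1 x) has_real_derivative f2 (g x) * g1 x * g1 x + f1 (g x) * g2 x) (at x)"
      using fx gx by (auto intro!: derivative_eq_intros c)
    show "((\<lambda>x. f2 (g x) * g1 x * g1 x + f1 (g x) * g2 x) has_real_derivative
       (f3 (g x) * g1 x) * g1 x * g1 x + f2 (g x) * g2 x * g1 x + f2 (g x) * g1 x * g2 x
        + (f2 (g x) * g1 x) * g2 x + f1 (g x) * g3 x) (at x)"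
      by (rule derivative_eq_intros c fx[THEN conjunct2, THEN conjunct1]
           fx[THEN conjunct2, THEN conjunct2, THEN conjunct1] gx[THEN conjunct2, THEN conjunct1]
           gx[THEN conjunct2, THEN conjunct2, THEN conjunct1] refl)+ (simp add: algebra_simps)
    show "f1 (g x) * g1 x \<noteq> 0" using fx gx by simp
  qed
qed

lemma D3_regular_affine: "m \<noteq> 0 \<Longrightarrow> D3_regular I (\<lambda>x. m * x + t)"
  unfolding D3_regular_def
  by (intro exI[of _ "\<lambda>_. m"] exI[of _ "\<lambda>_. 0"]) (auto intro!: derivative_eq_intros)

lemma D3_regular_powr:
  assumes "\<And>x. x \<in> I \<Longrightarrow> 0 < x" "l \<noteq> 0"
  shows "D3_regular I (\<lambda>x. x powr l)"
  unfolding D3_regular_def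
proof (intro exI ballI conjI)
  fix x assume "x \<in> I"
  then have x: "0 < x" by (rule assms)
  have *: "((\<lambda>x. a * x powr l) has_real_derivative a * l * x powr (l - 1)) (at x)" for a l
    using DERIV_cmult[OF has_real_derivative_powr[OF x, of l], of a] by (simp add: mult_ac)
  show "((\<lambda>x. x powr l) has_real_derivative l * x powr (l - 1)) (at x)" using *[of 1 l] by simp
  show "((\<lambda>x. l * x powr (l - 1)) has_real_derivative (l * (l - 1)) * x powr (l - 1 - 1)) (at x)" by (rule *)
  show "((\<lambda>x. (l * (l - 1)) * x powr (l - 1 - 1)) has_real_derivative
      (l * (l - 1) * (l - 1 - 1)) * x powr (l - 1 - 1 - 1)) (at x)" by (rule *)
  show "l * x powr (l - 1) \<noteq> 0" using x assms by simp
qed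

lemma C1_regular_power_branch:
  assumes "C1_regular S h" "\<And>y. y \<in> S \<Longrightarrow> 0 < h y" "m \<noteq> 0" "l \<noteq> 0"
  shows "C1_regular S (\<lambda>y. m * h y powr l + t)"
proof -
  have "C1_regular S (\<lambda>y. h y powr l)"
    by (rule C1_regular_compose[OF C1_regular_powr[of "{0<..}" l] assms(1)]) (use assms in auto)
  then show ?thesis using assms by (intro C1_regular_compose[OF C1_regular_affine[of _ UNIV]]) auto
qed

lemma D3_regular_power_branch:
  assumes "D3_regular S h" "\<And>y. y \<in> S \<Longrightarrow> 0 < h y" "m \<noteq> 0" "l \<noteq> 0"
  shows "D3_regular S (\<lambda>y. m * h y powr l + t)"
proof -
  have "D3_regular S (\<lambda>y. h y powr l)"
    by (rule D3_regular_compose[OF D3_regular_powr[of "{0<..}" l] assms(1)]) (use assms in auto)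
  then show ?thesis using assms by (intro D3_regular_compose[OF D3_regular_affine[of _ UNIV]]) auto
qed

text \<open>The derivative of \<open>g\<close> vanishes nowhere on the closed interval, because the
  inverse is differentiable as well: by the chain rule the two derivatives have product 1.\<close>

lemma C3_diffeo_props:
  assumes "C3_diffeo g"
  shows "C1_regular {0..1} g" "D3_regular {0<..<1} g" "g 0 = 0" "g 1 = 1"
    "\<And>y z. 0 \<le> y \<Longrightarrow> y < z \<Longrightarrow> z \<le> 1 \<Longrightarrow> g y < g z"
proof -
  have bij: "bij_betw g {0..1} {0..1}" and sm: "strict_mono_on {0..1} g"
    using assms by (auto simp: C3_diffeo_def)
  show lt: "g y < g z" if "0 \<le> y" "y < z" "z \<le> 1" for y z
    using sm that by (auto simp: strict_mono_on_def)
  have im: "g ` {0..1} = {0..1}" using bij by (simp add: bij_betw_def)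
  have ge: "0 \<le> g y \<and> g y \<le> 1" if "y \<in> {0..1}" for y using im that by auto
  show "g 0 = 0"
  proof -
    obtain y where "y \<in> {0..1}" "g y = 0" using im by (metis atLeastAtMost_iff imageE order_refl zero_le_one)
    then show ?thesis using lt[of 0 y] ge[of 0] by (cases "y = 0") auto
  qed
  show "g 1 = 1"
  proof -
    obtain y where "y \<in> {0..1}" "g y = 1" using im by (metis atLeastAtMost_iff imageE order_refl zero_le_one)
    then show ?thesis using lt[of y 1] ge[of 1] by (cases "y = 1") auto
  qed
  obtain D where D0: "\<And>x. x \<in> {0..1} \<Longrightarrow> D 0 x = g x"
    and D: "\<And>i x. i < 3 \<Longrightarrow> x \<in> {0..1} \<Longrightarrow> (D i has_real_derivative D (Suc i) x) (at x within {0..1})"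
    using assms unfolding C3_diffeo_def C3_on_def by metis
  obtain E :: "nat \<Rightarrow> real \<Rightarrow> real" where E0: "\<And>x. x \<in> {0..1} \<Longrightarrow> E 0 x = inv_into {0..1} g x"
    and E: "\<And>x. x \<in> {0..1} \<Longrightarrow> (E 0 has_real_derivative E 1 x) (at x within {0..1})"
  proof -
    obtain E :: "nat \<Rightarrow> real \<Rightarrow> real" where "\<forall>x\<in>{0..1}. E 0 x = inv_into {0..1} g x"
      "\<forall>i<3. \<forall>x\<in>{0..1}. (E i has_real_derivative E (Suc i) x) (at x within {0..1})"
      using assms unfolding C3_diffeo_def C3_on_def by metis
    then show ?thesis using that[of E] by simp
  qed
  have g': "(g has_real_derivative D 1 x) (at x within {0..1})" if "x \<in> {0..1}" for x
  proof -
    have "(D 0 has_derivative (*) (D 1 x)) (at x within {0..1})"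
      using D[of 0 x] that by (simp add: has_field_derivative_def)
    then show ?thesis unfolding has_field_derivative_def
      by (rule has_derivative_transform[OF that, rotated]) (rule D0[symmetric])
  qed
  have ne: "D 1 x \<noteq> 0" if x: "x \<in> {0..1}" for x
  proof
    assume z: "D 1 x = 0"
    have "((E 0 \<circ> g) has_real_derivative E 1 (g x) * D 1 x) (at x within {0..1})"
      by (rule DERIV_image_chain) (use E[of "g x"] ge[OF x] g'[OF x] in \<open>simp_all add: im\<close>)
    then have "((\<lambda>x. x) has_real_derivative E 1 (g x) * D 1 x) (at x within {0..1})"
      unfolding has_field_derivative_def
    proof (rule has_derivative_transform[OF x, rotated])
      fix y :: real assume y: "y \<in> {0..1}"
      have "inv_into {0..1} g (g y) = y" using bij y by (simp add: bij_betw_def inv_into_f_f)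
      then show "y = (E 0 \<circ> g) y" using E0[of "g y"] ge[OF y] by simp
    qed
    then have "((\<lambda>x. x) has_vector_derivative 0) (at x within cbox 0 1)"
      using z by (simp add: has_real_derivative_iff_has_vector_derivative)
    moreover have "((\<lambda>x. x) has_vector_derivative 1) (at x within cbox 0 1)"
      unfolding has_real_derivative_iff_has_vector_derivative[symmetric] by (rule DERIV_ident)
    ultimately have "(0::real) = 1"
      by (intro vector_derivative_unique_within_closed_interval[of 0 1 x]) (use x in auto)
    then show False by simp
  qed
  have at: "(h has_real_derivative h') (at x)"
    if "(h has_real_derivative h') (at x within {0..1})" "x \<in> {0<..<1}" for h h' x
    using that at_within_Icc_at[of 0 x 1] by simp
  have suc: "Suc 0 = 1" "Suc 1 = 2" "Suc 2 = 3" by simp_all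
  have D12: "(D 1 has_real_derivative D 2 x) (at x within {0..1})"
    and D23: "(D 2 has_real_derivative D 3 x) (at x within {0..1})" if "x \<in> {0..1}" for x
    using D[OF _ that, of 1] D[OF _ that, of 2] by (simp_all only: suc)
  have "continuous_on {0..1} (D 1)" by (rule DERIV_continuous_on) (rule D12)
  then show "C1_regular {0..1} g" unfolding C1_regular_def C1_on_def using g' ne by blast
  have "(g has_real_derivative D 1 x) (at x) \<and> (D 1 has_real_derivative D 2 x) (at x) \<and>
      (D 2 has_real_derivative D 3 x) (at x) \<and> D 1 x \<noteq> 0" if "x \<in> {0<..<1}" for x
    using at[OF g'] at[OF D12] at[OF D23] ne that by simp
  then show "D3_regular {0<..<1} g" unfolding D3_regular_def by blast
qed

lemma C3_diffeo_affine:
  assumes "C3_diffeo g" "m \<noteq> 0" "\<And>y. lo < y \<Longrightarrow> y < hi \<Longrightarrow> 0 < m * y + t \<and> m * y + t < 1"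
    "{m * lo + t, m * hi + t} \<subseteq> {0..1}"
  shows "C1_regular {lo..hi} (\<lambda>y. g (m * y + t))" "D3_regular {lo<..<hi} (\<lambda>y. g (m * y + t))"
proof -
  have "m * y + t \<in> {0..1}" if "y \<in> {lo..hi}" for y
    using assms(3)[of y] assms(4) that by (cases "y = lo"; cases "y = hi") auto
  then show "C1_regular {lo..hi} (\<lambda>y. g (m * y + t))"
    by (intro C1_regular_compose[OF C3_diffeo_props(1)[OF assms(1)] C1_regular_affine[OF assms(2)]]) auto
  show "D3_regular {lo<..<hi} (\<lambda>y. g (m * y + t))"
    using assms(3) by (intro D3_regular_compose[OF C3_diffeo_props(2)[OF assms(1)] D3_regular_affine[OF assms(2)]]) auto
qed

text \<open>On the branch the lift \<open>F\<close> differs from \<open>f\<close> by a constant, so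
  their derivatives agree and the Schwarzian hypothesis on \<open>F\<close> applies to
  \<open>f\<close>. The first derivative is nonzero, and monotonicity makes it positive.\<close>

lemma neg_schwarzian_branch:
  assumes br: "D3_regular {lo<..<hi} f" and cont: "continuous_on {lo..hi} f"
    and inc: "\<And>y z. lo < y \<Longrightarrow> y < z \<Longrightarrow> z < hi \<Longrightarrow> f y < f z"
    and F: "\<And>y. lo < y \<Longrightarrow> y < hi \<Longrightarrow> F y = f y + t"
    and neg: "\<And>y. thrice_differentiable_at F y \<Longrightarrow> deriv F y \<noteq> 0 \<Longrightarrow> schwarzian F y < 0"
  shows "decreases_cross_ratio lo hi f"
proof -
  let ?I = "{lo<..<hi}"
  obtain f1 f2 f3 where f: "\<And>x. x \<in> ?I \<Longrightarrow> (f has_real_derivative f1 x) (at x) \<and>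
     (f1 has_real_derivative f2 x) (at x) \<and> (f2 has_real_derivative f3 x) (at x) \<and> f1 x \<noteq> 0"
    using br unfolding D3_regular_def Ball_def by blast
  have F1: "(F has_real_derivative f1 x) (at x)" if x: "x \<in> ?I" for x
  proof (rule has_field_derivative_transform_within_open[where S="?I"])
    show "((\<lambda>y. f y + t) has_real_derivative f1 x) (at x)"
      using f[OF x] by (auto intro!: derivative_eq_intros)
  qed (use F x in auto)
  then have d1: "deriv F x = f1 x" if "x \<in> ?I" for x using that DERIV_imp_deriv by blast
  have F2: "(deriv F has_real_derivative f2 x) (at x)" if x: "x \<in> ?I" for x
    by (rule has_field_derivative_transform_within_open[where S="?I" and f=f1]) (use f x d1 in auto)
  then have d2: "(deriv ^^ 2) F x = f2 x" if "x \<in> ?I" for x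
    using that DERIV_imp_deriv[of "deriv F"] by (simp add: numeral_2_eq_2)
  have F3: "((deriv ^^ 2) F has_real_derivative f3 x) (at x)" if x: "x \<in> ?I" for x
    by (rule has_field_derivative_transform_within_open[where S="?I" and f=f2]) (use f x d2 in auto)
  then have d3: "(deriv ^^ 3) F x = f3 x" if "x \<in> ?I" for x
    using that DERIV_imp_deriv[of "(deriv ^^ 2) F"] by (simp add: numeral_2_eq_2 numeral_3_eq_3)
  have pos: "0 < f1 x" if x: "x \<in> ?I" for x
  proof (rule ccontr)
    assume "\<not> 0 < f1 x"
    then have "f1 x < 0" using f[OF x] by auto
    then obtain d where d: "d > 0" "\<And>h. 0 < h \<Longrightarrow> h < d \<Longrightarrow> f (x + h) < f x"
      using DERIV_neg_dec_right[of f "f1 x" x] f[OF x] by auto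
    define h where "h = min (d / 2) ((hi - x) / 2)"
    have "0 < h" "h < d" "x + h < hi" using d x by (auto simp: h_def min_def field_simps)
    then show False using d(2)[of h] inc[of x "x + h"] x by auto
  qed
  have "f3 x / f1 x - 3 / 2 * (f2 x / f1 x)\<^sup>2 < 0" if x: "x \<in> ?I" for x
  proof -
    have "thrice_differentiable_at F x"
      unfolding thrice_differentiable_at_def
    proof
      have "\<forall>\<^sub>F z in nhds x. z \<in> ?I" using x by (intro eventually_nhds_in_open) auto
      then show "\<forall>\<^sub>F z in nhds x. F field_differentiable at z \<and> deriv F field_differentiable at z"
        by eventually_elim (use F1 F2 in \<open>auto simp: field_differentiable_def\<close>)
      show "(deriv ^^ 2) F field_differentiable at x" using F3[OF x] by (auto simp: field_differentiable_def)
    qed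
    then have "schwarzian F x < 0" using neg pos[OF x] d1[OF x] by simp
    then show ?thesis unfolding schwarzian_def using d1[OF x] d2[OF x] d3[OF x] by simp
  qed
  then interpret neg_schwarzian_interval f f1 f2 f3 lo hi
    using f pos cont by unfold_locales auto
  show ?thesis by (rule cross_ratio_decreasing)
qed

section \<open>The branches of a map in the class\<close>

lemma powr_lipschitz:
  fixes p :: real
  assumes "1 \<le> p"
  shows "p-lipschitz_on {0..1} (\<lambda>x. x powr p)"
proof (rule lipschitz_on_leI)
  fix x y :: real assume xy: "x \<in> {0..1}" "y \<in> {0..1}" "x \<le> y"
  show "dist (x powr p) (y powr p) \<le> p * dist x y"
  proof (cases "x = y")
    case False
    then have lt: "x < y" using xy by simp
    have D: "((\<lambda>x. x powr p) has_real_derivative p * z powr (p - 1)) (at z)" if "x < z" for z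
      using has_real_derivative_powr[of z p] that xy by simp
    have "\<exists>l z. x < z \<and> z < y \<and> ((\<lambda>x. x powr p) has_real_derivative l) (at z) \<and> y powr p - x powr p = (y - x) * l"
    proof (rule MVT[OF lt])
      show "continuous_on {x..y} (\<lambda>x. x powr p)"
        using assms xy by (intro continuous_on_powr' continuous_intros) auto
      show "(\<lambda>x. x powr p) differentiable (at z)" if "x < z" "z < y" for z
        using D[OF that(1)] unfolding real_differentiable_def by blast
    qed
    then obtain l z where z: "x < z" "z < y" "((\<lambda>x. x powr p) has_real_derivative l) (at z)"
      "y powr p - x powr p = (y - x) * l" by blast
    have "l = p * z powr (p - 1)" using DERIV_unique[OF z(3) D] z by simp
    moreover have "z powr (p - 1) \<le> 1" using z xy assms by (intro powr_le1) auto
    ultimately have "0 \<le> l" "l \<le> p" using assms by (auto simp: mult_le_cancel_left1)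
    then have "\<bar>y powr p - x powr p\<bar> \<le> p * \<bar>y - x\<bar>"
      unfolding z(4) abs_mult using lt by (simp add: mult.commute mult_right_mono)
    then show ?thesis by (simp add: dist_real_def abs_minus_commute)
  qed simp
qed (use assms in simp)

lemma lipschitz_compose_ex:
  fixes f g :: "real \<Rightarrow> real"
  assumes "\<exists>L. L-lipschitz_on T f" "\<exists>L. L-lipschitz_on S g" "g ` S \<subseteq> T"
  shows "\<exists>L. L-lipschitz_on S (\<lambda>x. f (g x))"
  using assms lipschitz_on_compose2 lipschitz_on_subset by metis

lemma lipschitz_affine_ex: "\<exists>L. L-lipschitz_on S (\<lambda>x::real. m * x + t)"
  by (intro exI[of _ "\<bar>m\<bar>"] lipschitz_onI)
     (auto simp: dist_real_def abs_mult right_diff_distrib[symmetric])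

lemma lipschitz_concat_ex:
  fixes h :: "real \<Rightarrow> real"
  assumes "\<exists>L. L-lipschitz_on {a..b} h" "\<exists>L. L-lipschitz_on {b..c} h"
  shows "\<exists>L. L-lipschitz_on {a..c} h"
proof -
  obtain L M where "L-lipschitz_on {a..b} h" "M-lipschitz_on {b..c} h" using assms by auto
  then have "(max L M)-lipschitz_on {a..b} h" "(max L M)-lipschitz_on {b..c} h"
    by (auto elim: lipschitz_on_le)
  from lipschitz_on_concat[OF this refl] show ?thesis by auto
qed

text \<open>Shows that a lift differs from a continuous piece of the circle map by one fixed number
  of periods.\<close>

lemma continuous_multiples_constant:
  fixes h :: "real \<Rightarrow> real"
  assumes "connected S" "continuous_on S h" "\<And>y. y \<in> S \<Longrightarrow> \<exists>k::int. h y = of_int k * c" "0 < c"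
  shows "\<exists>k::int. \<forall>y\<in>S. h y = of_int k * c"
proof (cases "S = {}")
  case False
  then obtain y0 where y0: "y0 \<in> S" by auto
  have "h constant_on S"
  proof (rule continuous_discrete_range_constant[OF assms(1,2)])
    fix x assume "x \<in> S"
    then obtain k :: int where k: "h x = of_int k * c" using assms by blast
    show "\<exists>e>0. \<forall>y. y \<in> S \<and> h y \<noteq> h x \<longrightarrow> e \<le> norm (h y - h x)"
    proof (intro exI[of _ c] conjI allI impI assms(4))
      fix y assume y: "y \<in> S \<and> h y \<noteq> h x"
      then obtain m :: int where m: "h y = of_int m * c" using assms by blast
      have "m \<noteq> k" using y k m by auto
      then have "1 \<le> \<bar>of_int (m - k) :: real\<bar>" by linarith
      then have "1 * c \<le> \<bar>of_int (m - k)\<bar> * c" using assms(4) by (intro mult_right_mono) auto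
      then show "c \<le> norm (h y - h x)" using assms(4) by (simp add: k m abs_mult left_diff_distrib[symmetric])
    qed
  qed
  then show ?thesis using assms(3)[OF y0] y0 by (auto simp: constant_on_def)
qed auto

locale flat_circle_map =
  fixes l1 l2 :: real and f :: flat_tuple
  assumes l1: "1 < l1" and l2: "1 < l2" and cL: "f \<in> class_L"
begin

abbreviation "X1 \<equiv> x\<^sub>1 f"
abbreviation "X2 \<equiv> x\<^sub>2 f"
abbreviation "X3 \<equiv> x\<^sub>3 f"
abbreviation "X4 \<equiv> x\<^sub>4 f"
abbreviation "s \<equiv> s_par f"
abbreviation "c \<equiv> circ_length f"
abbreviation "circ \<equiv> circ_map l1 l2 f"

lemma ordX: "X1 < 0" "0 < X3" "X3 < X4" "X4 < 1" "0 < X2" "X2 < 1" "0 < s" "s < 1"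
  and diffeo: "C3_diffeo (phi f)" "C3_diffeo (phi_l f)" "C3_diffeo (phi_r f)"
  using cL by (auto simp: class_L_def)

lemma c_eq: "c = 1 - X1" by (simp add: circ_length_def)

lemma c_pos: "0 < c" using ordX by (simp add: c_eq)

text \<open>\<open>B1\<close>, \<open>B2\<close>, \<open>B4\<close> are the branches on the three
  intervals that are not flat. \<open>A\<close> and \<open>B\<close> are the smooth coordinates at
  \<open>X3\<close> and \<open>X4\<close> whose powers give \<open>B2\<close> and
  \<open>B4\<close>.\<close>

definition B1 :: "real \<Rightarrow> real" where
  "B1 y = (1 - X2) * q_branch l2 s (phi f ((X1 - y) / X1)) + X2"

definition A :: "real \<Rightarrow> real" where "A y = phi_l f ((X3 - y) / X3)"

definition B :: "real \<Rightarrow> real" where "B y = phi_r f ((y - X4) / (1 - X4))"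

definition B2 :: "real \<Rightarrow> real" where "B2 y = X1 * A y powr l1"

definition B4 :: "real \<Rightarrow> real" where "B4 y = X2 * B y powr l2"

lemmas phi0 = C3_diffeo_props(3)[OF diffeo(1)] C3_diffeo_props(3)[OF diffeo(2)] C3_diffeo_props(3)[OF diffeo(3)]
lemmas phi1 = C3_diffeo_props(4)[OF diffeo(1)] C3_diffeo_props(4)[OF diffeo(2)] C3_diffeo_props(4)[OF diffeo(3)]

lemma diffeo_range:
  assumes "C3_diffeo g"
  shows "0 \<le> y \<Longrightarrow> y \<le> 1 \<Longrightarrow> 0 \<le> g y \<and> g y \<le> 1" "0 < y \<Longrightarrow> y < 1 \<Longrightarrow> 0 < g y \<and> g y < 1"
  using C3_diffeo_props(3-4)[OF assms] C3_diffeo_props(5)[OF assms, of 0 y] C3_diffeo_props(5)[OF assms, of y 1]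
  by (cases "y = 0"; cases "y = 1"; force)+

lemma A_props: "A X3 = 0" "A 0 = 1" "0 \<le> y \<Longrightarrow> y < z \<Longrightarrow> z \<le> X3 \<Longrightarrow> A z < A y"
  "0 \<le> y \<Longrightarrow> y \<le> X3 \<Longrightarrow> 0 \<le> A y \<and> A y \<le> 1" "0 < y \<Longrightarrow> y < X3 \<Longrightarrow> 0 < A y \<and> A y < 1"
proof -
  show "A X3 = 0" "A 0 = 1" using ordX by (simp_all add: A_def phi0 phi1)
  show "A z < A y" if "0 \<le> y" "y < z" "z \<le> X3"
    unfolding A_def using that ordX by (intro C3_diffeo_props(5)[OF diffeo(2)]) (auto simp: divide_simps)
  show "0 \<le> y \<Longrightarrow> y \<le> X3 \<Longrightarrow> 0 \<le> A y \<and> A y \<le> 1"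
    unfolding A_def using ordX by (intro diffeo_range(1)[OF diffeo(2)]) (auto simp: divide_simps)
  show "0 < y \<Longrightarrow> y < X3 \<Longrightarrow> 0 < A y \<and> A y < 1"
    unfolding A_def using ordX by (intro diffeo_range(2)[OF diffeo(2)]) (auto simp: divide_simps)
qed

lemma B_props: "B X4 = 0" "B 1 = 1" "X4 \<le> y \<Longrightarrow> y < z \<Longrightarrow> z \<le> 1 \<Longrightarrow> B y < B z"
  "X4 \<le> y \<Longrightarrow> y \<le> 1 \<Longrightarrow> 0 \<le> B y \<and> B y \<le> 1" "X4 < y \<Longrightarrow> y < 1 \<Longrightarrow> 0 < B y \<and> B y < 1"
proof -
  show "B X4 = 0" "B 1 = 1" using ordX by (simp_all add: B_def phi0 phi1)
  show "B y < B z" if "X4 \<le> y" "y < z" "z \<le> 1"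
    unfolding B_def using that ordX by (intro C3_diffeo_props(5)[OF diffeo(3)]) (auto simp: divide_simps)
  show "X4 \<le> y \<Longrightarrow> y \<le> 1 \<Longrightarrow> 0 \<le> B y \<and> B y \<le> 1"
    unfolding B_def using ordX by (intro diffeo_range(1)[OF diffeo(3)]) (auto simp: divide_simps)
  show "X4 < y \<Longrightarrow> y < 1 \<Longrightarrow> 0 < B y \<and> B y < 1"
    unfolding B_def using ordX by (intro diffeo_range(2)[OF diffeo(3)]) (auto simp: divide_simps)
qed

lemma s_powr: "s powr l2 < 1" "0 < s powr l2"
  using ordX l2 powr_less_mono2[of l2 s 1] by auto

lemma B1_eq: "B1 y = (1 - X2) / (1 - s powr l2) * (((1 - s) * phi f (- (1 / X1) * y + 1) + s) powr l2)
    + (X2 - (1 - X2) * s powr l2 / (1 - s powr l2))"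
proof -
  have "(X1 - y) / X1 = - (1 / X1) * y + 1" using ordX by (simp add: diff_divide_distrib)
  moreover have "(1 - x) * ((P - S) / d) + x = (1 - x) / d * P + (x - (1 - x) * S / d)" for x P S d :: real
    by (simp add: diff_divide_distrib algebra_simps)
  ultimately show ?thesis unfolding B1_def q_branch_def by simp
qed

lemma B2_eq: "B2 y = X1 * A y powr l1 + 0" and A_eq: "A y = phi_l f (- (1 / X3) * y + 1)"
  using ordX by (simp_all add: B2_def A_def diff_divide_distrib)

lemma B4_eq: "B4 y = X2 * B y powr l2 + 0" and B_eq: "B y = phi_r f (1 / (1 - X4) * y + - (X4 / (1 - X4)))"
  using ordX by (simp_all add: B4_def B_def diff_divide_distrib)

lemma B1_ends: "B1 X1 = X2" "B1 0 = 1"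
  using ordX s_powr l2 by (simp_all add: B1_def q_branch_def phi0 phi1)

lemma B1_mono: "X1 \<le> y \<Longrightarrow> y < z \<Longrightarrow> z \<le> 0 \<Longrightarrow> B1 y < B1 z"
proof -
  assume yz: "X1 \<le> y" "y < z" "z \<le> 0"
  have u: "0 \<le> - (1 / X1) * y + 1" "- (1 / X1) * y + 1 < - (1 / X1) * z + 1" "- (1 / X1) * z + 1 \<le> 1"
    using yz ordX by (auto simp: divide_simps)
  have "phi f (- (1 / X1) * y + 1) < phi f (- (1 / X1) * z + 1)" "0 \<le> phi f (- (1 / X1) * y + 1)"
    using C3_diffeo_props(5)[OF diffeo(1) u] diffeo_range(1)[OF diffeo(1) u(1)] u by auto
  then have "((1 - s) * phi f (- (1 / X1) * y + 1) + s) powr l2 < ((1 - s) * phi f (- (1 / X1) * z + 1) + s) powr l2"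
    using ordX l2 by (intro powr_less_mono2) auto
  then show ?thesis unfolding B1_eq using ordX s_powr
    by (intro add_strict_right_mono mult_strict_left_mono) auto
qed

lemma B2_ends: "B2 0 = X1" "B2 X3 = 0"
  using l1 by (simp_all add: B2_def A_props)

lemma B2_mono: "0 \<le> y \<Longrightarrow> y < z \<Longrightarrow> z \<le> X3 \<Longrightarrow> B2 y < B2 z"
  unfolding B2_def using A_props(3)[of y z] A_props(4)[of z] ordX l1
  by (intro mult_strict_left_mono_neg powr_less_mono2) auto

lemma B4_ends: "B4 X4 = 0" "B4 1 = X2"
  using l2 by (simp_all add: B4_def B_props)

lemma B4_mono: "X4 \<le> y \<Longrightarrow> y < z \<Longrightarrow> z \<le> 1 \<Longrightarrow> B4 y < B4 z"
  unfolding B4_def using B_props(3)[of y z] B_props(4)[of y] ordX l2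
  by (intro mult_strict_left_mono powr_less_mono2) auto

lemma A_regular: "C1_regular {0..X3} A" and A_D3: "D3_regular {0<..<X3} A"
  unfolding A_eq[abs_def]
  by (rule C3_diffeo_affine[OF diffeo(2)]; use ordX in \<open>simp add: divide_simps\<close>)+

lemma B_regular: "C1_regular {X4..1} B" and B_D3: "D3_regular {X4<..<1} B"
  unfolding B_eq[abs_def]
  by (rule C3_diffeo_affine[OF diffeo(3)]; use ordX in \<open>simp add: divide_simps\<close>)+

lemma B1_regular: "C1_regular {X1..0} B1" and B1_D3: "D3_regular {X1<..<0} B1"
proof -
  note phi = C3_diffeo_affine[OF diffeo(1), of "- (1 / X1)" X1 0 1]
  have range: "0 < - (1 / X1) * y + 1 \<and> - (1 / X1) * y + 1 < 1" if "X1 < y" "y < 0" for y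
    using that ordX by (auto simp: divide_simps)
  have pos: "0 < (1 - s) * phi f (- (1 / X1) * y + 1) + s" if "y \<in> {X1..0}" for y
    using that ordX diffeo_range(1)[OF diffeo(1), of "- (1 / X1) * y + 1"]
    by (intro add_nonneg_pos mult_nonneg_nonneg) (auto simp: divide_simps)
  have "C1_regular {X1..0} (\<lambda>y. (1 - s) * phi f (- (1 / X1) * y + 1) + s)"
    using phi(1) range ordX by (intro C1_regular_compose[OF C1_regular_affine[of "1 - s" UNIV s]]) auto
  then show "C1_regular {X1..0} B1" unfolding B1_eq[abs_def]
    by (rule C1_regular_power_branch) (use pos ordX s_powr l2 in auto)
  have "D3_regular {X1<..<0} (\<lambda>y. (1 - s) * phi f (- (1 / X1) * y + 1) + s)"
    using phi(2) range ordX by (intro D3_regular_compose[OF D3_regular_affine[of "1 - s" UNIV s]]) auto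
  then show "D3_regular {X1<..<0} B1" unfolding B1_eq[abs_def]
    by (rule D3_regular_power_branch) (use pos ordX s_powr l2 in auto)
qed

lemma B2_D3: "D3_regular {0<..<X3} B2"
  unfolding B2_eq[abs_def] by (rule D3_regular_power_branch[OF A_D3]) (use A_props l1 ordX in auto)

lemma B4_D3: "D3_regular {X4<..<1} B4"
  unfolding B4_eq[abs_def] by (rule D3_regular_power_branch[OF B_D3]) (use B_props l2 ordX in auto)

lemma B2_regular: "h < X3 \<Longrightarrow> C1_regular {0..h} B2"
proof -
  assume h: "h < X3"
  have "0 < A y" if "y \<in> {0..h}" for y using that A_props(1) A_props(3)[of y X3] h by auto
  then show ?thesis unfolding B2_eq[abs_def]
    using h l1 ordX by (intro C1_regular_power_branch C1_regular_subset[OF A_regular]) auto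
qed

lemma B4_regular: "X4 < h \<Longrightarrow> C1_regular {h..1} B4"
proof -
  assume h: "X4 < h"
  have "0 < B y" if "y \<in> {h..1}" for y using that B_props(1) B_props(3)[of X4 y] h by auto
  then show ?thesis unfolding B4_eq[abs_def]
    using h l2 ordX by (intro C1_regular_power_branch C1_regular_subset[OF B_regular]) auto
qed

lemma regular_lipschitz: "C1_regular {u..v} h \<Longrightarrow> \<exists>L. L-lipschitz_on {u..v} h"
  unfolding C1_regular_def using C1_on_lipschitz by blast

lemma power_branch_lipschitz:
  assumes "C1_regular {u..v} h" "h ` {u..v} \<subseteq> {0..1}" "1 < l"
  shows "\<exists>L. L-lipschitz_on {u..v} (\<lambda>y. m * h y powr l + t)"
proof -
  have "\<exists>L. L-lipschitz_on {u..v} (\<lambda>y. h y powr l)"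
    by (rule lipschitz_compose_ex[OF _ regular_lipschitz[OF assms(1)] assms(2)])
       (use powr_lipschitz[of l] assms in auto)
  then show ?thesis by (intro lipschitz_compose_ex[OF lipschitz_affine_ex[of UNIV]]) auto
qed

lemma B2_lipschitz: "\<exists>L. L-lipschitz_on {0..X3} B2"
  unfolding B2_eq[abs_def] by (rule power_branch_lipschitz[OF A_regular]) (use l1 A_props in auto)

lemma B4_lipschitz: "\<exists>L. L-lipschitz_on {X4..1} B4"
  unfolding B4_eq[abs_def] by (rule power_branch_lipschitz[OF B_regular]) (use l2 B_props in auto)

lemmas B1_cont = C1_regular_imp_continuous_on[OF B1_regular]

lemma lipschitz_cont: "\<exists>L. L-lipschitz_on S h \<Longrightarrow> continuous_on S h"
  using lipschitz_on_continuous_on by blast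

lemmas B2_cont = lipschitz_cont[OF B2_lipschitz]
lemmas B4_cont = lipschitz_cont[OF B4_lipschitz]

lemma circ_B1: "y < 0 \<Longrightarrow> circ y = B1 y"
  by (simp add: circ_map_def B1_def)

lemma circ_B2: "0 \<le> y \<Longrightarrow> y \<le> X3 \<Longrightarrow> circ y = B2 y"
  using B2_ends by (cases "y = 0") (auto simp: circ_map_def B2_def A_def)

lemma circ_flat: "X3 \<le> y \<Longrightarrow> y \<le> X4 \<Longrightarrow> circ y = 0"
  using B2_ends circ_B2[of y] ordX by (cases "y = X3") (auto simp: circ_map_def)

lemma circ_B4: "X4 \<le> y \<Longrightarrow> circ y = B4 y"
  using B4_ends circ_flat[of y] ordX by (cases "y = X4") (auto simp: circ_map_def B4_def B_def)

lemma circ_cont: "continuous_on {0..1} circ"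
proof -
  have "{0..1} = {0..X3} \<union> ({X3..X4} \<union> {X4..1})" using ordX by auto
  moreover have "continuous_on {0..X3} circ" by (rule continuous_on_eq[OF B2_cont]) (simp add: circ_B2)
  moreover have "continuous_on {X3..X4} circ" by (rule continuous_on_eq[OF continuous_on_const[of _ 0]]) (simp add: circ_flat)
  moreover have "continuous_on {X4..1} circ" by (rule continuous_on_eq[OF B4_cont]) (simp add: circ_B4)
  ultimately show ?thesis by (auto intro!: continuous_on_closed_Un)
qed

text \<open>At 0 the representative \<open>circ\<close> jumps from the value 1 of the left branch
  down to \<open>X1\<close>. A continuous lift therefore carries one more period \<open>c\<close> to
  the right of 0.\<close>

lemma lift_eq:
  assumes G: "is_lift l1 l2 f G"
  shows "\<exists>k::int. (\<forall>y\<in>{X1..0}. G y = B1 y + of_int k * c) \<and> (\<forall>y\<in>{0..1}. G y = circ y + of_int k * c + c)"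
proof -
  have cont: "continuous_on S G" for S using G continuous_on_subset by (auto simp: is_lift_def)
  have G': "\<exists>k::int. G y = circ y + of_int k * c" if "X1 \<le> y" "y \<le> 1" for y
    using G that by (auto simp: is_lift_def)
  have circ0: "circ 0 = B1 0 - c" using B1_ends B2_ends circ_B2[of 0] ordX by (simp add: c_eq)
  have "\<exists>k::int. \<forall>y\<in>{X1..0}. G y - B1 y = of_int k * c"
  proof (rule continuous_multiples_constant)
    fix y assume y: "y \<in> {X1..0}"
    obtain k :: int where k: "G y = circ y + of_int k * c" using G'[of y] y by auto
    show "\<exists>k::int. G y - B1 y = of_int k * c"
    proof (cases "y < 0")
      case True
      then show ?thesis using k circ_B1 by auto
    next
      case False
      then have "G y - B1 y = of_int (k - 1) * c" using y k circ0 by (simp add: algebra_simps)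
      then show ?thesis by blast
    qed
  qed (auto intro!: continuous_intros cont B1_cont c_pos)
  then obtain k :: int where k: "\<And>y. y \<in> {X1..0} \<Longrightarrow> G y - B1 y = of_int k * c" by blast
  have "\<exists>k::int. \<forall>y\<in>{0..1}. G y - circ y = of_int k * c"
  proof (rule continuous_multiples_constant)
    fix y :: real assume "y \<in> {0..1}"
    then show "\<exists>k::int. G y - circ y = of_int k * c" using G'[of y] ordX by force
  qed (auto intro!: continuous_intros cont circ_cont c_pos)
  then obtain m :: int where m: "\<And>y. y \<in> {0..1} \<Longrightarrow> G y - circ y = of_int m * c" by blast
  have "of_int m * c = of_int k * c + c" using k[of 0] m[of 0] circ0 ordX by simp
  then show ?thesis using k m by (intro exI[of _ k]) (auto simp: algebra_simps)
qed

end

section \<open>The normalised lift, which equals \<open>B1\<close> to the left of 0\<close>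

locale flat_circle_lift = flat_circle_map +
  fixes F :: "real \<Rightarrow> real"
  assumes F_cont: "continuous_on UNIV F" and F_shift: "F (y + c) = F y + c"
    and F_B1: "X1 \<le> y \<Longrightarrow> y \<le> 0 \<Longrightarrow> F y = B1 y"
    and F_circ: "0 \<le> y \<Longrightarrow> y \<le> 1 \<Longrightarrow> F y = circ y + c"
begin

lemma F_B2: "0 \<le> y \<Longrightarrow> y \<le> X3 \<Longrightarrow> F y = B2 y + c"
  and F_flat: "X3 \<le> y \<Longrightarrow> y \<le> X4 \<Longrightarrow> F y = c"
  and F_B4: "X4 \<le> y \<Longrightarrow> y \<le> 1 \<Longrightarrow> F y = B4 y + c"
  using ordX F_circ circ_B2 circ_flat circ_B4 by auto

lemma F_shift_int: "F (y + of_int k * c) = F y + of_int k * c"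
  using add_int_period F_shift .

lemma F_less_left: "X1 \<le> y \<Longrightarrow> y < z \<Longrightarrow> z \<le> X3 \<Longrightarrow> F y < F z"
proof -
  assume yz: "X1 \<le> y" "y < z" "z \<le> X3"
  have 1: "F y < F z" if "z \<le> 0" using B1_mono[of y z] yz that by (simp add: F_B1)
  have 2: "F y < F z" if "0 \<le> y" using B2_mono[of y z] yz that by (simp add: F_B2)
  have 3: "F y < F z" if "y < 0" "0 < z"
  proof -
    have "F y < F 0" using B1_mono[of y 0] yz that by (simp add: F_B1)
    also have "F 0 < F z" using B2_mono[of 0 z] yz that ordX by (simp add: F_B2)
    finally show ?thesis .
  qed
  show ?thesis using 1 2 3 by linarith
qed

lemma F_less_right: "X4 \<le> y \<Longrightarrow> y < z \<Longrightarrow> z \<le> 1 \<Longrightarrow> F y < F z"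
  using B4_mono[of y z] by (simp add: F_B4)

lemma F_le_fund: "X1 \<le> y \<Longrightarrow> y \<le> z \<Longrightarrow> z \<le> 1 \<Longrightarrow> F y \<le> F z"
  and F_eq_fund: "X1 \<le> y \<Longrightarrow> y < z \<Longrightarrow> z \<le> 1 \<Longrightarrow> F y = F z \<Longrightarrow> X3 \<le> y \<and> z \<le> X4"
proof -
  have L: "F y \<le> F z" if "X1 \<le> y" "y \<le> z" "z \<le> X3" for y z
    using F_less_left[of y z] that by (cases "y = z") auto
  have R: "F y \<le> F z" if "X4 \<le> y" "y \<le> z" "z \<le> 1" for y z
    using F_less_right[of y z] that by (cases "y = z") auto
  have U: "F y \<le> F X3" if "X1 \<le> y" "y \<le> X4" for y
    using L[of y X3] F_flat[of y] F_flat[of X3] that ordX by (cases "y \<le> X3") auto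
  have V: "F X4 \<le> F z" if "X3 \<le> z" "z \<le> 1" for z
    using R[of X4 z] F_flat[of z] F_flat[of X4] that ordX by (cases "X4 \<le> z") auto
  have e: "F X3 = F X4" using F_flat ordX by simp
  show le: "F y \<le> F z" if "X1 \<le> y" "y \<le> z" "z \<le> 1" for y z
    using L[of y z] R[of y z] U[of y] V[of z] e that by (cases "z \<le> X3"; cases "X4 \<le> y") auto
  assume yz: "X1 \<le> y" "y < z" "z \<le> 1" "F y = F z"
  have "X3 \<le> y"
  proof (rule ccontr)
    assume "\<not> ?thesis"
    then have "F y < F (min z X3)" using yz by (intro F_less_left) auto
    also have "\<dots> \<le> F z" using yz ordX by (intro le) auto
    finally show False using yz by simp
  qed
  moreover have "z \<le> X4"
  proof (rule ccontr)
    assume "\<not> ?thesis"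
    then have "F (max y X4) < F z" using yz by (intro F_less_right) auto
    moreover have "F y \<le> F (max y X4)" using yz ordX by (intro le) auto
    ultimately show False using yz by simp
  qed
  ultimately show "X3 \<le> y \<and> z \<le> X4" ..
qed

lemma fund_domain: "\<exists>k::int. X1 \<le> y - of_int k * c \<and> y - of_int k * c < 1"
proof -
  define k where "k = \<lfloor>(y - X1) / c\<rfloor>"
  have "of_int k \<le> (y - X1) / c" "(y - X1) / c < of_int k + 1" by (auto simp: k_def)
  then have "of_int k * c \<le> y - X1" "y - X1 < (of_int k + 1) * c" using c_pos by (auto simp: field_simps)
  then show ?thesis by (intro exI[of _ k]) (auto simp: c_eq algebra_simps)
qed

lemma F_1: "F 1 = F X1 + c"
  using F_shift[of X1] by (simp add: c_eq)

lemma period_decomposition: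
  assumes "y < z"
  obtains u v and k :: int and n :: nat where "X1 \<le> u" "u < 1" "X1 \<le> v" "v < 1" "y = u + of_int k * c"
    "z = v + of_int k * c + of_nat n * c" "F y = F u + of_int k * c" "F z = F v + of_int k * c + of_nat n * c"
proof -
  obtain k :: int where k: "X1 \<le> y - of_int k * c" "y - of_int k * c < 1" using fund_domain by blast
  obtain m :: int where m: "X1 \<le> z - of_int m * c" "z - of_int m * c < 1" using fund_domain by blast
  have "k \<le> m"
  proof (rule ccontr)
    assume "\<not> k \<le> m"
    then have "of_int m + 1 \<le> (of_int k :: real)" by linarith
    then have "(of_int m + 1) * c \<le> of_int k * c" using c_pos by (intro mult_right_mono) auto
    then show False using k m assms by (simp add: c_eq algebra_simps)
  qed
  then have "of_int m * c = of_int k * c + of_nat (nat (m - k)) * c" by (simp add: algebra_simps)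
  moreover have "F y = F (y - of_int k * c) + of_int k * c" "F z = F (z - of_int m * c) + of_int m * c"
    using F_shift_int[of "y - of_int k * c" k] F_shift_int[of "z - of_int m * c" m] by simp_all
  ultimately show thesis using k m by (intro that[of "y - of_int k * c" "z - of_int m * c" k "nat (m - k)"]) auto
qed

lemma F_mono_inj:
  assumes "y < z"
  shows "F y \<le> F z" "F y = F z \<Longrightarrow> \<exists>k::int. X3 + of_int k * c \<le> y \<and> z \<le> X4 + of_int k * c"
proof -
  obtain u v and k :: int and n :: nat where uv: "X1 \<le> u" "u < 1" "X1 \<le> v" "v < 1"
    and yz: "y = u + of_int k * c" "z = v + of_int k * c + of_nat n * c"
    and F: "F y = F u + of_int k * c" "F z = F v + of_int k * c + of_nat n * c"
    using period_decomposition[OF assms] .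
  have lt: "F y < F z" if "n \<noteq> 0"
  proof -
    have "1 * c \<le> of_nat n * c" using that c_pos by (intro mult_right_mono) auto
    moreover have "F u \<le> F (max u X4)" "F (max u X4) < F 1" "F X1 \<le> F v"
      using uv ordX by (auto intro!: F_le_fund F_less_right)
    ultimately show ?thesis unfolding F using F_1 by linarith
  qed
  show "F y \<le> F z"
    using F_le_fund[of u v] uv assms lt yz unfolding F by (cases "n = 0") auto
  assume "F y = F z"
  then have "n = 0" "F u = F v" using lt F by auto
  then show "\<exists>k::int. X3 + of_int k * c \<le> y \<and> z \<le> X4 + of_int k * c"
    using F_eq_fund[of u v] uv assms unfolding yz by (intro exI[of _ k]) auto
qed

lemma F_orbit: "F X3 = c" "F (F X3) = 1 + c"
proof -
  show 1: "F X3 = c" using F_flat ordX by simp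
  have "F (0 + c) = F 0 + c" by (rule F_shift)
  then show "F (F X3) = 1 + c" using B1_ends F_B1[of 0] ordX by (simp add: 1)
qed

lemma cross_ratio_F:
  assumes N: "decreases_cross_ratio X1 0 B1" "decreases_cross_ratio 0 X3 B2" "decreases_cross_ratio X4 1 B4"
    and lt: "p1 < p2" "p2 < p3" "p3 < p4"
    and av: "\<And>y k::int. p1 < y \<Longrightarrow> y < p4 \<Longrightarrow> \<not> (X3 + of_int k * c \<le> y \<and> y \<le> X4 + of_int k * c) \<and>
         y \<noteq> F X3 + of_int k * c \<and> y \<noteq> F (F X3) + of_int k * c"
  shows "cross_ratio (F p1) (F p2) (F p3) (F p4) \<le> cross_ratio p1 p2 p3 p4"
proof -
  obtain k :: int where k: "X1 \<le> p1 - of_int k * c" "p1 - of_int k * c < 1" using fund_domain by blast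
  define u where "u p = p - of_int k * c" for p
  have Fp: "F p = F (u p) + of_int k * c" for p using F_shift_int[of "u p" k] by (simp add: u_def)
  have u: "X1 \<le> u p1" "u p1 < 1" "u p1 < u p2" "u p2 < u p3" "u p3 < u p4" using k lt by (auto simp: u_def)
  have avu: "\<not> (X3 \<le> y \<and> y \<le> X4)" "y \<noteq> 0" "y \<noteq> 1" if "u p1 < y" "y < u p4" for y
  proof -
    have y: "p1 < y + of_int k * c" "y + of_int k * c < p4" using that by (auto simp: u_def)
    show "\<not> (X3 \<le> y \<and> y \<le> X4)" using av[OF y, of k] by auto
    \<comment> \<open>The junctions 0 and 1 equal \<open>F X3 - c\<close> and
      \<open>F (F X3) - c\<close>, which accounts for the index \<open>k - 1\<close>.\<close>
    show "y \<noteq> 0" using av[OF y, of "k - 1"] F_orbit by (auto simp: algebra_simps)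
    show "y \<noteq> 1" using av[OF y, of "k - 1"] F_orbit by (auto simp: algebra_simps)
  qed
  have u4: "u p4 \<le> 1" using avu(3)[of 1] u by force
  have goal: "cross_ratio (F (u p1)) (F (u p2)) (F (u p3)) (F (u p4)) \<le> cross_ratio (u p1) (u p2) (u p3) (u p4)"
  proof -
    consider "u p4 \<le> 0" | "0 \<le> u p1" "u p4 \<le> X3" | "X4 \<le> u p1"
    proof -
      have "u p4 \<le> 0" if "u p1 < 0" using avu(2)[of 0] that by force
      moreover have "u p4 \<le> X3" if "u p1 < X3" using avu(1)[of X3] that ordX by force
      moreover have "X4 \<le> u p1" if "X3 \<le> u p1"
      proof (rule ccontr)
        assume "\<not> ?thesis"
        then obtain y where "u p1 < y" "y < min (u p4) X4" using u dense[of "u p1" "min (u p4) X4"] by auto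
        then show False using avu(1)[of y] that by auto
      qed
      ultimately show ?thesis using that by linarith
    qed
    then show ?thesis
    proof cases
      case 1
      have "F (u p) = B1 (u p)" if "p \<in> {p1, p2, p3, p4}" for p
        using that u 1 by (intro F_B1) auto
      from this[of p1] this[of p2] this[of p3] this[of p4] show ?thesis
        using N(1)[unfolded decreases_cross_ratio_def, rule_format, of "u p1" "u p2" "u p3" "u p4"] u 1 by simp
    next
      case 2
      have "F (u p) = B2 (u p) + c" if "p \<in> {p1, p2, p3, p4}" for p
        using that u 2 by (intro F_B2) auto
      from this[of p1] this[of p2] this[of p3] this[of p4] show ?thesis
        using N(2)[unfolded decreases_cross_ratio_def, rule_format, of "u p1" "u p2" "u p3" "u p4"] u 2
        by (simp add: cross_ratio_def)
    next
      case 3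
      have "F (u p) = B4 (u p) + c" if "p \<in> {p1, p2, p3, p4}" for p
        using that u u4 3 by (intro F_B4) auto
      from this[of p1] this[of p2] this[of p3] this[of p4] show ?thesis
        using N(3)[unfolded decreases_cross_ratio_def, rule_format, of "u p1" "u p2" "u p3" "u p4"] u 3 u4
        by (simp add: cross_ratio_def)
    qed
  qed
  then show ?thesis unfolding Fp[of p1] Fp[of p2] Fp[of p3] Fp[of p4] by (simp add: cross_ratio_def u_def)
qed

lemma F_lipschitz: "\<exists>L. L-lipschitz_on {X1..1} F"
proof -
  have cong: "\<exists>L. L-lipschitz_on S F" if "\<exists>L. L-lipschitz_on S h" "\<And>y. y \<in> S \<Longrightarrow> F y = h y + t"
    for S :: "real set" and h :: "real \<Rightarrow> real" and t :: real
    using that by (auto simp: lipschitz_on_def dist_real_def)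
  have 1: "\<exists>L. L-lipschitz_on {X1..0} F" by (rule cong[OF regular_lipschitz[OF B1_regular], where t=0]) (auto simp: F_B1)
  have 2: "\<exists>L. L-lipschitz_on {0..X3} F" by (rule cong[OF B2_lipschitz, where t=c]) (auto simp: F_B2)
  have 3: "\<exists>L. L-lipschitz_on {X3..X4} F" by (rule cong[OF lipschitz_affine_ex[of _ 0 0], where t=c]) (auto simp: F_flat)
  have 4: "\<exists>L. L-lipschitz_on {X4..1} F" by (rule cong[OF B4_lipschitz, where t=c]) (auto simp: F_B4)
  show ?thesis using 1 2 3 4 lipschitz_concat_ex by blast
qed

lemma F_le: "y \<le> z \<Longrightarrow> F y \<le> F z"
  using F_mono_inj(1)[of y z] by (cases "y = z") auto

lemma F_lipschitz_UNIV: "\<exists>L. L-lipschitz_on UNIV F"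
proof -
  obtain L where L: "L-lipschitz_on {X1..1} F" using F_lipschitz by blast
  have fund: "F v - F u \<le> L * (v - u)" if "X1 \<le> u" "u \<le> v" "v \<le> 1" for u v
    using lipschitz_onD[OF L, of v u] that by (auto simp: dist_real_def)
  \<comment> \<open>\<open>F\<close> advances by exactly \<open>c\<close> over one period, so a
    Lipschitz constant on the period is at least 1. This permits whole periods between
    \<open>y\<close> and \<open>z\<close>.\<close>
  have "c \<le> L * c" using fund[of X1 1] F_1 ordX by (simp add: c_eq)
  then have L1: "1 \<le> L" using c_pos by simp
  have "F z - F y \<le> L * (z - y)" if lt: "y < z" for y z
  proof -
    obtain u v and k :: int and n :: nat where uv: "X1 \<le> u" "u < 1" "X1 \<le> v" "v < 1"
      and yz: "y = u + of_int k * c" "z = v + of_int k * c + of_nat n * c"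
      and F: "F y = F u + of_int k * c" "F z = F v + of_int k * c + of_nat n * c"
      using period_decomposition[OF lt] .
    show ?thesis
    proof (cases "n = 0")
      case True
      then have "z - y = v - u" using yz by simp
      moreover have "F z - F y = F v - F u" using True F by simp
      ultimately show ?thesis using fund[of u v] lt uv by simp
    next
      case False
      define d where "d = of_nat n * c"
      have "1 * c \<le> d" unfolding d_def using False c_pos by (intro mult_right_mono) auto
      then have "1 * (d - c) \<le> L * (d - c)" using L1 by (intro mult_right_mono) auto
      then have "(F 1 - F u) + (F v - F X1) + 1 * (d - c) \<le> L * (1 - u) + L * (v - X1) + L * (d - c)"
        by (intro add_mono fund; use uv ordX in linarith)
      also have "(F 1 - F u) + (F v - F X1) + 1 * (d - c) = F z - F y" using F_1 by (simp add: F d_def)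
      also have "L * (1 - u) + L * (v - X1) + L * (d - c) = L * (z - y)"
        by (simp add: yz d_def c_eq right_diff_distrib distrib_left)
      finally show ?thesis .
    qed
  qed
  then have "L-lipschitz_on UNIV F"
  proof (intro lipschitz_on_leI)
    fix y z :: real assume "y \<le> z"
    then show "dist (F y) (F z) \<le> L * dist y z"
      using F_le[of y z] \<open>\<And>y z. y < z \<Longrightarrow> F z - F y \<le> L * (z - y)\<close>[of y z]
      by (cases "y = z") (auto simp: dist_real_def)
  qed (use L1 in simp)
  then show ?thesis ..
qed

lemma F3_eq: "(F ^^ 3) y = F (F (F y))"
  by (simp add: numeral_3_eq_3)

lemma A_affine: "asymp_affine {..X3} X3 A (\<lambda>y. y)"
  by (rule asymp_affine_C1[OF A_regular, where s=X3]) (use ordX in auto)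

lemma B_affine: "asymp_affine {X4..} X4 B (\<lambda>y. y)"
  by (rule asymp_affine_C1[OF B_regular, where s="1 - X4"]) (use ordX in auto)

text \<open>Just left of the flat piece the three iterates are \<open>B2\<close>, then
  \<open>B1\<close> near 0, then \<open>B4\<close> near 1. The last two are regular there, so the
  power \<open>l1\<close> in \<open>B2\<close> is the only singular part.\<close>

lemma F3_A: "asymp_affine {..X3} X3 (F ^^ 3) (\<lambda>y. A y powr l1)"
proof -
  \<comment> \<open>A point between the critical point \<open>X4\<close> of \<open>B4\<close> and 1:
    on \<open>[h, 1]\<close> the branch \<open>B4\<close> is regular.\<close>
  define h where "h = (1 + X4) / 2"
  have h: "X4 < h" "h < 1" using ordX by (auto simp: h_def)
  have "isCont B1 0 \<or> True" by simp
  have "\<exists>t<0. X1 \<le> t \<and> (\<forall>v. t \<le> v \<longrightarrow> v \<le> 0 \<longrightarrow> h \<le> B1 v)"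
  proof -
    have "0 < 1 - h" using h by simp
    then obtain d where d: "d > 0" "\<And>v. v \<in> {X1..0} \<Longrightarrow> dist v 0 < d \<Longrightarrow> dist (B1 v) (B1 0) < 1 - h"
      using B1_cont ordX unfolding continuous_on_iff by (metis atLeastAtMost_iff less_imp_le order_refl)
    have "h \<le> B1 v" if "max X1 (- d / 2) \<le> v" "v \<le> 0" for v
      using d(2)[of v] that d(1) B1_ends by (auto simp: dist_real_def)
    then show ?thesis using d(1) ordX by (intro exI[of _ "max X1 (- d / 2)"]) auto
  qed
  then obtain t where t: "t < 0" "X1 \<le> t" "\<And>v. t \<le> v \<Longrightarrow> v \<le> 0 \<Longrightarrow> h \<le> B1 v" by blast
  define ep where "ep = t / X1"
  have ep: "0 < ep" "X1 * ep = t" using t ordX by (auto simp: ep_def divide_neg_neg)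
  have vb: "t \<le> X1 * v + 0 \<and> X1 * v + 0 \<le> 0" if "v \<in> {0..ep}" for v
    using that ordX ep by (auto simp: mult_nonpos_nonneg simp flip: ep(2))
  have "C1_regular {0..ep} (\<lambda>v. B1 (X1 * v + 0))"
  proof (rule C1_regular_compose[OF B1_regular C1_regular_affine])
    show "(\<lambda>v. X1 * v + 0) ` {0..ep} \<subseteq> {X1..0}"
    proof (rule image_subsetI)
      fix v assume "v \<in> {0..ep}"
      from vb[OF this] show "X1 * v + 0 \<in> {X1..0}" using t(2) unfolding atLeastAtMost_iff by linarith
    qed
  qed (use ordX in auto)
  then have K: "C1_regular {0..ep} (\<lambda>v. B4 (B1 (X1 * v + 0)))"
  proof (rule C1_regular_compose[OF B4_regular[OF h(1)]])
    show "(\<lambda>v. B1 (X1 * v + 0)) ` {0..ep} \<subseteq> {h..1}"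
    proof
      fix y assume "y \<in> (\<lambda>v. B1 (X1 * v + 0)) ` {0..ep}"
      then obtain v where v: "v \<in> {0..ep}" "y = B1 (X1 * v + 0)" by auto
      have "B1 u \<le> B1 0" if "t \<le> u" "u \<le> 0" for u
        using B1_mono[of u 0] that t(2) by (cases "u = 0") auto
      then have "B1 (X1 * v + 0) \<le> B1 0" using vb[OF v(1)] by blast
      then show "y \<in> {h..1}" using t(3)[of "X1 * v + 0"] vb[OF v(1)] v B1_ends by auto
    qed
  qed
  have "continuous_on {0..X3} (\<lambda>y. A y powr l1)"
    using C1_regular_imp_continuous_on[OF A_regular] l1 A_props
    by (intro continuous_on_powr' continuous_intros) auto
  then show ?thesis
  proof (rule asymp_affine_compose[OF K ep(1), where s=X3 and t="2 * c"])
    fix y assume y': "y \<in> {0..X3}" "A y powr l1 \<le> ep"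
    then have v: "A y powr l1 \<in> {0..ep}" by simp
    note vb' = vb[OF v]
    have Fy: "F y = B2 y + c" using F_B2 y' by simp
    have B2y: "B2 y = X1 * A y powr l1 + 0" by (rule B2_eq)
    have B2r: "t \<le> B2 y" "B2 y \<le> 0" "X1 \<le> B2 y" using vb' t(2) unfolding B2y by linarith+
    have "F (F y) = F (B2 y) + c" unfolding Fy by (rule F_shift)
    also have "F (B2 y) = B1 (B2 y)" using B2r by (intro F_B1)
    finally have FF: "F (F y) = B1 (B2 y) + c" .
    have "F (B1 (B2 y) + c) = F (B1 (B2 y)) + c" by (rule F_shift)
    also have "F (B1 (B2 y)) = B4 (B1 (B2 y)) + c"
    proof (rule F_B4)
      show "X4 \<le> B1 (B2 y)" using t(3)[OF B2r(1,2)] h by linarith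
      show "B1 (B2 y) \<le> 1" using B1_mono[of "B2 y" 0] B2r B1_ends by (cases "B2 y = 0") auto
    qed
    finally have "(F ^^ 3) y = B4 (B1 (B2 y)) + 2 * c" by (simp add: F3_eq FF)
    then show "(F ^^ 3) y = B4 (B1 (X1 * A y powr l1 + 0)) + 2 * c" by (simp add: B2y)
  qed (use ordX l1 A_props in auto)
qed

text \<open>Just right of the flat piece the three iterates are \<open>B4\<close>, then
  \<open>B2\<close> near 0, then \<open>B1\<close> near \<open>X1\<close>. The bound
  \<open>X3 / 2\<close> keeps the second one away from its critical point \<open>X3\<close>.\<close>

lemma F3_B: "asymp_affine {X4..} X4 (F ^^ 3) (\<lambda>y. B y powr l2)"
proof -
  define ep where "ep = min 1 (X3 / 2 / X2)"
  have ep: "0 < ep" "ep \<le> 1" "X2 * ep \<le> X3 / 2" using ordX by (auto simp: ep_def min_def field_simps)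
  have vb: "0 \<le> X2 * v + 0 \<and> X2 * v + 0 \<le> X3 / 2" if "v \<in> {0..ep}" for v
  proof -
    have "X2 * v \<le> X2 * ep" using that ordX by (intro mult_left_mono) auto
    moreover have "0 \<le> X2 * v" using that ordX by simp
    ultimately show ?thesis using ep by linarith
  qed
  have b2: "X1 \<le> B2 v \<and> B2 v \<le> 0" if "0 \<le> v" "v \<le> X3 / 2" for v
  proof -
    have "B2 v < B2 X3" using that ordX by (intro B2_mono) auto
    moreover have "B2 0 \<le> B2 v" using B2_mono[of 0 v] that ordX by (cases "v = 0") auto
    ultimately show ?thesis using B2_ends by simp
  qed
  have "C1_regular {0..ep} (\<lambda>v. B2 (X2 * v + 0))"
    by (rule C1_regular_compose[OF B2_regular[of "X3 / 2"] C1_regular_affine]) (use vb ordX in force)+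
  then have K: "C1_regular {0..ep} (\<lambda>v. B1 (B2 (X2 * v + 0)))"
    by (rule C1_regular_compose[OF B1_regular]) (use vb b2 in force)
  have "continuous_on {X4..1} (\<lambda>y. B y powr l2)"
    using C1_regular_imp_continuous_on[OF B_regular] l2 B_props
    by (intro continuous_on_powr' continuous_intros) auto
  then show ?thesis
  proof (rule asymp_affine_compose[OF K ep(1), where s="1 - X4" and t="2 * c"])
    fix y assume y': "y \<in> {X4..1}" "B y powr l2 \<le> ep"
    then have v: "B y powr l2 \<in> {0..ep}" by simp
    note vb' = vb[OF v]
    have Fy: "F y = B4 y + c" using F_B4 y' by simp
    have B4y: "B4 y = X2 * B y powr l2 + 0" by (rule B4_eq)
    have "F (F y) = F (B4 y) + c" unfolding Fy by (rule F_shift)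
    also have "F (B4 y) = B2 (B4 y) + c" using vb' ordX by (intro F_B2) (auto simp: B4y)
    finally have FF: "F (F y) = (B2 (B4 y) + c) + c" .
    have "F ((B2 (B4 y) + c) + c) = F (B2 (B4 y)) + c + c" by (simp only: F_shift)
    also have "F (B2 (B4 y)) = B1 (B2 (B4 y))"
      using b2[of "B4 y"] vb' by (intro F_B1) (auto simp: B4y)
    finally have "(F ^^ 3) y = B1 (B2 (B4 y)) + 2 * c" unfolding F3_eq FF by linarith
    then show "(F ^^ 3) y = B1 (B2 (X2 * B y powr l2 + 0)) + 2 * c" by (simp add: B4y)
  qed (use ordX l2 B_props in auto)
qed

end

section \<open>Golden mean rotation\<close>

lemma golden_mean_props: "0 < golden_mean" "golden_mean < 1" "golden_mean * golden_mean = 1 - golden_mean"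
proof -
  have "sqrt 5 > (2::real)" "sqrt 5 < (3::real)"
    by (auto intro: real_less_rsqrt real_less_lsqrt)
  then show "0 < golden_mean" "golden_mean < 1" by (auto simp: golden_mean_eq)
  show "golden_mean * golden_mean = 1 - golden_mean" by (simp add: golden_mean_eq field_simps)
qed

text \<open>Both sides satisfy the Fibonacci recursion, because \<open>- golden_mean\<close> is a
  root of its characteristic polynomial. The alternating sign is what decides the side of the flat
  piece by the parity of \<open>n\<close>.\<close>

lemma fib_golden_mean: "real (fib (Suc n)) * golden_mean - real (fib n) = - ((- golden_mean) ^ Suc n)"
proof (induction n rule: fib.induct)
  case (3 n)
  have "real (fib (Suc (Suc (Suc n)))) * golden_mean - real (fib (Suc (Suc n)))
      = (real (fib (Suc (Suc n))) * golden_mean - real (fib (Suc n))) + (real (fib (Suc n)) * golden_mean - real (fib n))"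
    by (simp add: algebra_simps)
  also have "\<dots> = - ((- golden_mean) ^ Suc n * (1 - golden_mean))" unfolding 3 by (simp add: algebra_simps)
  also have "1 - golden_mean = (- golden_mean) * (- golden_mean)" using golden_mean_props by simp
  finally show ?case by (simp only: power_Suc mult_ac)
qed (use golden_mean_props in \<open>auto simp: algebra_simps\<close>)

lemma abs_fib_golden_mean: "\<bar>real (fib (Suc n)) * golden_mean - real (fib n)\<bar> = golden_mean ^ Suc n"
  unfolding fib_golden_mean using golden_mean_props by (simp add: power_abs abs_mult)

text \<open>Each value is a mean of the two previous ones with weights \<open>golden_mean\<close>
  and its square, which sum to 1. The index starts at 2 because the bound fails for
  \<open>fib 1\<close>.\<close>

lemma two_fib_golden_mean_le: "2 * real (fib (n + 2)) * golden_mean ^ (n + 2) \<le> 1"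
proof (induction n rule: fib.induct)
  case 1
  have "sqrt 5 \<ge> (2::real)" by (auto intro: real_le_rsqrt)
  then show ?case using golden_mean_props by (simp add: power2_eq_square golden_mean_eq field_simps)
next
  case 2
  have s: "sqrt 5 * sqrt 5 = (5::real)" by simp
  have "golden_mean ^ 3 = 2 * golden_mean - 1"
    by (simp only: power3_eq_cube golden_mean_props(3) left_diff_distrib)
  moreover have "golden_mean \<le> 5 / 8"
    using real_le_lsqrt[of "9/4" 5] by (simp add: golden_mean_eq power2_eq_square)
  ultimately show ?case by (simp add: eval_nat_numeral)
next
  case (3 n)
  let ?a = "2 * real (fib (n + 3)) * golden_mean ^ (n + 3)" and ?b = "2 * real (fib (n + 2)) * golden_mean ^ (n + 2)"
  have "2 * real (fib (n + 4)) * golden_mean ^ (n + 4) = ?a * golden_mean + ?b * (golden_mean * golden_mean)"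
    by (simp add: eval_nat_numeral algebra_simps)
  also have "\<dots> \<le> 1 * golden_mean + 1 * (golden_mean * golden_mean)"
    using 3 golden_mean_props by (intro add_mono mult_right_mono) (auto simp: eval_nat_numeral)
  also have "\<dots> = 1" using golden_mean_props by simp
  finally show ?case by (simp add: eval_nat_numeral)
qed

text \<open>With \<open>q = fib (Suc n)\<close> and \<open>p = fib n\<close>, a better approximation
  would make the integer \<open>i * p - k * q\<close> smaller than
  \<open>2 * q * golden_mean ^ Suc n \<le> 1\<close> in absolute value, hence zero. As
  \<open>q\<close> and \<open>p\<close> are coprime, \<open>q\<close> would then divide
  \<open>i\<close>.\<close>

lemma golden_mean_best_approximation:
  fixes k :: int
  assumes i: "0 < i" "i < fib (Suc n)"
  shows "\<bar>real (fib (Suc n)) * golden_mean - real (fib n)\<bar> \<le> \<bar>real i * golden_mean - of_int k\<bar>"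
proof (rule ccontr)
  assume neg: "\<not> ?thesis"
  have "n \<noteq> 0" using i by (cases n) auto
  then obtain m where m: "n = Suc m" by (cases n) auto
  let ?q = "fib (Suc n)" and ?p = "fib n"
  define th where "th = golden_mean ^ Suc n"
  have th: "0 < th" "2 * real ?q * th \<le> 1"
    using golden_mean_props two_fib_golden_mean_le[of m] by (simp_all add: th_def m)
  define D where "D = int i * int ?p - k * int ?q"
  have "real_of_int D = real ?q * (real i * golden_mean - of_int k) - real i * (real ?q * golden_mean - real ?p)"
    by (simp add: D_def algebra_simps)
  then have "\<bar>real_of_int D\<bar> \<le> real ?q * \<bar>real i * golden_mean - of_int k\<bar> + real i * \<bar>real ?q * golden_mean - real ?p\<bar>"
    using abs_triangle_ineq4[of "real ?q * (real i * golden_mean - of_int k)" "real i * (real ?q * golden_mean - real ?p)"]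
    by (simp only: abs_mult abs_of_nat)
  also have "\<dots> < real ?q * th + real ?q * th"
    using neg i th unfolding abs_fib_golden_mean th_def[symmetric]
    by (intro add_strict_mono mult_strict_left_mono mult_strict_right_mono) auto
  also have "\<dots> \<le> 1" using th(2) by (simp only: mult_2 distrib_right)
  finally have "D = 0" by linarith
  then have "int (i * ?p) = k * int ?q" by (simp add: D_def)
  then have "int ?q dvd int (i * ?p)" by (metis dvd_triv_right)
  then have "?q dvd i * ?p" by (simp only: of_nat_dvd_iff)
  moreover have "coprime ?q ?p" using coprime_fib_Suc_nat[of n] by (simp add: coprime_commute)
  ultimately have "?q dvd i" by (simp add: coprime_dvd_mult_left_iff)
  then show False using i by (auto dest: dvd_imp_le)
qed

text \<open>Otherwise the integer \<open>D\<close>, of absolute value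
  \<open>j * golden_mean ^ Suc n\<close>, would lie strictly between 0 and 1 in absolute value for
  large \<open>n\<close>.\<close>

lemma golden_mean_irrational:
  assumes "0 < j"
  shows "real j * golden_mean \<noteq> of_int k"
proof
  assume eq: "real j * golden_mean = of_int k"
  have "\<exists>n. golden_mean ^ n < 1 / real j"
    using golden_mean_props assms by (intro real_arch_pow_inv) auto
  then obtain n where n: "golden_mean ^ n < 1 / real j" by auto
  define D where "D = int j * int (fib n) - k * int (fib (Suc n))"
  have "real_of_int D = real (fib (Suc n)) * (real j * golden_mean - of_int k) - real j * (real (fib (Suc n)) * golden_mean - real (fib n))"
    by (simp add: D_def algebra_simps)
  then have "\<bar>real_of_int D\<bar> = real j * golden_mean ^ Suc n"
    unfolding eq using abs_fib_golden_mean[of n] by (simp only: abs_mult) (simp add: abs_mult)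
  moreover have "0 < real j * golden_mean ^ Suc n" using assms golden_mean_props by simp
  moreover have "real j * golden_mean ^ Suc n < 1"
  proof -
    have "golden_mean ^ Suc n \<le> golden_mean ^ n" using golden_mean_props by (simp add: mult_left_le_one_le)
    then have "real j * golden_mean ^ Suc n \<le> real j * golden_mean ^ n" by (rule mult_left_mono) simp
    also have "\<dots> < 1" using n assms by (simp add: field_simps)
    finally show ?thesis .
  qed
  ultimately have "0 < \<bar>real_of_int D\<bar>" "\<bar>real_of_int D\<bar> < 1" by simp_all
  moreover from this(2) have "D = 0" by linarith
  ultimately show False by simp
qed

section \<open>Lifts with golden mean rotation number\<close>

locale golden_circle_lift = flat_circle_lift +
  fixes l r :: "nat \<Rightarrow> real"
  assumes rot: "(\<lambda>n. ((F ^^ n) y - y) / (real n * c)) \<longlonglongrightarrow> golden_mean"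
    and N: "decreases_cross_ratio X1 0 B1" "decreases_cross_ratio 0 X3 B2" "decreases_cross_ratio X4 1 B4"
    and l_eq': "(F ^^ fib (Suc n)) (l n) = X3 + real (fib n) * c"
    and r_eq': "(F ^^ fib (Suc n)) (r n) = X4 + real (fib n) * c"
begin

lemma iter_shift': "(F ^^ j) (y + of_int k * c) = (F ^^ j) y + of_int k * c"
  using iter_add_int_period F_shift .

lemma iter_mono': "y \<le> z \<Longrightarrow> (F ^^ j) y \<le> (F ^^ j) z"
  by (induction j) (auto intro: F_le)

lemma rot_subseq: "0 < j \<Longrightarrow> (\<lambda>m. ((F ^^ (j * m)) y - y) / (real (j * m) * c)) \<longlonglongrightarrow> golden_mean"
proof -
  assume "0 < j"
  then have "filterlim (\<lambda>m. j * m) sequentially sequentially"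
    by (intro filterlim_subseq) (auto simp: strict_mono_def)
  then show ?thesis by (rule filterlim_compose[OF rot])
qed

text \<open>A single point moved by at most \<open>k\<close> periods in \<open>j\<close> steps
  would, by monotonicity and periodicity, bound the rotation number by \<open>k / j\<close>.\<close>

lemma rot_greater:
  assumes j: "0 < j" and k: "of_int k < real j * golden_mean"
  shows "y + of_int k * c < (F ^^ j) y"
proof (rule ccontr)
  assume "\<not> ?thesis"
  then have le: "(F ^^ j) y \<le> y + of_int k * c" by simp
  have it: "(F ^^ (j * m)) y \<le> y + of_int (int m * k) * c" for m
  proof (induction m)
    case (Suc m)
    have "(F ^^ (j * Suc m)) y = (F ^^ j) ((F ^^ (j * m)) y)" by (simp add: funpow_add)
    also have "\<dots> \<le> (F ^^ j) (y + of_int (int m * k) * c)" by (rule iter_mono'[OF Suc])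
    also have "\<dots> = (F ^^ j) y + of_int (int m * k) * c" by (rule iter_shift')
    also have "\<dots> \<le> y + of_int (int (Suc m) * k) * c" using le by (simp add: algebra_simps)
    finally show ?case .
  qed simp
  have "golden_mean \<le> of_int k / real j"
  proof (rule LIMSEQ_le_const2[OF rot_subseq[OF j, of y]], intro exI allI impI)
    fix m :: nat assume m: "1 \<le> m"
    have "((F ^^ (j * m)) y - y) / (real (j * m) * c) \<le> (real m * of_int k * c) / (real (j * m) * c)"
      using it[of m] c_pos by (intro divide_right_mono) auto
    also have "\<dots> = of_int k / real j" using m j c_pos by (simp add: field_simps)
    finally show "((F ^^ (j * m)) y - y) / (real (j * m) * c) \<le> of_int k / real j" .
  qed
  then show False using k j by (simp add: field_simps)
qed

lemma rot_less:
  assumes j: "0 < j" and k: "real j * golden_mean < of_int k"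
  shows "(F ^^ j) y < y + of_int k * c"
proof (rule ccontr)
  assume "\<not> ?thesis"
  then have le: "y + of_int k * c \<le> (F ^^ j) y" by simp
  have it: "y + of_int (int m * k) * c \<le> (F ^^ (j * m)) y" for m
  proof (induction m)
    case (Suc m)
    have "y + of_int (int (Suc m) * k) * c \<le> (F ^^ j) y + of_int (int m * k) * c" using le by (simp add: algebra_simps)
    also have "\<dots> = (F ^^ j) (y + of_int (int m * k) * c)" by (rule iter_shift'[symmetric])
    also have "\<dots> \<le> (F ^^ j) ((F ^^ (j * m)) y)" by (rule iter_mono'[OF Suc])
    also have "\<dots> = (F ^^ (j * Suc m)) y" by (simp add: funpow_add)
    finally show ?case .
  qed simp
  have "of_int k / real j \<le> golden_mean"
  proof (rule LIMSEQ_le_const[OF rot_subseq[OF j, of y]], intro exI allI impI)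
    fix m :: nat assume m: "1 \<le> m"
    have "of_int k / real j = (real m * of_int k * c) / (real (j * m) * c)" using m j c_pos by (simp add: field_simps)
    also have "\<dots> \<le> ((F ^^ (j * m)) y - y) / (real (j * m) * c)"
      using it[of m] c_pos by (intro divide_right_mono) auto
    finally show "of_int k / real j \<le> ((F ^^ (j * m)) y - y) / (real (j * m) * c)" .
  qed
  then show False using k j by (simp add: field_simps)
qed

sublocale P: fib_flat_lift F c X3 X4 golden_mean "\<lambda>n. fib (Suc n)" "\<lambda>n. int (fib n)" l r
proof
  show "X3 < X4" "X4 < X3 + c" using ordX by (auto simp: c_eq)
  show "F y \<le> F z" if "y \<le> z" for y z using F_le[OF that] .
  show "F X4 = F X3" using F_flat ordX by simp
  show "\<exists>k::int. X3 + of_int k * c \<le> y \<and> z \<le> X4 + of_int k * c" if "F y = F z" "y < z" for y z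
    using F_mono_inj(2)[OF that(2,1)] .
  show "y + of_int k * c < (F ^^ j) y" if "0 < j" "of_int k < real j * golden_mean" for j k y
    using rot_greater[OF that] .
  show "(F ^^ j) y < y + of_int k * c" if "0 < j" "real j * golden_mean < of_int k" for j k y
    using rot_less[OF that] .
  show "real j * golden_mean \<noteq> of_int k" if "0 < j" for j k using golden_mean_irrational[OF that] .
  show "0 < fib (Suc n)" for n by (rule fib_neq_0_nat) simp
  show "fib (Suc (n + 2)) = fib (Suc (n + 1)) + fib (Suc n)" for n by simp
  show "int (fib (n + 2)) = int (fib (n + 1)) + int (fib n)" for n by simp
  show "of_int (int (fib n)) < real (fib (Suc n)) * golden_mean" if "even n" for n
  proof -
    have "0 < - ((- golden_mean) ^ Suc n)" using that golden_mean_props by (simp add: power_minus_even)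
    then show ?thesis using fib_golden_mean[of n] by simp
  qed
  show "real (fib (Suc n)) * golden_mean < of_int (int (fib n))" if "odd n" for n
  proof -
    have "- ((- golden_mean) ^ Suc n) < 0" using that golden_mean_props by (simp add: power_minus_odd)
    then show ?thesis using fib_golden_mean[of n] by simp
  qed
  show "\<bar>real (fib (Suc n)) * golden_mean - of_int (int (fib n))\<bar> \<le> \<bar>real i * golden_mean - of_int k\<bar>"
    if "0 < i" "i < fib (Suc n)" for i n k
    using golden_mean_best_approximation[OF that] by simp
  show "cross_ratio (F x1) (F x2) (F x3) (F x4) \<le> cross_ratio x1 x2 x3 x4"
    if "x1 < x2" "x2 < x3" "x3 < x4" "\<And>y k::int. x1 < y \<Longrightarrow> y < x4 \<Longrightarrow>
      \<not> (X3 + of_int k * c \<le> y \<and> y \<le> X4 + of_int k * c) \<and>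
         y \<noteq> F X3 + of_int k * c \<and> y \<noteq> F (F X3) + of_int k * c" for x1 x2 x3 x4
    by (rule cross_ratio_F[OF N that])
qed (use F_cont F_shift l_eq' r_eq' in auto)

text \<open>The first images of the flat piece are the junctions of the circle coordinate. Together
  with the interlacing they confine all preimages from index 2 on to the interval from 0 to
  1.\<close>

lemma e_1: "P.e 1 = 0" and e_2: "P.e 2 = 1"
proof -
  show "P.e 1 = 0" using F_orbit by (simp add: P.e_def P.T_def)
  have "fib (Suc 2) = 2" by (simp add: eval_nat_numeral)
  moreover have "fib 2 = 1" by (simp add: eval_nat_numeral)
  moreover have "(F ^^ 2) X3 = 1 + c" using F_orbit by (simp add: eval_nat_numeral)
  ultimately show "P.e 2 = 1" by (simp add: P.e_def P.T_def)
qed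

lemma preimage_left: "even n \<Longrightarrow> 2 \<le> n \<Longrightarrow> 0 < l n \<and> l n < r n \<and> r n < X3"
proof -
  have e: "0 \<le> P.e (2 * k + 1)" for k
  proof (induction k)
    case 0
    then show ?case using e_1 by simp
  next
    case (Suc k)
    have "P.e (2 * k + 1) < l (2 * k + 2)" "r (2 * k + 2) < P.e (2 * k + 2 + 1)" "l (2 * k + 2) < r (2 * k + 2)"
      using P.order_left(2)[of "2 * k"] P.order_left(1)[of "2 * k + 2"] P.l_less_r by auto
    then have "0 \<le> P.e (2 * k + 2 + 1)" using Suc by linarith
    moreover have "2 * Suc k + 1 = 2 * k + 2 + 1" by simp
    ultimately show ?case by (simp only:)
  qed
  assume n: "even n" "2 \<le> n"
  define k where "k = (n - 2) div 2"
  have k: "n = 2 * k + 2" using n unfolding k_def by presburger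
  show ?thesis
    using e[of k] P.order_left[of "2 * k"] P.order_left[of n] P.l_less_r[of n] n by (auto simp: k)
qed

lemma preimage_right: "odd n \<Longrightarrow> 2 \<le> n \<Longrightarrow> X4 < l n \<and> l n < r n \<and> r n < 1"
proof -
  have e: "P.e (2 * k + 2) \<le> 1" for k
  proof (induction k)
    case 0
    show ?case by (simp only: mult_0_right add_0 e_2 order_refl)
  next
    case (Suc k)
    have "P.e (2 * k + 2 + 2) < l (2 * k + 2 + 1)" "r (2 * k + 2 + 1) < P.e (2 * k + 2)"
        "l (2 * k + 2 + 1) < r (2 * k + 2 + 1)"
      using P.order_right(1,2)[of "2 * k + 2"] P.l_less_r by auto
    then have "P.e (2 * k + 2 + 2) \<le> 1" using Suc by linarith
    moreover have "2 * Suc k + 2 = 2 * k + 2 + 2" by simp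
    ultimately show ?case by (simp only:)
  qed
  assume n: "odd n" "2 \<le> n"
  define k where "k = (n - 3) div 2"
  have k: "n = 2 * k + 2 + 1" using n unfolding k_def by presburger
  show ?thesis
    using e[of k] P.order_right[of "2 * k + 2"] P.l_less_r[of n] by (auto simp: k)
qed

sublocale Q: fib_flat_lift_coords F c X3 X4 golden_mean "\<lambda>n. fib (Suc n)" "\<lambda>n. int (fib n)" l r A B l1 l2
proof
  show "\<exists>d>0. \<forall>y z. X3 - d < y \<longrightarrow> y < z \<longrightarrow> z \<le> X3 \<longrightarrow> A z < A y"
    using ordX by (intro exI[of _ X3]) (auto intro: A_props)
  show "\<exists>d>0. \<forall>y z. X4 \<le> y \<longrightarrow> y < z \<longrightarrow> z < X4 + d \<longrightarrow> B y < B z"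
    using ordX by (intro exI[of _ "1 - X4"]) (auto intro: B_props)
qed (use l1 l2 A_props B_props A_affine B_affine F3_A F3_B F_lipschitz_UNIV in auto)

section \<open>From preimages of the lift to the scaling ratios\<close>

lemma circ_range: "X1 \<le> y \<Longrightarrow> y \<le> 1 \<Longrightarrow> X1 \<le> circ y \<and> circ y \<le> 1"
proof -
  assume y: "X1 \<le> y" "y \<le> 1"
  show ?thesis
  proof (cases "y < 0")
    case True
    then show ?thesis
      using F_le[of X1 y] F_le[of y 0] y F_B1[of y] F_B1[of X1] F_B1[of 0] B1_ends circ_B1[of y] ordX by auto
  next
    case False
    then show ?thesis
      using F_le[of 0 y] F_le[of y 1] y F_circ[of y] F_B2[of 0] F_B4[of 1] B2_ends B4_ends ordX by auto
  qed
qed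

lemma circ_iter: "X1 \<le> y \<Longrightarrow> y \<le> 1 \<Longrightarrow>
  X1 \<le> (circ ^^ j) y \<and> (circ ^^ j) y \<le> 1 \<and> (\<exists>k::int. (F ^^ j) y = (circ ^^ j) y + of_int k * c)"
proof (induction j)
  case 0
  then show ?case by (auto intro: exI[of _ 0])
next
  case (Suc j)
  let ?u = "(circ ^^ j) y"
  obtain k :: int where k: "(F ^^ j) y = ?u + of_int k * c" and u: "X1 \<le> ?u" "?u \<le> 1" using Suc by auto
  have "\<exists>i::int. F ?u = circ ?u + of_int i * c"
  proof (cases "?u < 0")
    case True
    then show ?thesis using F_B1[of ?u] circ_B1[of ?u] u by (intro exI[of _ 0]) auto
  next
    case False
    then show ?thesis using F_circ[of ?u] u by (intro exI[of _ 1]) auto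
  qed
  then obtain i :: int where i: "F ?u = circ ?u + of_int i * c" by blast
  have "(F ^^ Suc j) y = (circ ^^ Suc j) y + of_int (i + k) * c"
  proof -
    have "(F ^^ Suc j) y = F (?u + of_int k * c)" using k by simp
    also have "\<dots> = F ?u + of_int k * c" by (rule F_shift_int)
    also have "\<dots> = (circ ^^ Suc j) y + of_int (i + k) * c" by (simp add: i algebra_simps)
    finally show ?thesis .
  qed
  then show ?case using circ_range[OF u] by (intro conjI exI[of _ "i + k"]) auto
qed

text \<open>Iterates of \<open>F\<close> and \<open>circ\<close> agree modulo \<open>c\<close>. The
  preimage and the flat piece both lie within one fundamental interval, so the multiple of
  \<open>c\<close> between them must vanish.\<close>

lemma U_iter_preimage:
  assumes n: "2 \<le> n"
  shows "U_iter l1 l2 f (- int (qn n)) = {l n<..<r n}"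
proof -
  have lr: "0 < l n" "l n < r n" "r n < 1"
    using preimage_left[of n] preimage_right[of n] n ordX by (cases "even n"; force)+
  have q0: "0 < qn n" unfolding qn_def by (rule fib_neq_0_nat) simp
  have T_iff: "P.T n y \<in> {X3<..<X4} \<longleftrightarrow> y \<in> {l n<..<r n}" for y
  proof
    assume "P.T n y \<in> {X3<..<X4}"
    then show "y \<in> {l n<..<r n}"
      using P.T_less_cancel[of n "l n" y] P.T_less_cancel[of n y "r n"] by (simp add: P.T_l P.T_r)
  next
    assume "y \<in> {l n<..<r n}"
    then show "P.T n y \<in> {X3<..<X4}"
      using P.T_less[of n "l n" y] P.T_less[of n y "r n"] ordX by (simp add: P.T_l P.T_r)
  qed
  have T_shift: "P.T n (y - of_int k * c) = P.T n y - of_int k * c" for y k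
    using iter_shift'[of "fib (Suc n)" "y - of_int k * c" k] by (simp add: P.T_def)
  have small: "k = 0" if "\<bar>of_int k * c\<bar> < c" for k :: int
  proof -
    have "\<bar>of_int k :: real\<bar> * c < 1 * c" using that c_pos by (simp add: abs_mult)
    then have "\<bar>of_int k :: real\<bar> < 1" using c_pos by (simp only: mult_less_cancel_right_pos)
    then show ?thesis by linarith
  qed
  have "(circ ^^ qn n) y \<in> flat_piece f \<longleftrightarrow> y \<in> {l n<..<r n}" if y: "X1 \<le> y" "y \<le> 1" for y
  proof -
    obtain k :: int where k: "(F ^^ qn n) y = (circ ^^ qn n) y + of_int k * c"
      and u: "X1 \<le> (circ ^^ qn n) y" "(circ ^^ qn n) y \<le> 1" using circ_iter[OF y] by blast
    have Ty: "P.T n y = (circ ^^ qn n) y + of_int (k - int (fib n)) * c"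
      using k by (simp add: P.T_def qn_def algebra_simps)
    show ?thesis
    proof
      assume "(circ ^^ qn n) y \<in> flat_piece f"
      then have "P.T n (y - of_int (k - int (fib n)) * c) \<in> {X3<..<X4}"
        unfolding T_shift Ty by (simp add: flat_piece_def)
      then have *: "y - of_int (k - int (fib n)) * c \<in> {l n<..<r n}" by (simp only: T_iff)
      then have "\<bar>of_int (k - int (fib n)) * c\<bar> < c"
        using y lr ordX(1) c_eq unfolding abs_less_iff greaterThanLessThan_iff by linarith
      then have "k - int (fib n) = 0" by (rule small)
      then show "y \<in> {l n<..<r n}" using * by (simp only:) simp
    next
      assume "y \<in> {l n<..<r n}"
      then have *: "P.T n y \<in> {X3<..<X4}" by (simp only: T_iff)
      then have "\<bar>of_int (k - int (fib n)) * c\<bar> < c"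
        using u ordX c_eq unfolding Ty abs_less_iff greaterThanLessThan_iff by linarith
      then have "k - int (fib n) = 0" by (rule small)
      then show "(circ ^^ qn n) y \<in> flat_piece f" using * unfolding Ty flat_piece_def by (simp only:) simp
    qed
  qed
  moreover have "X1 \<le> y \<and> y \<le> 1" if "y \<in> {l n<..<r n}" for y using that lr ordX by auto
  ultimately show ?thesis using q0 by (auto simp: U_iter_def)
qed

text \<open>The minimum over the endpoint distances is at most the distance on the side facing the
  flat piece, and the denominator is at least the length of the preimage.\<close>

lemma scaling_ratio_le:
  assumes n: "2 \<le> n"
  shows "scaling_ratio l1 l2 f n \<le> (if even n then X3 - r n else l n - X4) / (r n - l n)"
proof -
  define D where "D = (if even n then X3 - r n else l n - X4)"
  have lr: "0 < l n" "l n < r n" "r n < 1" and D: "0 < D"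
    using preimage_left[of n] preimage_right[of n] n ordX by (cases "even n"; force simp: D_def)+
  have U: "U_iter l1 l2 f (- int (qn n)) = {l n<..<r n}" by (rule U_iter_preimage[OF n])
  have U0: "U_iter l1 l2 f 0 = {X3<..<X4}" by (simp add: U_iter_def flat_piece_def)
  have ends: "endpoints (U_iter l1 l2 f (- int (qn n))) = {l n, r n}" "endpoints (U_iter l1 l2 f 0) = {X3, X4}"
    unfolding U U0 endpoints_def using lr ordX by auto
  let ?S = "{circ_dist f a b |a b. a \<in> {l n, r n} \<and> b \<in> {X3, X4}}"
  have gap: "gap l1 l2 f (- int (qn n)) 0 = Min ?S" unfolding gap_def ends ..
  have S: "?S = (\<lambda>(a, b). circ_dist f a b) ` ({l n, r n} \<times> {X3, X4})" by auto
  have fin: "finite ?S" unfolding S by (intro finite_imageI finite_cartesian_product) auto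
  have "Min ?S \<le> D"
  proof (cases "even n")
    case True
    have "Min ?S \<le> circ_dist f (r n) X3" using fin by (intro Min_le) auto
    also have "\<dots> \<le> \<bar>r n - X3\<bar>" by (simp add: circ_dist_def)
    also have "\<dots> = D" using True D by (simp add: D_def)
    finally show ?thesis .
  next
    case False
    have "Min ?S \<le> circ_dist f (l n) X4" using fin by (intro Min_le) auto
    also have "\<dots> \<le> \<bar>l n - X4\<bar>" by (simp add: circ_dist_def)
    also have "\<dots> = D" using False D by (simp add: D_def)
    finally show ?thesis .
  qed
  moreover have "0 \<le> Min ?S"
    using lr ordX by (subst Min_ge_iff[OF fin]) (auto simp: circ_dist_def circ_length_def)
  moreover have "measure lborel {l n<..<r n} = r n - l n" using lr by simp
  ultimately have "scaling_ratio l1 l2 f n \<le> D / (r n - l n)"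
    unfolding scaling_ratio_def gap_closed_left_def gap U using lr by (intro frac_le) auto
  then show ?thesis by (simp add: D_def)
qed

lemma scaling_ratio_doubly_exponential:
  assumes "l1 < 2" "l2 < 2"
  shows "\<exists>\<kappa> lam :: real. 0 < \<kappa> \<and> \<kappa> < 1 \<and> 1 < lam \<and>
    (\<forall>\<^sub>F n in sequentially. scaling_ratio l1 l2 f n \<le> \<kappa> powr (lam ^ n))"
proof -
  obtain C m where C: "C > 0" and m: "m > 1" and ev: "\<forall>\<^sub>F n in sequentially.
    exp (C * m ^ n) \<le> 2 * ((r n - l n) / (if even n then X3 - r n else l n - X4))"
    using Q.preimage_scaling_doubly_exponential l1 l2 assms by blast
  have "filterlim (\<lambda>n. m ^ n) at_top sequentially"
    using m by (intro filterlim_at_infinity_imp_filterlim_at_top filterlim_realpow_sequentially_gt1) auto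
  \<comment> \<open>Once \<open>C * m ^ n \<ge> 2\<close>, half of the exponent absorbs the factor
    \<open>2 \<le> exp 1\<close>. This is the origin of the base
    \<open>exp (- C / 2)\<close>.\<close>
  then have big: "\<forall>\<^sub>F n in sequentially. 2 / C \<le> m ^ n" by (simp add: filterlim_at_top)
  have "\<forall>\<^sub>F n in sequentially. scaling_ratio l1 l2 f n \<le> exp (- C / 2) powr (m ^ n)"
    using ev big eventually_ge_at_top[of 2]
  proof eventually_elim
    case (elim n)
    define D where "D = (if even n then X3 - r n else l n - X4)"
    have D: "0 < D" and lr: "l n < r n"
      using preimage_left[of n] preimage_right[of n] elim by (cases "even n"; force simp: D_def)+
    have "scaling_ratio l1 l2 f n \<le> D / (r n - l n)" unfolding D_def by (rule scaling_ratio_le) (rule elim)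
    also have "\<dots> \<le> 2 * exp (- (C * m ^ n))"
    proof -
      have "exp (C * m ^ n) \<le> 2 * ((r n - l n) / D)" using elim(1) by (simp add: D_def)
      then have "D * exp (C * m ^ n) \<le> 2 * (r n - l n)" using D by (simp add: field_simps)
      then show ?thesis using lr by (simp add: exp_minus field_simps)
    qed
    also have "\<dots> \<le> exp 1 * exp (- (C * m ^ n))"
      using exp_ge_add_one_self[of 1] by (intro mult_right_mono) auto
    also have "\<dots> \<le> exp (- C / 2 * m ^ n)"
      unfolding exp_add[symmetric] using elim(2) C by (simp add: field_simps)
    also have "\<dots> = exp (- C / 2) powr (m ^ n)" by (simp add: powr_def mult.commute)
    finally show ?case .
  qed
  then show ?thesis using C m by (intro exI[of _ "exp (- C / 2)"] exI[of _ m]) auto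
qed

end

section \<open>Normalisation of an arbitrary lift\<close>

lemma (in flat_circle_map) lift_iter_shift:
  assumes "is_lift l1 l2 f G"
  shows "((\<lambda>y. G y - of_int k * c) ^^ n) y = (G ^^ n) y - of_nat n * of_int k * c"
proof (induction n)
  case (Suc n)
  have "G (y + c) = G y + c" for y using assms by (simp add: is_lift_def)
  from add_int_period[of G c, OF this, of "(G ^^ n) y" "- (int n * k)"]
  have "G ((G ^^ n) y - of_nat n * of_int k * c) = G ((G ^^ n) y) - of_nat n * of_int k * c" by simp
  moreover have "((\<lambda>y. G y - of_int k * c) ^^ Suc n) y = G (((\<lambda>y. G y - of_int k * c) ^^ n) y) - of_int k * c"
    by simp
  ultimately show ?case unfolding Suc by (simp add: algebra_simps)
qed simp

text \<open>\<open>F\<close> does not move \<open>X1\<close> to the left and moves 0 by at most one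
  period; both bounds persist under iteration. They make it possible to recover the rotation number
  of \<open>F\<close> from its fractional part.\<close>

lemma (in flat_circle_lift) rotation_number_bounds:
  assumes lim: "\<And>y. (\<lambda>n. ((F ^^ n) y - y) / (real n * c)) \<longlonglongrightarrow> \<rho>"
  shows "0 \<le> \<rho>" "\<rho> \<le> 1"
proof -
  have mono: "y \<le> z \<Longrightarrow> (F ^^ j) y \<le> (F ^^ j) z" for y z j by (induction j) (auto intro: F_le)
  have lo: "X1 \<le> (F ^^ n) X1" for n
  proof (induction n)
    case (Suc n)
    have "X1 \<le> F X1" using F_B1[of X1] B1_ends ordX by simp
    also have "\<dots> \<le> F ((F ^^ n) X1)" using Suc by (rule F_le)
    finally show ?case by simp
  qed simp
  have hi: "(F ^^ n) 0 \<le> of_nat n * c" for n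
  proof (induction n)
    case (Suc n)
    have "(F ^^ Suc n) 0 \<le> F (0 + of_int (int n) * c)" using Suc by (simp add: F_le)
    also have "\<dots> = F 0 + of_nat n * c" using F_shift_int[of 0 "int n"] by simp
    also have "F 0 \<le> c" using F_B1[of 0] B1_ends ordX by (simp add: c_eq)
    finally show ?case by (simp add: algebra_simps)
  qed simp
  show "0 \<le> \<rho>"
    by (rule LIMSEQ_le_const[OF lim[of X1]]) (use lo c_pos in \<open>auto intro!: exI[of _ 0]\<close>)
  show "\<rho> \<le> 1"
  proof (rule LIMSEQ_le_const2[OF lim[of 0]], intro exI allI impI)
    fix n :: nat assume "1 \<le> n"
    then show "((F ^^ n) 0 - 0) / (real n * c) \<le> 1" using hi[of n] c_pos by simp
  qed
qed

lemma (in flat_circle_lift) iter_surj: "\<exists>y. (F ^^ j) y = t"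
proof -
  note sh = iter_add_int_period[of F c, OF F_shift]
  define k where "k = \<lceil>\<bar>t - (F ^^ j) 0\<bar> / c\<rceil>"
  have k: "\<bar>t - (F ^^ j) 0\<bar> \<le> of_int k * c"
  proof -
    have "\<bar>t - (F ^^ j) 0\<bar> / c \<le> of_int k" unfolding k_def by (rule le_of_int_ceiling)
    then show ?thesis using c_pos by (simp add: pos_divide_le_eq)
  qed
  have "\<exists>y. 0 + of_int (- k) * c \<le> y \<and> y \<le> 0 + of_int k * c \<and> (F ^^ j) y = t"
  proof (rule IVT')
    show "(F ^^ j) (0 + of_int (- k) * c) \<le> t" "t \<le> (F ^^ j) (0 + of_int k * c)"
      using k unfolding sh by auto
    show "0 + of_int (- k) * c \<le> 0 + of_int k * c" using k by simp
  qed (rule continuous_on_iter[OF F_cont])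
  then show ?thesis by blast
qed

theorem lemma1p1:
  fixes l1 l2 :: real and f :: flat_tuple
  assumes "1 < l1" and "l1 < 2" and "1 < l2" and "l2 < 2"
    and "f \<in> W_fib l1 l2"
  shows "\<exists>\<kappa> lam :: real. 0 < \<kappa> \<and> \<kappa> < 1 \<and> 1 < lam \<and>
    (\<forall>\<^sub>F n in sequentially. scaling_ratio l1 l2 f n \<le> \<kappa> powr (lam ^ n))"
proof -
  interpret flat_circle_map l1 l2 f
    using assms by unfold_locales (auto simp: W_fib_def)
  have "has_rotation_number l1 l2 f golden_mean" "negative_schwarzian l1 l2 f"
    using assms by (auto simp: W_fib_def)
  then obtain G \<rho> H where G: "is_lift l1 l2 f G"
      "\<And>y. (\<lambda>n. ((G ^^ n) y - y) / (real n * c)) \<longlonglongrightarrow> \<rho>" "golden_mean = frac \<rho>"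
    and H: "is_lift l1 l2 f H"
      "\<And>y. thrice_differentiable_at H y \<Longrightarrow> deriv H y \<noteq> 0 \<Longrightarrow> schwarzian H y < 0"
    unfolding has_rotation_number_def negative_schwarzian_def by blast
  \<comment> \<open>\<open>G\<close> carries the rotation number and \<open>H\<close> the Schwarzian
    condition. They need not be the same lift, so each is compared with the branches
    separately.\<close>
  obtain k :: int where k: "\<And>y. y \<in> {X1..0} \<Longrightarrow> G y = B1 y + of_int k * c"
    "\<And>y. y \<in> {0..1} \<Longrightarrow> G y = circ y + of_int k * c + c"
    using lift_eq[OF G(1)] by blast
  obtain m :: int where m: "\<And>y. y \<in> {X1..0} \<Longrightarrow> H y = B1 y + of_int m * c"
    "\<And>y. y \<in> {0..1} \<Longrightarrow> H y = circ y + of_int m * c + c"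
    using lift_eq[OF H(1)] by blast
  define F where "F y = G y - of_int k * c" for y
  interpret flat_circle_lift l1 l2 f F
  proof
    show "continuous_on UNIV F"
      unfolding F_def using G(1) by (intro continuous_intros) (auto simp: is_lift_def)
    show "F (y + c) = F y + c" for y using G(1) by (simp add: F_def is_lift_def)
  qed (use k in \<open>auto simp: F_def\<close>)
  have F_iter: "(F ^^ n) y = (G ^^ n) y - of_nat n * of_int k * c" for n y
    using lift_iter_shift[OF G(1)] unfolding F_def[abs_def] .
  have lim: "(\<lambda>n. ((F ^^ n) y - y) / (real n * c)) \<longlonglongrightarrow> \<rho> - of_int k" for y
  proof (rule Lim_transform_eventually)
    show "(\<lambda>n. ((G ^^ n) y - y) / (real n * c) - of_int k) \<longlonglongrightarrow> \<rho> - of_int k"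
      by (intro tendsto_intros G(2))
    show "\<forall>\<^sub>F n in sequentially. ((G ^^ n) y - y) / (real n * c) - of_int k = ((F ^^ n) y - y) / (real n * c)"
      using eventually_gt_at_top[of 0]
      by eventually_elim (use c_pos in \<open>simp add: F_iter field_simps\<close>)
  qed
  have rho: "\<rho> - of_int k = golden_mean"
  proof -
    have "\<rho> - of_int k = golden_mean + of_int (\<lfloor>\<rho>\<rfloor> - k)" using G(3) by (simp add: frac_def)
    \<comment> \<open>Both \<open>\<rho> - of_int k\<close> and \<open>golden_mean\<close> lie in
      \<open>[0, 1]\<close>, the latter strictly inside, so an integer difference must be
      zero.\<close>
    moreover have "\<lfloor>\<rho>\<rfloor> - k = 0"
      using rotation_number_bounds[OF lim] golden_mean_props calculation by linarith
    ultimately show ?thesis by simp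
  qed
  \<comment> \<open>The choice is harmless: an iterate is strictly monotone at points that it sends
    into a translate of the closed flat piece, so the preimage is unique.\<close>
  define l where "l n = (SOME y. (F ^^ fib (Suc n)) y = X3 + real (fib n) * c)" for n
  have l: "(F ^^ fib (Suc n)) (l n) = X3 + real (fib n) * c" for n
    unfolding l_def by (rule someI_ex[OF iter_surj])
  define r where "r n = (SOME y. (F ^^ fib (Suc n)) y = X4 + real (fib n) * c)" for n
  have r: "(F ^^ fib (Suc n)) (r n) = X4 + real (fib n) * c" for n
    unfolding r_def by (rule someI_ex[OF iter_surj])
  interpret golden_circle_lift l1 l2 f F l r
  proof
    show "(\<lambda>n. ((F ^^ n) y - y) / (real n * c)) \<longlonglongrightarrow> golden_mean" for y using lim unfolding rho .
    show "decreases_cross_ratio X1 0 B1"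
      by (rule neg_schwarzian_branch[OF B1_D3 B1_cont _ _ H(2), of "of_int m * c"]) (use B1_mono m in auto)
    show "decreases_cross_ratio 0 X3 B2"
      by (rule neg_schwarzian_branch[OF B2_D3 B2_cont _ _ H(2), of "of_int m * c + c"])
         (use B2_mono m(2) circ_B2 ordX in auto)
    show "decreases_cross_ratio X4 1 B4"
      by (rule neg_schwarzian_branch[OF B4_D3 B4_cont _ _ H(2), of "of_int m * c + c"])
         (use B4_mono m(2) circ_B4 ordX in auto)
  qed (rule l r)+
  show ?thesis by (rule scaling_ratio_doubly_exponential) (fact assms)+
qed

end
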